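(* Let $r,n\ge 1$ be integers and let $\tau$ be an analyzing Taylorlet of order $n$ with $r$ vanishing moments. Let $j\ge 0$ be an integer with $j<r$, let $t\in\mathbb R$, and let $f$ be a $j$-feasible function with singularity function $q\in C^\infty(\mathbb R)$, where $f$ is a tempered distribution. Let $s=(s_0,\dots,s_n)\in\mathbb R^{n+1}$. 1. Let $\alpha>0$. If $s_0\neq q(t)$, then for all $N>0$ $$\mathcal T^{(n,\alpha)}f(a,s,t)=\mathcal O(a^N)\quad\text{for } a\to 0.$$ 2. Let $0<\alpha<\frac1n$ and let $k\in\{0,\dots,n-1\}$ be the highest approximation order of $s$ for $f$ in $t$. Then $$\mathcal T^{(n,\alpha)}f(a,s,t)=\mathcal O\!\left(a^{\,j+(\alpha-1)/2+(r-j)[1-(k+1)\alpha]}\right)\quad\text{for } a\to 0.$$ 3. Let $\alpha>\frac1{n+1}$ and let $\tau$ be restrictive. If $n$ is the highest approximation order of $s$ for $f$ in $t$, then $$\mathcal T^{(n,\alpha)}f(a,s,t)\sim a^{\,j+(\alpha-1)/2}\quad\text{for } a\to 0.$$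
   Context: $\mathcal S$, $\mathcal S'$ denote Schwartz functions and tempered distributions. All limits $a\to0$ are with $a>0$. $F(a)\sim a^p$ for $a\to 0$ means exact order: there are $c,C,a_0>0$ with $c\,a^p\le |F(a)|\le C\,a^p$ for all $0<a<a_0$. Iterated integrals: $I_+\varphi(u):=\int_{-\infty}^u\varphi(v)\,dv$, $I_-\varphi(u):=\int_u^\infty\varphi(v)\,dv$, $I_\pm^0\varphi=\varphi$, $I_\pm^{k+1}\varphi=I_\pm(I_\pm^k\varphi)$. Applied to the Dirac delta $\delta$ on $\mathbb R$: $I_\pm^0\delta=\delta$ and, for $j\ge1$, $I_\pm^j\delta(u)=\frac{(\pm u)^{j-1}}{(j-1)!}H(\pm u)$ with $H=\mathbf 1_{(0,\infty)}$. Feasible function: for an integer $j\ge0$ and $q\in C^\infty(\mathbb R)$ (real-valued), $f(x)=(I_\pm^j\delta)(x_1-q(x_2))$ on $\mathbb R^2$ (either choice of sign) is called a $j$-feasible function with singularity function $q$. For $j=0$, $f=\delta(x_1-q(x_2))$ acts by $\langle f,\varphi\rangle=\int_{\mathbb R}\varphi(q(x_2),x_2)\,dx_2$. Vanishing moments of higher order: $g:\mathbb R\to\mathbb R$ has $r$ vanishing moments of order $n$ if, for both signs, $\int_{\mathbb R}g(\pm t^k)t^m\,dt=0$ for all $k\in\{1,\dots,n\}$ and all $m\in\{0,\dots,kr-1\}$. Analyzing Taylorlet of order $n$ with $r$ vanishing moments: $\tau=g\otimes h$, i.e. $\tau(x_1,x_2)=g(x_1)h(x_2)$, with $g,h\in\mathcal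 S(\mathbb R)$ and $g$ having $r$ vanishing moments of order $n$. It is restrictive if additionally $I_+^jg(0)\ne0$ for all $j\in\{0,\dots,r\}$ and $\int_{\mathbb R}h(t)\,dt\neq0$. Taylorlet transform: for $\alpha>0$, $a>0$, $s=(s_0,\dots,s_n)\in\mathbb R^{n+1}$, $t\in\mathbb R$, $$\tau^{(n,\alpha)}_{a,s,t}(x):=a^{-(1+\alpha)/2}\,\tau\!\left(\frac{x_1-\sum_{\ell=0}^n\frac{s_\ell}{\ell!}(x_2-t)^\ell}{a},\ \frac{x_2-t}{a^\alpha}\right),\qquad x\in\mathbb R^2,$$ and for $f\in\mathcal S'(\mathbb R^2)$, $\mathcal T^{(n,\alpha)}f(a,s,t):=\langle f,\tau^{(n,\alpha)}_{a,s,t}\rangle$. Highest approximation order: for $k\in\{0,\dots,n-1\}$, $k$ is the highest approximation order of $s=(s_0,\dots,s_n)$ for $f$ in $t$ if $s_\ell=q^{(\ell)}(t)$ for all $\ell\in\{0,\dots,k\}$ and $s_{k+1}\neq q^{(k+1)}(t)$. The number $n$ is the highest approximation order of $s$ for $f$ in $t$ if $s_\ell=q^{(\ell)}(t)$ for all $\ell\in\{0,\dots,n\}$. *)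

theory Defs
  imports "HOL-Analysis.Analysis" "HOL-Library.Landau_Symbols"
begin

section \<open>Schwartz functions and tempered distributions\<close>

text \<open>
  Everything in this section is stated over a Euclidean space, so that the same notions serve
  for functions on the line and on the plane.
\<close>

primrec dir_derivs ::
  "'a::euclidean_space list \<Rightarrow> ('a \<Rightarrow> 'b::real_normed_vector) \<Rightarrow> 'a \<Rightarrow> 'b" where
  "dir_derivs [] f = f"
| "dir_derivs (v # vs) f = (\<lambda>x. frechet_derivative (dir_derivs vs f) (at x) v)"

text \<open>
  Differentiability of all iterated partial derivatives makes them all continuous, so the
  following is \<open>C\<^sup>\<infinity>\<close> on the whole space.
\<close>

definition smooth :: "('a::euclidean_space \<Rightarrow> 'b::real_normed_vector) \<Rightarrow> bool" where
  "smooth f \<longleftrightarrow> (\<forall>vs \<in> lists Basis. \<forall>x. dir_derivs vs f differentiable (at x))"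

definition schwartz :: "('a::euclidean_space \<Rightarrow> 'b::real_normed_vector) \<Rightarrow> bool" where
  "schwartz f \<longleftrightarrow> smooth f \<and>
     (\<forall>vs \<in> lists Basis. \<forall>k::nat. bounded (range (\<lambda>x. norm x ^ k *\<^sub>R dir_derivs vs f x)))"

definition schwartz_norm ::
  "nat \<Rightarrow> ('a::euclidean_space \<Rightarrow> 'b::real_normed_vector) \<Rightarrow> real" where
  "schwartz_norm N f =
     (\<Sum>k\<le>N. \<Sum>vs | vs \<in> lists Basis \<and> length vs \<le> N.
        (SUP x. norm x ^ k * norm (dir_derivs vs f x)))"

text \<open>
  A tempered distribution is a functional on all functions of which only the restriction to the
  Schwartz space matters: there it is linear and continuous for the locally convex topology
  given by the norms above. As these norms increase with \<open>N\<close>, continuity of a linear functional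
  is domination by one of them.
\<close>

definition tempered_distribution ::
  "(('a::euclidean_space \<Rightarrow> complex) \<Rightarrow> complex) \<Rightarrow> bool" where
  "tempered_distribution T \<longleftrightarrow>
     (\<forall>\<phi> \<psi>. schwartz \<phi> \<longrightarrow> schwartz \<psi> \<longrightarrow> T (\<lambda>x. \<phi> x + \<psi> x) = T \<phi> + T \<psi>) \<and>
     (\<forall>c \<phi>. schwartz \<phi> \<longrightarrow> T (\<lambda>x. c * \<phi> x) = c * T \<phi>) \<and>
     (\<exists>C N. \<forall>\<phi>. schwartz \<phi> \<longrightarrow> norm (T \<phi>) \<le> C * schwartz_norm N \<phi>)"

definition test_function :: "('a::euclidean_space \<Rightarrow> complex) \<Rightarrow> bool" where
  "test_function \<phi> \<longleftrightarrow> smooth \<phi> \<and> (\<exists>K. compact K \<and> (\<forall>x. x \<notin> K \<longrightarrow> \<phi> x = 0))"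


section \<open>Feasible functions\<close>

text \<open>
  The \<open>j\<close>-fold iterated integral of the Dirac delta for \<open>j \<ge> 1\<close>, where \<open>\<sigma> = 1\<close> stands
  for \<open>I\<^sub>+\<close> and \<open>\<sigma> = -1\<close> for \<open>I\<^sub>-\<close>. The case \<open>j = 0\<close> is the delta itself and is treated
  separately in the pairing.
\<close>

definition iter_int_delta :: "real \<Rightarrow> nat \<Rightarrow> real \<Rightarrow> real" where
  "iter_int_delta \<sigma> j u =
     (\<sigma> * u) ^ (j - 1) / fact (j - 1) * indicator {0<..} (\<sigma> * u)"

definition feasible_pairing ::
  "real \<Rightarrow> nat \<Rightarrow> (real \<Rightarrow> real) \<Rightarrow> (real \<times> real \<Rightarrow> complex) \<Rightarrow> complex" where
  "feasible_pairing \<sigma> j q \<phi> =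
     (if j = 0 then LINT y|lborel. \<phi> (q y, y)
      else LINT x|lborel. of_real (iter_int_delta \<sigma> j (fst x - q (snd x))) * \<phi> x)"

text \<open>
  The pairing is prescribed on compactly supported test functions only, where the integral always
  converges. A tempered distribution is determined by its values there.
\<close>

definition feasible ::
  "nat \<Rightarrow> (real \<Rightarrow> real) \<Rightarrow> ((real \<times> real \<Rightarrow> complex) \<Rightarrow> complex) \<Rightarrow> bool" where
  "feasible j q f \<longleftrightarrow> smooth q \<and>
     (\<exists>\<sigma> \<in> {1, -1}. \<forall>\<phi>. test_function \<phi> \<longrightarrow> f \<phi> = feasible_pairing \<sigma> j q \<phi>)"


section \<open>Taylorlets\<close>

definition vanishing_moments :: "nat \<Rightarrow> nat \<Rightarrow> (real \<Rightarrow> real) \<Rightarrow> bool" where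
  "vanishing_moments n r g \<longleftrightarrow>
     (\<forall>\<sigma> \<in> {1, -1}. \<forall>k \<in> {1..n}. \<forall>m < k * r. (LINT t|lborel. g (\<sigma> * t ^ k) * t ^ m) = 0)"

definition tensor :: "(real \<Rightarrow> real) \<Rightarrow> (real \<Rightarrow> complex) \<Rightarrow> real \<times> real \<Rightarrow> complex" where
  "tensor g h x = of_real (g (fst x)) * h (snd x)"

definition analyzing_taylorlet :: "nat \<Rightarrow> nat \<Rightarrow> (real \<times> real \<Rightarrow> complex) \<Rightarrow> bool" where
  "analyzing_taylorlet n r \<tau> \<longleftrightarrow>
     (\<exists>g h. \<tau> = tensor g h \<and> schwartz g \<and> schwartz h \<and> vanishing_moments n r g)"

definition int_plus :: "(real \<Rightarrow> real) \<Rightarrow> real \<Rightarrow> real" where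
  "int_plus \<phi> u = (LINT v:{..u}|lborel. \<phi> v)"

definition restrictive_taylorlet :: "nat \<Rightarrow> nat \<Rightarrow> (real \<times> real \<Rightarrow> complex) \<Rightarrow> bool" where
  "restrictive_taylorlet n r \<tau> \<longleftrightarrow>
     (\<exists>g h. \<tau> = tensor g h \<and> schwartz g \<and> schwartz h \<and> vanishing_moments n r g \<and>
        (\<forall>j\<le>r. (int_plus ^^ j) g 0 \<noteq> 0) \<and> (LINT t|lborel. h t) \<noteq> 0)"

text \<open>
  The shear parameter, a vector with entries \<open>s\<^sub>0, \<dots>, s\<^sub>n\<close>, is a function on the natural
  numbers whose values beyond \<open>n\<close> are ignored.
\<close>

definition taylorlet ::
  "nat \<Rightarrow> real \<Rightarrow> (real \<times> real \<Rightarrow> complex) \<Rightarrow> real \<Rightarrow> (nat \<Rightarrow> real) \<Rightarrow> real \<Rightarrow>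
   real \<times> real \<Rightarrow> complex" where
  "taylorlet n \<alpha> \<tau> a s t x =
     of_real (a powr (- (1 + \<alpha>) / 2)) *
     \<tau> ((fst x - (\<Sum>l\<le>n. s l / fact l * (snd x - t) ^ l)) / a, (snd x - t) / a powr \<alpha>)"

definition taylorlet_transform ::
  "nat \<Rightarrow> real \<Rightarrow> (real \<times> real \<Rightarrow> complex) \<Rightarrow> ((real \<times> real \<Rightarrow> complex) \<Rightarrow> complex) \<Rightarrow>
   real \<Rightarrow> (nat \<Rightarrow> real) \<Rightarrow> real \<Rightarrow> complex" where
  "taylorlet_transform n \<alpha> \<tau> f a s t = f (taylorlet n \<alpha> \<tau> a s t)"

definition highest_approx_order ::
  "nat \<Rightarrow> (real \<Rightarrow> real) \<Rightarrow> (nat \<Rightarrow> real) \<Rightarrow> real \<Rightarrow> nat \<Rightarrow> bool" where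
  "highest_approx_order n q s t k \<longleftrightarrow>
     k \<le> n \<and> (\<forall>l\<le>k. s l = (deriv ^^ l) q t) \<and>
     (k < n \<longrightarrow> s (Suc k) \<noteq> (deriv ^^ Suc k) q t)"

definition exact_order :: "(real \<Rightarrow> complex) \<Rightarrow> real \<Rightarrow> bool" where
  "exact_order F p \<longleftrightarrow>
     (\<exists>c>0. \<exists>C>0. \<exists>a0>0. \<forall>a. 0 < a \<and> a < a0 \<longrightarrow>
        c * a powr p \<le> norm (F a) \<and> norm (F a) \<le> C * a powr p)"

end

theory Submission
  imports Defs "HOL-Probability.Sinc_Integral" "HOL-Computational_Algebra.Polynomial"
begin

text \<open>
  Put \<open>p y = q (y + t) - (\<Sum>l\<le>n. s l / fact l * y ^ l)\<close>, the deviation of the singularity curve from the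
  shearing curve. The Taylorlet \<open>g \<otimes> h\<close> is concentrated, at scale \<open>a\<close>, where \<open>x\<^sub>1\<close> is near the shearing curve
  and \<open>x\<^sub>2\<close> is near \<open>t\<close>. A smooth cutoff in both variables therefore changes it only by a function whose
  Schwartz norms are \<open>O(a ^ N)\<close> for every \<open>N\<close>. A tempered distribution does not see such a change
  (\<open>localization\<close>), whereas on the compactly supported part the distribution is the explicit
  integral against the feasible function, irrespective of the growth of \<open>q\<close>.

  In that integral the \<open>j\<close>-fold integral of the delta is moved to the other factor
  (\<open>delta_adjoint_nderiv\<close>): the vanishing moments of \<open>g\<close> make \<open>A = I\<^sub>+\<^sup>j g\<close> again a Schwartz function,
  so that integration by parts leaves no boundary terms at infinity. Up to a sign
  and up to \<open>O(a ^ N)\<close>, the transform equals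
  \<open>a powr (j - (1 + \<alpha>) / 2)\<close> times the one-dimensional integral
  \<open>J a = (LINT y. A (p y / a) * \<kappa> (y / \<delta>) * h (y / a powr \<alpha>))\<close>
  (\<open>taylorlet_transform_representation\<close>). The three claims are three ways in which \<open>p\<close> can behave at \<open>0\<close>.

  If \<open>p 0 \<noteq> 0\<close>, then \<open>p y / a\<close> is at least of size \<open>c / a\<close> near \<open>0\<close> and \<open>A\<close> decays
  (\<open>local_integral_off_curve\<close>). If \<open>p\<close> vanishes to order \<open>n\<close>, then \<open>p y / a\<close> tends to \<open>0\<close> on the scale
  \<open>y \<approx> a powr \<alpha>\<close> because \<open>\<alpha> (n + 1) > 1\<close>, and \<open>J a\<close> is asymptotic to \<open>a powr \<alpha> * A 0 * (LINT v. h v)\<close>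
  (\<open>local_integral_osculating\<close>); restrictiveness says that this is nonzero.

  In the intermediate case \<open>p y = y ^ K * Q y\<close> with \<open>K = k + 1\<close> and \<open>Q 0 \<noteq> 0\<close>, where \<open>Q\<close> may be taken to be a
  polynomial. With \<open>y = a powr (1 / K) * w\<close> the integrand is \<open>A (w ^ K * Q y)\<close> times a window in \<open>y\<close>. Freezing
  \<open>w\<close> and expanding in \<open>y\<close> at \<open>0\<close>, the coefficient of \<open>y ^ m\<close> is a combination of terms
  \<open>w ^ (K * i)\<close> times the \<open>i\<close>-th derivative of \<open>A\<close> at \<open>Q 0 * w ^ K\<close>. Multiplied by \<open>w ^ m\<close>, these integrate to \<open>0\<close> as
  long as \<open>m < K * (r - j)\<close>: integration by parts reduces them to moments of \<open>A\<close>, which inherits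
  \<open>r - j\<close> vanishing moments of order \<open>n\<close> from \<open>g\<close>. Each of the \<open>K * (r - j)\<close> powers of \<open>y\<close> gained in this way is worth
  \<open>a powr (1 / K)\<close>, and each costs a derivative of the window, that is \<open>a powr (- \<alpha>)\<close>
  (\<open>polynomial_curve_integral\<close>, \<open>local_integral_partial_contact\<close>).
\<close>

section \<open>Higher derivatives on the line\<close>

definition nderiv :: "nat \<Rightarrow> (real \<Rightarrow> 'b::real_normed_vector) \<Rightarrow> real \<Rightarrow> 'b" where
  "nderiv m f = dir_derivs (replicate m 1) f"

lemma nderiv_0 [simp]: "nderiv 0 f = f"
  by (simp add: nderiv_def)

lemma lists_Basis_real: "vs \<in> lists (Basis :: real set) \<longleftrightarrow> vs = replicate (length vs) 1"
  by (induction vs) auto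

text \<open>
  On the line a derivative is determined by its value at \<open>1\<close>, so that the iterated Frechet derivatives in the
  definition of smoothness are ordinary higher derivatives.
\<close>

lemma differentiable_iff_vector_derivative_frechet:
  fixes f :: "real \<Rightarrow> 'b::real_normed_vector"
  shows "f differentiable (at x) \<longleftrightarrow>
    (f has_vector_derivative frechet_derivative f (at x) 1) (at x)"
proof
  assume *: "f differentiable (at x)"
  then have d: "(f has_derivative frechet_derivative f (at x)) (at x)"
    by (simp add: frechet_derivative_works)
  then have "linear (frechet_derivative f (at x))"
    by (rule has_derivative_linear)
  then have "frechet_derivative f (at x) = (\<lambda>h. h *\<^sub>R frechet_derivative f (at x) 1)"
    by (metis linear_scale mult.right_neutral real_scaleR_def)
  with d show "(f has_vector_derivative frechet_derivative f (at x) 1) (at x)"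
    unfolding has_vector_derivative_def by simp
next
  assume "(f has_vector_derivative frechet_derivative f (at x) 1) (at x)"
  then show "f differentiable (at x)"
    unfolding has_vector_derivative_def differentiable_def by blast
qed

lemma smooth_real_iff:
  fixes f :: "real \<Rightarrow> 'b::real_normed_vector"
  shows "smooth f \<longleftrightarrow> (\<forall>m x. (nderiv m f has_vector_derivative nderiv (Suc m) f x) (at x))"
proof -
  have "smooth f \<longleftrightarrow> (\<forall>m x. nderiv m f differentiable (at x))"
    unfolding smooth_def nderiv_def
    by (metis length_replicate lists_Basis_real)
  then show ?thesis
    by (simp add: differentiable_iff_vector_derivative_frechet nderiv_def)
qed

lemma nderiv_has_vector_derivative:
  "smooth f \<Longrightarrow> (nderiv m f has_vector_derivative nderiv (Suc m) f x) (at x)"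
  by (simp add: smooth_real_iff)

text \<open>
  The usual way of computing \<open>nderiv\<close> below: any chain of successive derivatives that starts at \<open>f\<close> is the
  sequence of higher derivatives of \<open>f\<close>.
\<close>

lemma nderiv_eqI:
  fixes f :: "real \<Rightarrow> 'b::real_normed_vector"
  assumes "D 0 = f" and D: "\<And>m x. (D m has_vector_derivative D (Suc m) x) (at x)"
  shows "nderiv m f = D m"
proof (induction m)
  case 0
  then show ?case by (simp add: assms)
next
  case (Suc m)
  have "nderiv (Suc m) f = (\<lambda>x. frechet_derivative (nderiv m f) (at x) 1)"
    by (simp add: nderiv_def)
  also have "\<dots> = D (Suc m)"
  proof
    fix x
    have "(D m has_derivative (\<lambda>h. h *\<^sub>R D (Suc m) x)) (at x)"
      using D unfolding has_vector_derivative_def .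
    then have "frechet_derivative (D m) (at x) = (\<lambda>h. h *\<^sub>R D (Suc m) x)"
      by (metis frechet_derivative_at)
    then show "frechet_derivative (nderiv m f) (at x) 1 = D (Suc m) x"
      by (simp add: Suc)
  qed
  finally show ?case .
qed

lemma smoothI:
  fixes f :: "real \<Rightarrow> 'b::real_normed_vector"
  assumes "D 0 = f" and "\<And>m x. (D m has_vector_derivative D (Suc m) x) (at x)"
  shows "smooth f"
  unfolding smooth_real_iff using nderiv_eqI[of D f] assms by metis

lemma nderiv_add: "smooth f \<Longrightarrow> nderiv m (nderiv l f) = nderiv (m + l) f"
  by (rule nderiv_eqI) (auto intro: nderiv_has_vector_derivative)

lemma smooth_nderiv: "smooth f \<Longrightarrow> smooth (nderiv l f)"
  by (rule smoothI[of "\<lambda>m. nderiv (m + l) f"]) (auto intro: nderiv_has_vector_derivative)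

lemma continuous_nderiv: "smooth f \<Longrightarrow> continuous_on A (nderiv m f)"
  using nderiv_has_vector_derivative[of f m]
  by (meson continuous_at_imp_continuous_on has_vector_derivative_continuous)

lemma smooth_continuous: "smooth f \<Longrightarrow> continuous_on A (f :: real \<Rightarrow> 'b::real_normed_vector)"
  using continuous_nderiv[of f A 0] by simp

lemma nderiv_field_derivative:
  "smooth (f :: real \<Rightarrow> real) \<Longrightarrow> (nderiv m f has_real_derivative nderiv (Suc m) f x) (at x)"
  by (simp add: has_real_derivative_iff_has_vector_derivative nderiv_has_vector_derivative)

lemma continuous_interval_bounded:
  fixes f :: "real \<Rightarrow> real"
  assumes "continuous_on {-R..R} f"
  obtains B where "\<And>u. \<bar>u\<bar> \<le> R \<Longrightarrow> \<bar>f u\<bar> \<le> B"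
proof -
  have "bounded (f ` {-R..R})" using assms by (intro compact_imp_bounded compact_continuous_image) auto
  then obtain B where "\<And>u. u \<in> {-R..R} \<Longrightarrow> \<bar>f u\<bar> \<le> B"
    by (metis (no_types, lifting) bounded_iff imageI real_norm_def)
  then show ?thesis using that[of B] by (simp add: abs_le_iff)
qed

lemma higher_deriv_eq_nderiv:
  "smooth (f :: real \<Rightarrow> real) \<Longrightarrow> (deriv ^^ m) f = nderiv m f"
proof (induction m)
  case (Suc m)
  then have "(deriv ^^ Suc m) f = deriv (nderiv m f)" by simp
  also have "\<dots> = nderiv (Suc m) f"
    using nderiv_field_derivative[OF Suc.prems] by (metis DERIV_imp_deriv ext)
  finally show ?case .
qed simp

lemma smooth_vanishing_nderiv:
  fixes f :: "real \<Rightarrow> 'b::real_normed_vector"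
  assumes "smooth f" "open U" "\<And>x. x \<in> U \<Longrightarrow> f x = 0" "x \<in> U"
  shows "nderiv m f x = 0"
  using assms(4)
proof (induction m arbitrary: x)
  case (Suc m)
  have "((\<lambda>_. 0) has_vector_derivative nderiv (Suc m) f x) (at x)"
    by (rule has_vector_derivative_transform_within_open[OF
          nderiv_has_vector_derivative[OF assms(1)] assms(2) Suc.prems]) (auto simp: Suc.IH)
  then show ?case
    using vector_derivative_unique_at has_vector_derivative_const by blast
qed (auto simp: assms)

lemma smooth_affine:
  fixes f :: "real \<Rightarrow> 'b::real_normed_vector"
  assumes "smooth f"
  shows "smooth (\<lambda>x. f (c * x + d))"
    and "nderiv m (\<lambda>x. f (c * x + d)) = (\<lambda>x. c ^ m *\<^sub>R nderiv m f (c * x + d))"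
proof -
  let ?D = "\<lambda>m x. c ^ m *\<^sub>R nderiv m f (c * x + d)"
  have *: "(?D m has_vector_derivative ?D (Suc m) x) (at x)" for m x
  proof -
    have "((\<lambda>x. c * x + d) has_vector_derivative c) (at x)"
      by (auto intro!: derivative_eq_intros simp flip: has_real_derivative_iff_has_vector_derivative)
    from vector_diff_chain_at[OF this nderiv_has_vector_derivative[OF assms, of m]]
    have "((\<lambda>x. nderiv m f (c * x + d)) has_vector_derivative c *\<^sub>R nderiv (Suc m) f (c * x + d)) (at x)"
      by (simp add: o_def)
    from bounded_linear.has_vector_derivative[OF bounded_linear_scaleR_right this, of "c ^ m"]
    show ?thesis by (simp add: mult.commute)
  qed
  show "smooth (\<lambda>x. f (c * x + d))" by (rule smoothI[of ?D, OF _ *]) auto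
  show "nderiv m (\<lambda>x. f (c * x + d)) = ?D m" by (rule nderiv_eqI[of ?D, OF _ *]) auto
qed

lemma smooth_add:
  fixes f g :: "real \<Rightarrow> 'b::real_normed_vector"
  assumes "smooth f" "smooth g"
  shows "smooth (\<lambda>x. f x + g x)" "nderiv m (\<lambda>x. f x + g x) = (\<lambda>x. nderiv m f x + nderiv m g x)"
proof -
  let ?D = "\<lambda>m x. nderiv m f x + nderiv m g x"
  have *: "(?D m has_vector_derivative ?D (Suc m) x) (at x)" for m x
    using assms by (intro has_vector_derivative_add nderiv_has_vector_derivative)
  show "smooth (\<lambda>x. f x + g x)" by (rule smoothI[of ?D, OF _ *]) auto
  show "nderiv m (\<lambda>x. f x + g x) = ?D m" by (rule nderiv_eqI[of ?D, OF _ *]) auto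
qed

lemma smooth_scaleR:
  fixes f :: "real \<Rightarrow> 'b::real_normed_vector"
  assumes "smooth f"
  shows "smooth (\<lambda>x. c *\<^sub>R f x)" "nderiv m (\<lambda>x. c *\<^sub>R f x) = (\<lambda>x. c *\<^sub>R nderiv m f x)"
proof -
  let ?D = "\<lambda>m x. c *\<^sub>R nderiv m f x"
  have *: "(?D m has_vector_derivative ?D (Suc m) x) (at x)" for m x
    using assms by (intro bounded_linear.has_vector_derivative[OF bounded_linear_scaleR_right]
        nderiv_has_vector_derivative)
  show "smooth (\<lambda>x. c *\<^sub>R f x)" by (rule smoothI[of ?D, OF _ *]) auto
  show "nderiv m (\<lambda>x. c *\<^sub>R f x) = ?D m" by (rule nderiv_eqI[of ?D, OF _ *]) auto
qed

lemma smooth_const: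
  fixes c :: "'b::real_normed_vector"
  shows "smooth (\<lambda>x::real. c)" "nderiv m (\<lambda>x::real. c) = (\<lambda>x. if m = 0 then c else 0)"
proof -
  let ?D = "\<lambda>m x::real. if m = 0 then c else 0"
  have *: "(?D m has_vector_derivative ?D (Suc m) x) (at x)" for m x
    by (cases m) auto
  show "smooth (\<lambda>x::real. c)" by (rule smoothI[of ?D, OF _ *]) auto
  show "nderiv m (\<lambda>x::real. c) = ?D m" by (rule nderiv_eqI[of ?D, OF _ *]) auto
qed

lemma smooth_poly: "smooth (poly p :: real \<Rightarrow> real)" "nderiv m (poly p :: real \<Rightarrow> real) = poly ((pderiv ^^ m) p)"
proof -
  have *: "(poly ((pderiv ^^ m) p) has_vector_derivative poly ((pderiv ^^ Suc m) p) x) (at x)" for m x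
    by (simp add: poly_DERIV flip: has_real_derivative_iff_has_vector_derivative)
  show "smooth (poly p)" by (rule smoothI[of "\<lambda>m. poly ((pderiv ^^ m) p)", OF _ *]) auto
  show "nderiv m (poly p) = poly ((pderiv ^^ m) p)" by (rule nderiv_eqI[of "\<lambda>m. poly ((pderiv ^^ m) p)", OF _ *]) auto
qed

section \<open>Higher derivatives of products and compositions\<close>

text \<open>
  Higher derivatives of \<open>\<gamma> 0 * \<eta> 0\<close>, where \<open>\<eta> (Suc l)\<close> is the derivative of \<open>\<eta> l\<close> and the derivative of
  \<open>\<gamma> i\<close> is \<open>R * \<gamma> (Suc i)\<close> for a fixed polynomial \<open>R\<close>, are sums of products of a polynomial, some \<open>\<gamma> i\<close> and
  some \<open>\<eta> l\<close>. A list of triples records the summands without collecting equal ones: the estimates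
  need only the polynomial growth of the coefficients. One calculus serves for the Leibniz rule (\<open>R = 1\<close>), for functions of
  \<open>x\<^sub>1 - S x\<^sub>2\<close> (\<open>R\<close> is the derivative of \<open>- S\<close>), and for \<open>A (w ^ K * Q y)\<close> with parameter \<open>w\<close>
  (\<open>R\<close> is the derivative of \<open>Q\<close>).
\<close>

definition expansion ::
  "(real poly \<times> nat \<times> nat) list \<Rightarrow> (nat \<Rightarrow> real \<Rightarrow> real) \<Rightarrow> (nat \<Rightarrow> real \<Rightarrow> 'b::real_normed_vector) \<Rightarrow> real \<Rightarrow> 'b"
  where "expansion ts \<gamma> \<eta> y = (\<Sum>(p, i, l)\<leftarrow>ts. (poly p y * \<gamma> i y) *\<^sub>R \<eta> l y)"

definition expansion_deriv ::
  "real poly \<Rightarrow> (real poly \<times> nat \<times> nat) list \<Rightarrow> (real poly \<times> nat \<times> nat) list"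
  where "expansion_deriv R ts =
    concat (map (\<lambda>(p, i, l). [(pderiv p, i, l), (R * p, Suc i, l), (p, i, Suc l)]) ts)"

lemma expansion_simps [simp]:
  "expansion [] \<gamma> \<eta> y = 0"
  "expansion ((p, i, l) # ts) \<gamma> \<eta> y = (poly p y * \<gamma> i y) *\<^sub>R \<eta> l y + expansion ts \<gamma> \<eta> y"
  by (auto simp: expansion_def)

lemma expansion_deriv_simps [simp]:
  "expansion_deriv R [] = []"
  "expansion_deriv R ((p, i, l) # ts) =
    (pderiv p, i, l) # (R * p, Suc i, l) # (p, i, Suc l) # expansion_deriv R ts"
  by (auto simp: expansion_deriv_def)

lemma expansion_has_vector_derivative:
  fixes \<gamma> :: "nat \<Rightarrow> real \<Rightarrow> real" and \<eta> :: "nat \<Rightarrow> real \<Rightarrow> 'b::real_normed_vector"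
  assumes \<gamma>: "\<And>i. (\<gamma> i has_real_derivative poly R y * \<gamma> (Suc i) y) (at y)"
    and \<eta>: "\<And>l. (\<eta> l has_vector_derivative \<eta> (Suc l) y) (at y)"
  shows "(expansion ts \<gamma> \<eta> has_vector_derivative expansion (expansion_deriv R ts) \<gamma> \<eta> y) (at y)"
proof (induction ts)
  case Nil
  then show ?case by (simp add: expansion_def[abs_def])
next
  case (Cons a ts)
  obtain p i l where a: "a = (p, i, l)" by (cases a)
  have "((\<lambda>y. poly p y * \<gamma> i y) has_real_derivative
      poly (pderiv p) y * \<gamma> i y + poly p y * (poly R y * \<gamma> (Suc i) y)) (at y)"
    by (auto intro!: derivative_eq_intros \<gamma> poly_DERIV simp: algebra_simps)
  from has_vector_derivative_scaleR[OF this \<eta>[of l]]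
  have "((\<lambda>y. (poly p y * \<gamma> i y) *\<^sub>R \<eta> l y) has_vector_derivative
     (poly p y * \<gamma> i y) *\<^sub>R \<eta> (Suc l) y +
     (poly (pderiv p) y * \<gamma> i y + poly p y * (poly R y * \<gamma> (Suc i) y)) *\<^sub>R \<eta> l y) (at y)"
    by simp
  from has_vector_derivative_add[OF this Cons]
  show ?case
    by (simp add: a algebra_simps expansion_simps[abs_def])
qed

lemma expansion_deriv_order:
  "(p, i, l) \<in> set (expansion_deriv R ts) \<Longrightarrow>
    \<exists>(p', i', l') \<in> set ts. i \<le> Suc i' \<and> l \<le> Suc l'"
  by (induction ts) auto

lemma funpow_expansion_deriv_order:
  "(p, i, l) \<in> set ((expansion_deriv R ^^ m) [(1, 0, 0)]) \<Longrightarrow> i \<le> m \<and> l \<le> m"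
proof (induction m arbitrary: p i l)
  case (Suc m)
  then have "\<exists>(p', i', l') \<in> set ((expansion_deriv R ^^ m) [(1, 0, 0)]). i \<le> Suc i' \<and> l \<le> Suc l'"
    unfolding funpow.simps o_apply by (rule_tac expansion_deriv_order)
  with Suc.IH show ?case by fastforce
qed auto

lemma nderiv_expansion:
  fixes \<gamma> :: "nat \<Rightarrow> real \<Rightarrow> real" and f :: "real \<Rightarrow> 'b::real_normed_vector"
  assumes \<gamma>: "\<And>i y. (\<gamma> i has_real_derivative poly R y * \<gamma> (Suc i) y) (at y)" and "smooth f"
  shows "smooth (\<lambda>y. \<gamma> 0 y *\<^sub>R f y)"
    and "nderiv m (\<lambda>y. \<gamma> 0 y *\<^sub>R f y) =
      expansion ((expansion_deriv R ^^ m) [(1, 0, 0)]) \<gamma> (\<lambda>l. nderiv l f)"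
proof -
  let ?D = "\<lambda>m. expansion ((expansion_deriv R ^^ m) [(1, 0, 0)]) \<gamma> (\<lambda>l. nderiv l f)"
  have *: "(?D m has_vector_derivative ?D (Suc m) y) (at y)" for m y
    using expansion_has_vector_derivative[of \<gamma> R y "\<lambda>l. nderiv l f"]
      \<gamma> nderiv_has_vector_derivative[OF assms(2)] by simp
  have 0: "?D 0 = (\<lambda>y. \<gamma> 0 y *\<^sub>R f y)" by auto
  show "smooth (\<lambda>y. \<gamma> 0 y *\<^sub>R f y)" by (rule smoothI[of ?D, OF 0 *])
  show "nderiv m (\<lambda>y. \<gamma> 0 y *\<^sub>R f y) = ?D m" by (rule nderiv_eqI[of ?D, OF 0 *])
qed

lemma nderiv_product:
  fixes \<phi> :: "real \<Rightarrow> real" and f :: "real \<Rightarrow> 'b::real_normed_vector"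
  assumes "smooth \<phi>" "smooth f"
  shows "smooth (\<lambda>y. \<phi> y *\<^sub>R f y)"
    and "nderiv m (\<lambda>y. \<phi> y *\<^sub>R f y) =
      expansion ((expansion_deriv 1 ^^ m) [(1, 0, 0)]) (\<lambda>i. nderiv i \<phi>) (\<lambda>l. nderiv l f)"
  using nderiv_expansion[of "\<lambda>i. nderiv i \<phi>" 1 f] nderiv_field_derivative[OF assms(1)] assms(2)
  by auto

text \<open>
  Constants are uniform in the parameter \<open>z\<close>, since the list \<open>ts\<close> does not depend on it.
\<close>

lemma expansion_bound:
  fixes \<gamma> :: "'p \<Rightarrow> nat \<Rightarrow> real \<Rightarrow> real" and \<eta> :: "'p \<Rightarrow> nat \<Rightarrow> real \<Rightarrow> 'b::real_normed_vector"
    and b :: "'p \<Rightarrow> real \<Rightarrow> real"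
  assumes "\<And>p i l. (p, i, l) \<in> set ts \<Longrightarrow>
      \<exists>C. \<forall>z y. P z y \<longrightarrow> norm ((poly p y * \<gamma> z i y) *\<^sub>R \<eta> z l y) \<le> C * b z y"
  shows "\<exists>C. \<forall>z y. P z y \<longrightarrow> norm (expansion ts (\<gamma> z) (\<eta> z) y) \<le> C * b z y"
  using assms
proof (induction ts)
  case Nil
  then show ?case by (auto intro!: exI[of _ 0])
next
  case (Cons a ts)
  obtain p i l where a: "a = (p, i, l)" by (cases a)
  from Cons obtain C1 where 1: "P z y \<Longrightarrow> norm (expansion ts (\<gamma> z) (\<eta> z) y) \<le> C1 * b z y" for z y
    by (metis list.set_intros(2))
  from Cons.prems[of p i l] a obtain C2 where
    2: "P z y \<Longrightarrow> norm ((poly p y * \<gamma> z i y) *\<^sub>R \<eta> z l y) \<le> C2 * b z y" for z y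
    by auto
  show ?case
    unfolding a expansion_simps
    by (intro exI[of _ "C2 + C1"] allI impI norm_triangle_le)
       (use 1 2 in \<open>auto simp: distrib_right intro: add_mono\<close>)
qed

section \<open>Schwartz functions on the line\<close>

text \<open>
  A bound for the seminorm of order \<open>M\<close>, phrased as a relation so that no suprema have to be handled.
\<close>

definition seminorm_le :: "nat \<Rightarrow> (real \<Rightarrow> 'b::real_normed_vector) \<Rightarrow> real \<Rightarrow> bool" where
  "seminorm_le M f A \<longleftrightarrow> (\<forall>i\<le>M. \<forall>u. (1 + \<bar>u\<bar>) ^ M * norm (nderiv i f u) \<le> A)"

lemma seminorm_leD: "seminorm_le M f A \<Longrightarrow> i \<le> M \<Longrightarrow> m \<le> M \<Longrightarrow> (1 + \<bar>u\<bar>) ^ m * norm (nderiv i f u) \<le> A"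
  unfolding seminorm_le_def
  by (rule order.trans[OF mult_right_mono[OF power_increasing[of m M]]]) auto

lemma seminorm_le_nderiv: "seminorm_le M f A \<Longrightarrow> i \<le> M \<Longrightarrow> norm (nderiv i f u) \<le> A"
  using seminorm_leD[of M f A i 0 u] by simp

lemma seminorm_le_mono: "seminorm_le M f A \<Longrightarrow> M' \<le> M \<Longrightarrow> seminorm_le M' f A"
  by (simp add: seminorm_le_def[of M'] seminorm_leD)

lemma seminorm_le_nonneg: "seminorm_le M f A \<Longrightarrow> A \<ge> 0"
  using seminorm_le_nderiv[of M f A 0 0] by (metis le0 norm_ge_zero order.trans)

lemma one_plus_power_le: "(1 + \<bar>u::real\<bar>) ^ M \<le> 2 ^ M * (1 + \<bar>u\<bar> ^ M)"
proof -
  have "(1 + \<bar>u\<bar>) ^ M \<le> (2 * max 1 \<bar>u\<bar>) ^ M" by (rule power_mono) auto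
  also have "\<dots> = 2 ^ M * max 1 \<bar>u\<bar> ^ M" by (rule power_mult_distrib)
  also have "max 1 \<bar>u\<bar> ^ M \<le> 1 + \<bar>u\<bar> ^ M" by (auto simp: max_def)
  finally show ?thesis by simp
qed

lemma schwartz_real_iff:
  fixes f :: "real \<Rightarrow> 'b::real_normed_vector"
  shows "schwartz f \<longleftrightarrow> smooth f \<and> (\<forall>M. \<exists>A. seminorm_le M f A)"
proof safe
  assume f: "schwartz f"
  then show "smooth f" by (simp add: schwartz_def)
  fix M
  have *: "\<exists>A. \<forall>u. (1 + \<bar>u\<bar>) ^ M * norm (nderiv i f u) \<le> A" for i
  proof -
    have b: "bounded (range (\<lambda>x. norm x ^ k *\<^sub>R nderiv i f x))" for k
      using f lists_Basis_real[of "replicate i 1"] unfolding schwartz_def nderiv_def by simp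
    obtain A where A: "norm (nderiv i f u) \<le> A" for u
      using b[of 0] by (auto simp: bounded_iff)
    obtain B where B: "\<bar>u\<bar> ^ M * norm (nderiv i f u) \<le> B" for u
      using b[of M] by (auto simp: bounded_iff power_abs)
    have "(1 + \<bar>u\<bar>) ^ M * norm (nderiv i f u) \<le> 2 ^ M * (A + B)" for u
    proof -
      have "(1 + \<bar>u\<bar>) ^ M * norm (nderiv i f u) \<le> 2 ^ M * (1 + \<bar>u\<bar> ^ M) * norm (nderiv i f u)"
        by (intro mult_right_mono one_plus_power_le) auto
      also have "\<dots> = 2 ^ M * (norm (nderiv i f u) + \<bar>u\<bar> ^ M * norm (nderiv i f u))"
        by (simp add: algebra_simps)
      also have "\<dots> \<le> 2 ^ M * (A + B)"
        by (intro mult_left_mono add_mono A B) auto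
      finally show ?thesis .
    qed
    then show ?thesis by blast
  qed
  have "\<exists>A. \<forall>i\<le>m. \<forall>u. (1 + \<bar>u\<bar>) ^ M * norm (nderiv i f u) \<le> A" for m
  proof (induction m)
    case 0
    then show ?case using *[of 0] by auto
  next
    case (Suc m)
    then obtain A where A: "\<forall>i\<le>m. \<forall>u. (1 + \<bar>u\<bar>) ^ M * norm (nderiv i f u) \<le> A" by blast
    obtain B where B: "\<forall>u. (1 + \<bar>u\<bar>) ^ M * norm (nderiv (Suc m) f u) \<le> B" using * by blast
    show ?case
      using A B by (intro exI[of _ "max A B"]) (auto simp: le_Suc_eq le_max_iff_disj)
  qed
  then show "\<exists>A. seminorm_le M f A" unfolding seminorm_le_def by blast
next
  assume f: "smooth f" "\<forall>M. \<exists>A. seminorm_le M f A"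
  show "schwartz f"
    unfolding schwartz_def
  proof (intro conjI ballI allI)
    show "smooth f" by fact
    fix vs k assume "vs \<in> lists (Basis :: real set)"
    then obtain i where i: "vs = replicate i 1" using lists_Basis_real by blast
    obtain A where A: "seminorm_le (max i k) f A" using f by blast
    have "norm (norm x ^ k *\<^sub>R nderiv i f x) \<le> A" for x
    proof -
      have "\<bar>x\<bar> ^ k * norm (nderiv i f x) \<le> (1 + \<bar>x\<bar>) ^ k * norm (nderiv i f x)"
        by (intro mult_right_mono power_mono) auto
      also have "\<dots> \<le> A" by (rule seminorm_leD[OF A]) auto
      finally show ?thesis by (simp add: power_abs)
    qed
    then show "bounded (range (\<lambda>x. norm x ^ k *\<^sub>R dir_derivs vs f x))"
      unfolding i nderiv_def[symmetric] by (auto simp: bounded_iff)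
  qed
qed

lemma schwartz_smooth: "schwartz f \<Longrightarrow> smooth f"
  by (simp add: schwartz_def)

lemma schwartz_seminorm_le:
  fixes f :: "real \<Rightarrow> 'b::real_normed_vector"
  assumes "schwartz f" obtains A where "seminorm_le M f A" "A \<ge> 0"
  using assms schwartz_real_iff seminorm_le_nonneg by blast

lemma schwartz_decay:
  fixes f :: "real \<Rightarrow> 'b::real_normed_vector"
  assumes "schwartz f"
  obtains C where "C \<ge> 0" "\<And>u. (1 + \<bar>u\<bar>) ^ M * norm (nderiv i f u) \<le> C"
proof -
  obtain A where "seminorm_le (max i M) f A" "A \<ge> 0" using schwartz_seminorm_le[OF assms] by blast
  then show ?thesis using that[of A] seminorm_leD[of "max i M" f A i M] by simp
qed

lemma schwartz_nderiv:
  fixes f :: "real \<Rightarrow> 'b::real_normed_vector"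
  assumes "schwartz f" shows "schwartz (nderiv l f)"
  unfolding schwartz_real_iff
proof safe
  have s: "smooth f" using assms by (simp add: schwartz_def)
  then show "smooth (nderiv l f)" by (rule smooth_nderiv)
  fix M
  obtain A where A: "seminorm_le (M + l) f A" using schwartz_seminorm_le[OF assms] by blast
  show "\<exists>A. seminorm_le M (nderiv l f) A"
    using seminorm_leD[OF A] s by (intro exI[of _ A]) (auto simp: seminorm_le_def nderiv_add)
qed

lemma poly_growth:
  fixes p :: "real poly"
  obtains C D where "C \<ge> 0" "\<And>y. \<bar>poly p y\<bar> \<le> C * (1 + \<bar>y\<bar>) ^ D"
proof -
  have "\<exists>C\<ge>0. \<exists>D. \<forall>y. \<bar>poly p y\<bar> \<le> C * (1 + \<bar>y\<bar>) ^ D"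
  proof (induction p)
    case 0
    then show ?case by (auto intro!: exI[of _ 0])
  next
    case (pCons a p)
    then obtain C D where C: "C \<ge> 0" "\<And>y. \<bar>poly p y\<bar> \<le> C * (1 + \<bar>y\<bar>) ^ D" by blast
    have "\<bar>poly (pCons a p) y\<bar> \<le> (\<bar>a\<bar> + C) * (1 + \<bar>y\<bar>) ^ Suc D" for y
    proof -
      have "\<bar>poly (pCons a p) y\<bar> \<le> \<bar>a\<bar> + \<bar>y\<bar> * \<bar>poly p y\<bar>"
        by (simp add: abs_mult[symmetric])
      also have "\<bar>y\<bar> * \<bar>poly p y\<bar> \<le> (1 + \<bar>y\<bar>) * (C * (1 + \<bar>y\<bar>) ^ D)"
        by (intro mult_mono C) auto
      also have "\<bar>a\<bar> \<le> \<bar>a\<bar> * (1 + \<bar>y\<bar>) ^ Suc D"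
        using one_le_power[of "1 + \<bar>y\<bar>" "Suc D"] by (simp add: mult_le_cancel_left1)
      finally show ?thesis by (simp add: algebra_simps)
    qed
    moreover have "\<bar>a\<bar> + C \<ge> 0" using C(1) by simp
    ultimately show ?case by blast
  qed
  then show ?thesis using that by blast
qed

section \<open>Integrals of decaying functions\<close>

lemma integrable_inverse_quadratic: "integrable lborel (\<lambda>u::real. inverse (1 + u ^ 2))"
  using integrable_inverse_1_plus_square by (simp add: set_integrable_def einterval_def)

lemma decay_integrable:
  fixes f :: "real \<Rightarrow> 'b::{banach, second_countable_topology}"
  assumes [measurable]: "f \<in> borel_measurable borel"
    and C: "\<And>u. (1 + \<bar>u\<bar>) ^ 2 * norm (f u) \<le> C"
  shows "integrable lborel f"
proof (rule Bochner_Integration.integrable_bound)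
  show "integrable lborel (\<lambda>x::real. C * inverse (1 + x ^ 2))"
    by (rule integrable_mult_right[OF integrable_inverse_quadratic])
  show "AE x in lborel. norm (f x) \<le> norm (C * inverse (1 + x ^ 2))"
  proof (rule AE_I2)
    fix x :: real
    have "1 + x ^ 2 \<le> (1 + \<bar>x\<bar>) ^ 2" by (simp add: power2_sum)
    then have "(1 + x ^ 2) * norm (f x) \<le> C"
      using C[of x] mult_right_mono[of "1 + x ^ 2" "(1 + \<bar>x\<bar>) ^ 2" "norm (f x)"] by simp
    moreover have "1 + x ^ 2 > 0" by (simp add: add_pos_nonneg)
    ultimately have "norm (f x) \<le> C * inverse (1 + x ^ 2)" by (simp add: field_simps)
    then show "norm (f x) \<le> norm (C * inverse (1 + x ^ 2))" by simp
  qed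
qed simp

lemma schwartz_weighted_integrable:
  fixes f :: "real \<Rightarrow> 'b::{banach, second_countable_topology}"
  assumes "schwartz f"
  shows "integrable lborel (\<lambda>u. (1 + \<bar>u\<bar>) ^ m * norm (nderiv i f u))"
proof -
  obtain C where C: "C \<ge> 0" "\<And>u. (1 + \<bar>u\<bar>) ^ (m + 2) * norm (nderiv i f u) \<le> C"
    using schwartz_decay[OF assms] by blast
  have "continuous_on UNIV (nderiv i f)"
    using assms by (intro continuous_nderiv schwartz_smooth)
  then have [measurable]: "nderiv i f \<in> borel_measurable borel"
    by (rule borel_measurable_continuous_onI)
  show ?thesis
    by (rule decay_integrable[of _ C]) (use C in \<open>auto simp: power_add power2_eq_square mult_ac abs_mult power_abs\<close>)
qed

lemma schwartz_integrable:
  fixes f :: "real \<Rightarrow> 'b::{banach, second_countable_topology}"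
  assumes "schwartz f"
  shows "integrable lborel (nderiv i f)" "integrable lborel f"
proof -
  have c: "continuous_on UNIV (nderiv i f)" for i
    using assms by (intro continuous_nderiv schwartz_smooth)
  show *: "integrable lborel (nderiv i f)" for i
    by (rule Bochner_Integration.integrable_bound[OF schwartz_weighted_integrable[OF assms, of 0 i]])
       (use c[of i] in \<open>auto intro: borel_measurable_continuous_onI\<close>)
  show "integrable lborel f" using *[of 0] by simp
qed

lemma decay_tendsto:
  fixes F :: "real \<Rightarrow> real"
  assumes C: "\<And>u. (1 + \<bar>u\<bar>) * \<bar>F u\<bar> \<le> C"
  shows "(F \<longlongrightarrow> 0) at_top" "(F \<longlongrightarrow> 0) at_bot"
proof -
  have "\<bar>F u\<bar> \<le> C * inverse (1 + \<bar>u\<bar>)" for u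
    using C[of u] by (simp add: field_simps add_pos_nonneg)
  then have *: "eventually (\<lambda>u. norm (F u) \<le> C * inverse (1 + \<bar>u\<bar>)) A" for A by simp
  have "((\<lambda>u::real. C * inverse (1 + \<bar>u\<bar>)) \<longlongrightarrow> 0) at_top" "((\<lambda>u::real. C * inverse (1 + \<bar>u\<bar>)) \<longlongrightarrow> 0) at_bot"
    by real_asymp+
  with * show "(F \<longlongrightarrow> 0) at_top" "(F \<longlongrightarrow> 0) at_bot"
    by (blast intro: Lim_null_comparison[OF *])+
qed

lemma integral_derivative_half_line:
  fixes F f :: "real \<Rightarrow> real"
  assumes F: "\<And>x. \<sigma> * (x - w) > 0 \<Longrightarrow> (F has_real_derivative f x) (at x)"
    and f: "continuous_on UNIV f" "integrable lborel f"
    and F0: "isCont F w"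
    and C: "\<And>u. (1 + \<bar>u\<bar>) * \<bar>F u\<bar> \<le> C"
    and \<sigma>: "\<sigma> \<in> {1, -1}"
  shows "(LINT u|lborel. indicator {0<..} (\<sigma> * (u - w)) * f u) = - \<sigma> * F w"
proof -
  have sint: "set_integrable lborel S f" if "S \<in> sets borel" for S
    using f(2) that unfolding set_integrable_def by (intro integrable_mult_indicator) auto
  have ic: "isCont f x" for x using f(1) by (simp add: continuous_on_eq_continuous_at)
  from F0 have lim: "(F \<longlongrightarrow> F w) (at_right w)" "(F \<longlongrightarrow> F w) (at_left w)"
    unfolding isCont_def by (auto simp: filterlim_at_split)
  from \<sigma> consider "\<sigma> = 1" | "\<sigma> = -1" by blast
  then show ?thesis
  proof cases
    case 1
    have "(LBINT x=ereal w..\<infinity>. f x) = 0 - F w"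
    proof (rule interval_integral_FTC_integrable)
      show "((F \<circ> real_of_ereal) \<longlongrightarrow> F w) (at_right (ereal w))"
        "((F \<circ> real_of_ereal) \<longlongrightarrow> 0) (at_left \<infinity>)"
        using lim decay_tendsto[of F C, OF C] by (simp_all add: ereal_tendsto_simps)
      show "set_integrable lborel (einterval (ereal w) \<infinity>) f" by (rule sint) simp
    qed (use 1 F ic in \<open>auto simp flip: has_real_derivative_iff_has_vector_derivative\<close>)
    also have "(LBINT x=ereal w..\<infinity>. f x) = (LINT u|lborel. indicator {0<..} (\<sigma> * (u - w)) * f u)"
      unfolding interval_lebesgue_integral_def set_lebesgue_integral_def
      by (auto simp: 1 einterval_def indicator_def intro!: Bochner_Integration.integral_cong)
    finally show ?thesis by (simp add: 1)
  next
    case 2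
    have "(LBINT x=-\<infinity>..ereal w. f x) = F w - 0"
    proof (rule interval_integral_FTC_integrable)
      show "((F \<circ> real_of_ereal) \<longlongrightarrow> F w) (at_left (ereal w))"
        "((F \<circ> real_of_ereal) \<longlongrightarrow> 0) (at_right (-\<infinity>))"
        using lim decay_tendsto[of F C, OF C] by (simp_all add: ereal_tendsto_simps)
      show "set_integrable lborel (einterval (-\<infinity>) (ereal w)) f" by (rule sint) simp
    qed (use 2 F ic in \<open>auto simp flip: has_real_derivative_iff_has_vector_derivative\<close>)
    also have "(LBINT x=-\<infinity>..ereal w. f x) = (LINT u|lborel. indicator {0<..} (\<sigma> * (u - w)) * f u)"
      unfolding interval_lebesgue_integral_def set_lebesgue_integral_def
      by (auto simp: 2 einterval_def indicator_def intro!: Bochner_Integration.integral_cong)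
    finally show ?thesis by (simp add: 2)
  qed
qed

lemma integral_derivative_line:
  fixes F f :: "real \<Rightarrow> real"
  assumes F: "\<And>x. (F has_real_derivative f x) (at x)"
    and f: "continuous_on UNIV f" "integrable lborel f"
    and C: "\<And>u. (1 + \<bar>u\<bar>) * \<bar>F u\<bar> \<le> C"
  shows "(LINT u|lborel. f u) = 0"
proof -
  have ic: "isCont f x" for x using f(1) by (simp add: continuous_on_eq_continuous_at)
  have "(LBINT x=-\<infinity>..\<infinity>. f x) = 0 - 0"
  proof (rule interval_integral_FTC_integrable)
    show "((F \<circ> real_of_ereal) \<longlongrightarrow> 0) (at_right (-\<infinity>))"
      "((F \<circ> real_of_ereal) \<longlongrightarrow> 0) (at_left \<infinity>)"
      using decay_tendsto[of F C, OF C] by (simp_all add: ereal_tendsto_simps)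
    show "set_integrable lborel (einterval (-\<infinity>) \<infinity>) f" using f(2) by (simp add: set_integrable_def einterval_def)
  qed (use F ic in \<open>auto simp flip: has_real_derivative_iff_has_vector_derivative\<close>)
  then show ?thesis
    by (simp add: interval_lebesgue_integral_def set_lebesgue_integral_def einterval_def)
qed

section \<open>Iterated integrals of Schwartz functions\<close>

lemma int_plus_has_derivative:
  assumes c: "continuous_on UNIV \<phi>" and i: "integrable lborel \<phi>"
  shows "(int_plus \<phi> has_real_derivative \<phi> u) (at u)"
proof -
  define c0 where "c0 = (LINT v:{..<u - 1}|lborel. \<phi> v)"
  have sint: "set_integrable lborel S \<phi>" if "S \<in> sets borel" for S
    using i that unfolding set_integrable_def by (intro integrable_mult_indicator) auto
  have eq: "int_plus \<phi> v = c0 + integral {u - 1..v} \<phi>" if "v \<ge> u - 1" for v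
  proof -
    have "{..v} = {..<u - 1} \<union> {u - 1..v}" using that by auto
    then have "int_plus \<phi> v = c0 + (LINT v:{u - 1..v}|lborel. \<phi> v)"
      unfolding int_plus_def c0_def by (simp add: set_integral_Un sint disjoint_iff)
    then show ?thesis using set_borel_integral_eq_integral(2)[OF sint[of "{u - 1..v}"]] by simp
  qed
  have "((\<lambda>v. integral {u - 1..v} \<phi>) has_real_derivative \<phi> u) (at u within {u - 1..u + 1})"
    by (rule integral_has_real_derivative) (auto intro: continuous_on_subset[OF c])
  then have "((\<lambda>v. integral {u - 1..v} \<phi>) has_real_derivative \<phi> u) (at u)"
    by (simp add: at_within_Icc_at)
  then have "((\<lambda>v. c0 + integral {u - 1..v} \<phi>) has_real_derivative \<phi> u) (at u)"
    by (auto intro!: derivative_eq_intros)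
  then show ?thesis
    by (rule has_field_derivative_transform_within_open[where S = "{u - 1<..}"]) (auto simp: eq)
qed

lemma int_plus_smooth:
  assumes "smooth \<phi>" and "integrable lborel \<phi>"
  shows "smooth (int_plus \<phi>)" "nderiv (Suc m) (int_plus \<phi>) = nderiv m \<phi>"
proof -
  let ?D = "\<lambda>m. case m of 0 \<Rightarrow> int_plus \<phi> | Suc k \<Rightarrow> nderiv k \<phi>"
  have *: "(?D m has_vector_derivative ?D (Suc m) x) (at x)" for m x
    using nderiv_has_vector_derivative[OF assms(1)]
      int_plus_has_derivative[OF smooth_continuous[OF assms(1)] assms(2)]
    by (cases m) (auto simp flip: has_real_derivative_iff_has_vector_derivative)
  show "smooth (int_plus \<phi>)" by (rule smoothI[of ?D, OF _ *]) auto
  show "nderiv (Suc m) (int_plus \<phi>) = nderiv m \<phi>" using nderiv_eqI[of ?D, OF _ *, of _ "Suc m"] by auto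
qed

text \<open>
  The weight \<open>(1 + \<bar>u\<bar>) ^ M\<close> is dominated by \<open>(1 + \<bar>v\<bar>) ^ M\<close> as soon as \<open>v\<close> lies beyond \<open>u\<close> as seen from \<open>0\<close>. On
  the negative half-line this bounds the defining integral; on the positive one the vanishing total
  integral first turns it into an integral over \<open>{u<..}\<close>.
\<close>

lemma int_plus_schwartz:
  assumes s: "schwartz \<phi>" and 0: "(LINT u|lborel. \<phi> u) = 0"
  shows "schwartz (int_plus \<phi>)"
  unfolding schwartz_real_iff
proof safe
  note sm = schwartz_smooth[OF s] and int = schwartz_integrable(2)[OF s]
  show "smooth (int_plus \<phi>)" by (rule int_plus_smooth[OF sm int])
  fix M
  have sint: "set_integrable lborel S \<phi>" if "S \<in> sets borel" for S
    using int that unfolding set_integrable_def by (intro integrable_mult_indicator) auto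
  have wint: "integrable lborel (\<lambda>v. (1 + \<bar>v\<bar>) ^ M * \<bar>\<phi> v\<bar>)"
    using schwartz_weighted_integrable[OF s, of M 0] by simp
  define B where "B = (LINT v|lborel. (1 + \<bar>v\<bar>) ^ M * \<bar>\<phi> v\<bar>)"
  have tail: "(1 + \<bar>u\<bar>) ^ M * \<bar>LINT v:S|lborel. \<phi> v\<bar> \<le> B"
    if S: "S \<in> sets borel" "\<And>v. v \<in> S \<Longrightarrow> \<bar>u\<bar> \<le> \<bar>v\<bar>" for S u
  proof -
    have "(1 + \<bar>u\<bar>) ^ M * \<bar>LINT v:S|lborel. \<phi> v\<bar> =
        \<bar>LINT v|lborel. (1 + \<bar>u\<bar>) ^ M * (indicator S v * \<phi> v)\<bar>"
      by (simp add: set_lebesgue_integral_def abs_mult)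
    also have "\<dots> \<le> B"
      unfolding B_def real_norm_def[symmetric]
    proof (rule Bochner_Integration.integral_norm_bound_integral)
      fix v
      show "norm ((1 + norm u) ^ M * (indicator S v * \<phi> v)) \<le> (1 + norm v) ^ M * norm (\<phi> v)"
        using S(2)[of v] by (auto simp: indicator_def abs_mult intro!: mult_right_mono power_mono)
    qed (use wint sint[OF S(1)] in \<open>simp_all add: set_integrable_def\<close>)
    finally show ?thesis .
  qed
  have main: "(1 + \<bar>u\<bar>) ^ M * \<bar>int_plus \<phi> u\<bar> \<le> B" for u
  proof (cases "u \<le> 0")
    case True
    then show ?thesis unfolding int_plus_def by (intro tail) auto
  next
    case False
    have "int_plus \<phi> u + (LINT v:{u<..}|lborel. \<phi> v) = (LINT v:{..u} \<union> {u<..}|lborel. \<phi> v)"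
      unfolding int_plus_def by (subst set_integral_Un) (auto simp: sint)
    also have "{..u} \<union> {u<..} = UNIV" by auto
    also have "(LINT v:UNIV|lborel. \<phi> v) = 0" using 0 by (simp add: set_lebesgue_integral_def)
    finally have "\<bar>int_plus \<phi> u\<bar> = \<bar>LINT v:{u<..}|lborel. \<phi> v\<bar>" by linarith
    then show ?thesis using False by (simp only:) (intro tail, auto)
  qed
  obtain A where A: "seminorm_le M \<phi> A" using schwartz_seminorm_le[OF s] by blast
  have "(1 + \<bar>u\<bar>) ^ M * norm (nderiv i (int_plus \<phi>) u) \<le> max A B" if "i \<le> M" for i u
    using main[of u] seminorm_leD[OF A, of "i - 1" M u] that int_plus_smooth(2)[OF sm int]
    by (cases i) (auto simp: le_max_iff_disj)
  then show "\<exists>A. seminorm_le M (int_plus \<phi>) A" unfolding seminorm_le_def by blast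
qed

section \<open>A smooth cutoff\<close>

text \<open>
  From \<open>1 + x \<le> exp x\<close> at \<open>x = z / (D + 1)\<close>, raised to the power \<open>D + 1\<close>.
\<close>

lemma power_le_exp:
  fixes z :: real assumes "z \<ge> 0" shows "(1 + z) ^ D \<le> (real D + 1) ^ (D + 1) * exp z"
proof -
  have "1 + z \<le> (real D + 1) * (1 + z / (real D + 1))" using assms by (simp add: field_simps)
  also have "\<dots> \<le> (real D + 1) * exp (z / (real D + 1))" by (intro mult_left_mono) auto
  finally have "(1 + z) ^ (D + 1) \<le> ((real D + 1) * exp (z / (real D + 1))) ^ (D + 1)"
    using assms by (intro power_mono) auto
  also have "\<dots> = (real D + 1) ^ (D + 1) * exp z"
    by (simp add: power_mult_distrib exp_of_nat_mult[symmetric] del: power_Suc) (simp add: add.commute)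
  finally show ?thesis
    using assms power_increasing[of D "D + 1" "1 + z"] by linarith
qed

lemma poly_exp_bounded:
  obtains C where "\<And>z::real. z \<ge> 0 \<Longrightarrow> \<bar>poly P z\<bar> * exp (- z) \<le> C"
proof -
  obtain C D where C: "C \<ge> 0" "\<And>y. \<bar>poly P y\<bar> \<le> C * (1 + \<bar>y\<bar>) ^ D" using poly_growth[of P] by blast
  have "\<bar>poly P z\<bar> * exp (- z) \<le> C * (real D + 1) ^ (D + 1)" if "z \<ge> 0" for z
  proof -
    have "\<bar>poly P z\<bar> \<le> C * ((real D + 1) ^ (D + 1) * exp z)"
      using C(2)[of z] mult_left_mono[OF power_le_exp[OF that, of D] C(1)] that by simp
    then show ?thesis by (simp add: exp_minus field_simps)
  qed
  then show ?thesis using that by blast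
qed

text \<open>
  The function that is smooth and flat at \<open>0\<close>; its derivatives on the positive half-line are
  \<open>exp (- 1 / x)\<close> times the polynomials below, evaluated at \<open>1 / x\<close>.
\<close>

definition flat_exp :: "real \<Rightarrow> real" where
  "flat_exp x = (if x > 0 then exp (- (1 / x)) else 0)"

primrec flat_exp_poly :: "nat \<Rightarrow> real poly" where
  "flat_exp_poly 0 = 1"
| "flat_exp_poly (Suc m) = [:0, 0, 1:] * (flat_exp_poly m - pderiv (flat_exp_poly m))"

lemma smooth_flat_exp: "smooth flat_exp"
proof (rule smoothI)
  let ?D = "\<lambda>m x. if x > 0 then poly (flat_exp_poly m) (1 / x) * exp (- (1 / x)) else 0"
  show "?D 0 = flat_exp" by (auto simp: flat_exp_def)
  fix m and x :: real
  consider "x > 0" | "x < 0" | "x = 0" by linarith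
  then have "(?D m has_real_derivative ?D (Suc m) x) (at x)"
  proof cases
    case 1
    let ?P = "flat_exp_poly m"
    have d: "((\<lambda>x. 1 / x) has_real_derivative - (1 / x^2)) (at x)"
      using 1 by (auto intro!: derivative_eq_intros simp: power2_eq_square)
    have "((\<lambda>x. poly ?P (1 / x) * exp (- (1 / x))) has_real_derivative ?D (Suc m) x) (at x)"
      by (rule derivative_eq_intros DERIV_chain2[OF poly_DERIV d] DERIV_chain2[OF DERIV_exp DERIV_minus[OF d]] refl)+
         (use 1 in \<open>simp add: algebra_simps power2_eq_square\<close>)
    then show ?thesis
      by (rule has_field_derivative_transform_within_open[where S = "{0<..}"]) (use 1 in auto)
  next
    case 2
    have "((\<lambda>x. 0) has_real_derivative ?D (Suc m) x) (at x)" using 2 by simp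
    then show ?thesis
      by (rule has_field_derivative_transform_within_open[where S = "{..<0}"]) (use 2 in auto)
  next
    case 3
    obtain C where C: "\<And>z::real. z \<ge> 0 \<Longrightarrow> \<bar>poly ([:0, 0, 1:] * flat_exp_poly m) z\<bar> * exp (- z) \<le> C"
      using poly_exp_bounded by blast
    have "norm (?D m h / h) \<le> \<bar>h\<bar> * C" for h
    proof (cases "h > 0")
      case True
      define p where "p = \<bar>poly (flat_exp_poly m) (1 / h)\<bar> * exp (- (1 / h))"
      have "p / h ^ 2 \<le> C"
        using C[of "1 / h"] True by (simp add: p_def abs_mult power2_eq_square)
      then have "p / h ^ 2 * h \<le> C * h" using True by (intro mult_right_mono) auto
      moreover have "norm (?D m h / h) = p / h ^ 2 * h"
        using True by (simp add: p_def abs_mult power2_eq_square)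
      ultimately show ?thesis using True by (simp add: mult.commute)
    next
      case False
      have "0 \<le> C" using C[of 0] by simp
      then have "0 \<le> \<bar>h\<bar> * C" by (rule mult_nonneg_nonneg[OF abs_ge_zero])
      moreover have "?D m h = 0" using False by (rule if_not_P)
      ultimately show ?thesis by (metis div_0 norm_zero)
    qed
    then have "((\<lambda>h. ?D m h / h) \<longlongrightarrow> 0) (at 0)"
      by (rule Lim_null_comparison[OF always_eventually[OF allI]]) (auto intro!: tendsto_eq_intros)
    moreover have "(?D m (x + h) - ?D m x) / h = ?D m h / h" "?D (Suc m) x = 0" for h
      unfolding 3 by simp_all
    ultimately show ?thesis unfolding DERIV_def by presburger
  qed
  then show "(?D m has_vector_derivative ?D (Suc m) x) (at x)"
    by (simp only: has_real_derivative_iff_has_vector_derivative)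
qed

text \<open>
  The primitive of a bump supported in \<open>{0..1}\<close>, normalized to reach the value \<open>1\<close>. Being a primitive, it
  needs no quotient of smooth functions.
\<close>

lemma smooth_step:
  obtains \<Psi> :: "real \<Rightarrow> real" where "smooth \<Psi>" "\<And>x. x \<le> 0 \<Longrightarrow> \<Psi> x = 0" "\<And>x. x \<ge> 1 \<Longrightarrow> \<Psi> x = 1"
proof -
  define \<psi> where "\<psi> x = flat_exp x * flat_exp (1 - x)" for x
  have sm: "smooth \<psi>"
    using nderiv_product(1)[OF smooth_flat_exp smooth_affine(1)[OF smooth_flat_exp, of "-1" 1]]
    by (simp add: \<psi>_def[abs_def])
  have le1: "\<bar>\<psi> x\<bar> \<le> 1" for x by (auto simp: \<psi>_def flat_exp_def abs_mult intro!: mult_le_one)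
  have 0: "\<psi> x = 0" if "x \<le> 0 \<or> x \<ge> 1" for x using that by (auto simp: \<psi>_def flat_exp_def)
  have int: "integrable lborel \<psi>"
  proof (rule decay_integrable[of _ 4])
    fix u :: real
    show "(1 + \<bar>u\<bar>)\<^sup>2 * norm (\<psi> u) \<le> 4"
    proof (cases "u \<le> 0 \<or> u \<ge> 1")
      case False
      then have "(1 + \<bar>u\<bar>)\<^sup>2 * norm (\<psi> u) \<le> 2\<^sup>2 * 1"
        using le1[of u] by (intro mult_mono power_mono) auto
      then show ?thesis by simp
    qed (simp add: 0)
  qed (use sm in \<open>auto intro: borel_measurable_continuous_onI smooth_continuous\<close>)
  note I = int_plus_has_derivative[OF smooth_continuous[OF sm] int]
  have I0: "int_plus \<psi> x = 0" if "x \<le> 0" for x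
  proof -
    have "int_plus \<psi> x = (LINT v::real|lborel. 0)"
      unfolding int_plus_def set_lebesgue_integral_def
      using that by (intro Bochner_Integration.integral_cong) (auto simp: indicator_def 0)
    then show ?thesis by simp
  qed
  have I1: "int_plus \<psi> x = int_plus \<psi> 1" if "x \<ge> 1" for x
    unfolding int_plus_def set_lebesgue_integral_def
    using that by (intro Bochner_Integration.integral_cong) (auto simp: indicator_def 0)
  have "int_plus \<psi> 0 < int_plus \<psi> 1"
  proof (rule DERIV_pos_imp_increasing_open[of 0 1 "int_plus \<psi>"])
    fix x :: real assume "0 < x" "x < 1"
    then have "\<psi> x > 0" by (simp add: \<psi>_def flat_exp_def)
    then show "\<exists>y. (int_plus \<psi> has_real_derivative y) (at x) \<and> y > 0" using I by blast
  next
    show "continuous_on {0..1} (int_plus \<psi>)"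
      using I by (meson DERIV_isCont continuous_at_imp_continuous_on)
  qed auto
  then have pos: "int_plus \<psi> 1 > 0" by (simp add: I0)
  show ?thesis
  proof (rule that[of "\<lambda>x. inverse (int_plus \<psi> 1) *\<^sub>R int_plus \<psi> x"])
    show "smooth (\<lambda>x. inverse (int_plus \<psi> 1) *\<^sub>R int_plus \<psi> x)"
      by (intro smooth_scaleR int_plus_smooth sm int)
    fix x :: real
    show "inverse (int_plus \<psi> 1) *\<^sub>R int_plus \<psi> x = 0" if "x \<le> 0" using I0[OF that] by simp
    show "inverse (int_plus \<psi> 1) *\<^sub>R int_plus \<psi> x = 1" if "x \<ge> 1"
      unfolding I1[OF that] using pos by simp
  qed
qed

lemma smooth_cutoff:
  obtains \<kappa> :: "real \<Rightarrow> real" where "smooth \<kappa>" "\<And>u. \<bar>u\<bar> \<le> 1 \<Longrightarrow> \<kappa> u = 1" "\<And>u. \<bar>u\<bar> \<ge> 2 \<Longrightarrow> \<kappa> u = 0"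
    "\<And>i. \<exists>B. \<forall>u. \<bar>nderiv i \<kappa> u\<bar> \<le> B"
proof -
  obtain \<Psi> :: "real \<Rightarrow> real" where \<Psi>: "smooth \<Psi>" "\<And>x. x \<le> 0 \<Longrightarrow> \<Psi> x = 0" "\<And>x. x \<ge> 1 \<Longrightarrow> \<Psi> x = 1"
    using smooth_step by metis
  define \<kappa> where "\<kappa> u = \<Psi> (2 - u) * \<Psi> (2 + u)" for u
  have sm: "smooth \<kappa>"
    using nderiv_product(1)[OF smooth_affine(1)[OF \<Psi>(1), of "-1" 2] smooth_affine(1)[OF \<Psi>(1), of 1 2]]
    by (simp add: \<kappa>_def[abs_def] add.commute)
  have 0: "\<kappa> u = 0" if "\<bar>u\<bar> \<ge> 2" for u
    using that \<Psi>(2)[of "2 - u"] \<Psi>(2)[of "2 + u"] by (cases "u \<ge> 0") (auto simp: \<kappa>_def)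
  have "\<exists>B. \<forall>u. \<bar>nderiv i \<kappa> u\<bar> \<le> B" for i
  proof -
    obtain B where B: "\<And>u. \<bar>u\<bar> \<le> 2 \<Longrightarrow> \<bar>nderiv i \<kappa> u\<bar> \<le> B"
      using continuous_interval_bounded[OF continuous_nderiv[OF sm]] by metis
    have "\<bar>nderiv i \<kappa> u\<bar> \<le> B" for u
    proof (cases "\<bar>u\<bar> \<le> 2")
      case False
      then have "nderiv i \<kappa> u = 0"
        by (intro smooth_vanishing_nderiv[OF sm, of "- {-2..2}"] 0) (auto simp: abs_le_iff)
      then show ?thesis using B[of 0] by auto
    qed (rule B)
    then show ?thesis by blast
  qed
  then show ?thesis
    using that[of \<kappa>, OF sm _ 0] \<Psi>(3) by (auto simp: \<kappa>_def)
qed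

section \<open>Sheared tensor products\<close>

text \<open>
  Every rescaled Taylorlet has this form. Working with the product in the sheared coordinates from
  the start avoids composing distributions with the shear.
\<close>

definition sheared ::
  "real poly \<Rightarrow> real \<Rightarrow> (real \<Rightarrow> real) \<Rightarrow> (real \<Rightarrow> complex) \<Rightarrow> real \<times> real \<Rightarrow> complex" where
  "sheared S t g h x = g (fst x - poly S (snd x - t)) *\<^sub>R h (snd x - t)"

abbreviation sheared_expansion ::
  "real poly \<Rightarrow> real \<Rightarrow> (real \<Rightarrow> real) \<Rightarrow> (real \<Rightarrow> complex) \<Rightarrow>
    (real poly \<times> nat \<times> nat) list \<Rightarrow> real \<times> real \<Rightarrow> complex" where
  "sheared_expansion S t g h ts x \<equiv>
    expansion ts (\<lambda>i y. nderiv i g (fst x - poly S y)) (\<lambda>l. nderiv l h) (snd x - t)"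

lemma sheared_expansion_has_derivative:
  assumes g: "smooth g" and h: "smooth h"
  shows "(sheared_expansion S t g h ts has_derivative
    (\<lambda>v. fst v *\<^sub>R sheared_expansion S t g h (map (\<lambda>(p, i, l). (p, Suc i, l)) ts) x +
         snd v *\<^sub>R sheared_expansion S t g h (expansion_deriv (- pderiv S) ts) x)) (at x)"
proof (induction ts)
  case Nil
  then show ?case by simp
next
  case (Cons a ts)
  obtain p i l where a: "a = (p, i, l)" by (cases a)
  let ?y = "snd x - t"
  have y: "((\<lambda>x. snd x - t) has_derivative snd) (at x)"
    by (auto intro!: derivative_eq_intros)
  have pd: "((\<lambda>x. poly P (snd x - t)) has_derivative (\<lambda>v. snd v * poly (pderiv P) ?y)) (at x)" for P
    using has_derivative_compose[OF y poly_DERIV[of P ?y, unfolded has_field_derivative_def]]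
    by (simp add: mult.commute)
  have gd: "((\<lambda>x. nderiv i g (fst x - poly S (snd x - t))) has_derivative
      (\<lambda>v. (fst v - snd v * poly (pderiv S) ?y) * nderiv (Suc i) g (fst x - poly S ?y))) (at x)"
    using has_derivative_compose[OF has_derivative_diff[OF has_derivative_fst[OF has_derivative_ident] pd[of S]]
       nderiv_field_derivative[OF g, of i, unfolded has_field_derivative_def]]
    by (simp add: mult.commute)
  have hd: "((\<lambda>x. nderiv l h (snd x - t)) has_derivative (\<lambda>v. snd v *\<^sub>R nderiv (Suc l) h ?y)) (at x)"
    using has_derivative_compose[OF y nderiv_has_vector_derivative[OF h, of l, unfolded has_vector_derivative_def]]
    by simp
  have "((\<lambda>x. (poly p (snd x - t) * nderiv i g (fst x - poly S (snd x - t))) *\<^sub>R nderiv l h (snd x - t))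
      has_derivative
      (\<lambda>v. fst v *\<^sub>R ((poly p ?y * nderiv (Suc i) g (fst x - poly S ?y)) *\<^sub>R nderiv l h ?y) +
        snd v *\<^sub>R ((poly (pderiv p) ?y * nderiv i g (fst x - poly S ?y)) *\<^sub>R nderiv l h ?y +
          (poly (- pderiv S * p) ?y * nderiv (Suc i) g (fst x - poly S ?y)) *\<^sub>R nderiv l h ?y +
          (poly p ?y * nderiv i g (fst x - poly S ?y)) *\<^sub>R nderiv (Suc l) h ?y))) (at x)"
    by (rule has_derivative_eq_rhs[OF has_derivative_scaleR[OF has_derivative_mult[OF pd gd] hd]])
       (simp add: fun_eq_iff scaleR_conv_of_real algebra_simps)
  from has_derivative_add[OF this Cons]
  show ?case
    unfolding a expansion_simps expansion_deriv_simps list.map prod.case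
    by (rule has_derivative_eq_rhs) (simp only: scaleR_add_right ac_simps)
qed

lemma Basis_real_prod: "(Basis :: (real \<times> real) set) = {(1, 0), (0, 1)}"
  by (auto simp: Basis_prod_def)

text \<open>
  Each partial derivative acts on the list of triples alone: the first variable raises the order of the
  factor \<open>g\<close>, the second one follows the chain rule with \<open>R\<close> the derivative of \<open>- S\<close>. The list is chosen before
  \<open>g\<close> and \<open>h\<close>, so later bounds are uniform in them.
\<close>

lemma dir_derivs_sheared:
  assumes "vs \<in> lists Basis"
  shows "\<exists>ts. \<forall>g h. smooth g \<longrightarrow> smooth h \<longrightarrow>
    dir_derivs vs (sheared S t g h) = sheared_expansion S t g h ts"
  using assms
proof (induction vs)
  case Nil
  then show ?case
    by (intro exI[of _ "[(1, 0, 0)]"]) (auto simp: sheared_def)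
next
  case (Cons v vs)
  then obtain ts where ts: "\<And>g h. smooth g \<Longrightarrow> smooth h \<Longrightarrow>
      dir_derivs vs (sheared S t g h) = sheared_expansion S t g h ts" by auto
  define us where "us = (if v = (1, 0) then map (\<lambda>(p, i, l). (p, Suc i, l)) ts
     else expansion_deriv (- pderiv S) ts)"
  have "v \<in> Basis" by (rule Cons.hyps(1))
  then have v: "v = (1, 0) \<or> v = (0, 1)" unfolding Basis_real_prod by blast
  have "dir_derivs (v # vs) (sheared S t g h) = sheared_expansion S t g h us"
    if "smooth g" "smooth h" for g h
  proof
    fix x
    show "dir_derivs (v # vs) (sheared S t g h) x = sheared_expansion S t g h us x"
      using v frechet_derivative_at[OF sheared_expansion_has_derivative[OF that, where S = S and t = t and ts = ts and x = x], symmetric]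
      by (auto simp: ts[OF that] us_def)
  qed
  then show ?case by blast
qed

lemma smooth_sheared:
  assumes "smooth g" "smooth h"
  shows "smooth (sheared S t g h)"
  unfolding smooth_def
proof (intro ballI allI)
  fix vs :: "(real \<times> real) list" and x assume "vs \<in> lists Basis"
  then obtain ts where eq: "dir_derivs vs (sheared S t g h) = sheared_expansion S t g h ts"
    using dir_derivs_sheared assms by blast
  show "dir_derivs vs (sheared S t g h) differentiable at x"
    unfolding eq by (rule differentiableI[OF sheared_expansion_has_derivative[OF assms]])
qed

text \<open>
  The shear and its inverse are polynomial, hence the Euclidean weight is controlled by weights in the sheared
  coordinates.
\<close>

lemma norm_power_sheared_bound:
  obtains C D where "C \<ge> 0"
    "\<And>x. norm x ^ k \<le> C * ((1 + \<bar>fst x - poly S (snd x - t)\<bar>) ^ k * (1 + \<bar>snd x - t\<bar>) ^ D)"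
proof -
  obtain CS DS where S: "CS \<ge> 0" "\<And>y. \<bar>poly S y\<bar> \<le> CS * (1 + \<bar>y\<bar>) ^ DS"
    using poly_growth[of S] by blast
  define K where "K = 2 + CS + \<bar>t\<bar>"
  have "norm x \<le> K * ((1 + \<bar>fst x - poly S (snd x - t)\<bar>) * (1 + \<bar>snd x - t\<bar>) ^ Suc DS)" for x
  proof -
    define u y where "u = fst x - poly S (snd x - t)" and "y = snd x - t"
    define U Y where "U = 1 + \<bar>u\<bar>" and "Y = (1 + \<bar>y\<bar>) ^ Suc DS"
    have U1: "U \<ge> 1" and Y1: "Y \<ge> 1" by (auto simp: U_def Y_def simp del: power_Suc)
    have le: "U \<le> U * Y" "Y \<le> U * Y" using U1 Y1 by auto
    have UY1: "1 \<le> U * Y" using le U1 by linarith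
    have "norm x \<le> \<bar>fst x\<bar> + \<bar>snd x\<bar>" using norm_Pair_le[of "fst x" "snd x"] by simp
    also have "\<dots> \<le> \<bar>u\<bar> + \<bar>poly S y\<bar> + \<bar>y\<bar> + \<bar>t\<bar>" by (simp add: u_def y_def)
    also have "\<dots> \<le> U * Y + CS * (U * Y) + U * Y + \<bar>t\<bar> * (U * Y)"
    proof (intro add_mono)
      show "\<bar>u\<bar> \<le> U * Y" using le U_def by linarith
      have "CS * (1 + \<bar>y\<bar>) ^ DS \<le> CS * Y"
        unfolding Y_def by (intro mult_left_mono power_increasing S(1)) auto
      moreover have "CS * Y \<le> CS * (U * Y)" by (intro mult_left_mono le S(1))
      ultimately show "\<bar>poly S y\<bar> \<le> CS * (U * Y)" using S(2)[of y] by linarith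
      have "(1 + \<bar>y\<bar>) ^ 1 \<le> Y" unfolding Y_def by (rule power_increasing) auto
      then show "\<bar>y\<bar> \<le> U * Y" using le by simp
      show "\<bar>t\<bar> \<le> \<bar>t\<bar> * (U * Y)" using mult_left_mono[OF UY1, of "\<bar>t\<bar>"] by simp
    qed
    also have "\<dots> = K * (U * Y)" by (simp add: K_def algebra_simps)
    finally show ?thesis by (simp add: U_def Y_def u_def y_def)
  qed
  then have "norm x ^ k \<le> (K * ((1 + \<bar>fst x - poly S (snd x - t)\<bar>) * (1 + \<bar>snd x - t\<bar>) ^ Suc DS)) ^ k" for x
    by (intro power_mono) auto
  also have "(K * ((1 + \<bar>fst x - poly S (snd x - t)\<bar>) * (1 + \<bar>snd x - t\<bar>) ^ Suc DS)) ^ k =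
    K ^ k * ((1 + \<bar>fst x - poly S (snd x - t)\<bar>) ^ k * (1 + \<bar>snd x - t\<bar>) ^ (Suc DS * k))" for x
    by (simp only: power_mult_distrib power_mult)
  finally show ?thesis using that[of "K ^ k" "Suc DS * k"] S(1) by (simp add: K_def)
qed

lemma sheared_expansion_bound:
  "\<exists>C M. \<forall>g h A B x. seminorm_le M g A \<longrightarrow> seminorm_le M h B \<longrightarrow>
    norm x ^ k * norm (sheared_expansion S t g h ts x) \<le> C * (A * B)"
proof (induction ts)
  case Nil
  show ?case by (intro exI[of _ 0]) auto
next
  case (Cons a ts)
  then obtain C1 M1 where 1: "\<And>g h A B x. seminorm_le M1 g A \<Longrightarrow> seminorm_le M1 h B \<Longrightarrow>
    norm x ^ k * norm (sheared_expansion S t g h ts x) \<le> C1 * (A * B)" by blast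
  obtain p i l where a: "a = (p, i, l)" by (cases a)
  obtain C2 D where 2: "C2 \<ge> 0"
    "\<And>x. norm x ^ k \<le> C2 * ((1 + \<bar>fst x - poly S (snd x - t)\<bar>) ^ k * (1 + \<bar>snd x - t\<bar>) ^ D)"
    using norm_power_sheared_bound[of k S t] by metis
  obtain C3 E where 3: "C3 \<ge> 0" "\<And>y. \<bar>poly p y\<bar> \<le> C3 * (1 + \<bar>y\<bar>) ^ E"
    using poly_growth[of p] by blast
  define M where "M = M1 + k + D + E + i + l"
  have "norm x ^ k * norm (sheared_expansion S t g h (a # ts) x) \<le> (C2 * C3 + C1) * (A * B)"
    if g: "seminorm_le M g A" and h: "seminorm_le M h B" for g h A B x
  proof -
    define u y where "u = fst x - poly S (snd x - t)" and "y = snd x - t"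
    have "norm x ^ k * norm ((poly p y * nderiv i g u) *\<^sub>R nderiv l h y) \<le>
      (C2 * ((1 + \<bar>u\<bar>) ^ k * (1 + \<bar>y\<bar>) ^ D)) * ((C3 * (1 + \<bar>y\<bar>) ^ E) * \<bar>nderiv i g u\<bar> * norm (nderiv l h y))"
      unfolding norm_scaleR abs_mult
      by (intro mult_mono 2(2)[of x, folded u_def y_def] 3 order.refl) (use 2 3 in auto)
    also have "\<dots> = C2 * C3 * (((1 + \<bar>u\<bar>) ^ k * \<bar>nderiv i g u\<bar>) * ((1 + \<bar>y\<bar>) ^ (D + E) * norm (nderiv l h y)))"
      by (simp add: power_add mult_ac)
    also have "\<dots> \<le> C2 * C3 * (A * B)"
      using seminorm_leD[OF g, of i k u] seminorm_leD[OF h, of l "D + E" y] 2 3 seminorm_le_nonneg[OF g]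
      by (intro mult_left_mono mult_mono) (auto simp: M_def)
    finally have "norm x ^ k * norm ((poly p y * nderiv i g u) *\<^sub>R nderiv l h y) \<le> C2 * C3 * (A * B)" .
    moreover have "norm x ^ k * norm (sheared_expansion S t g h ts x) \<le> C1 * (A * B)"
      by (rule 1) (auto intro: seminorm_le_mono[OF g] seminorm_le_mono[OF h] simp: M_def)
    moreover have "norm x ^ k * norm (sheared_expansion S t g h (a # ts) x) \<le>
      norm x ^ k * (norm ((poly p y * nderiv i g u) *\<^sub>R nderiv l h y) + norm (sheared_expansion S t g h ts x))"
      unfolding a expansion_simps u_def y_def by (intro mult_left_mono norm_triangle_ineq) auto
    ultimately show ?thesis by (simp add: distrib_left distrib_right)
  qed
  then show ?case by blast
qed

lemma dir_derivs_sheared_bound: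
  assumes "vs \<in> lists Basis"
  shows "\<exists>C M. \<forall>g h A B x. smooth g \<longrightarrow> smooth h \<longrightarrow> seminorm_le M g A \<longrightarrow> seminorm_le M h B \<longrightarrow>
    norm x ^ k * norm (dir_derivs vs (sheared S t g h) x) \<le> C * (A * B)"
proof -
  obtain ts where "\<And>g h. smooth g \<Longrightarrow> smooth h \<Longrightarrow>
      dir_derivs vs (sheared S t g h) = sheared_expansion S t g h ts"
    using dir_derivs_sheared[OF assms] by blast
  moreover obtain C M where "\<forall>g h A B x. seminorm_le M g A \<longrightarrow> seminorm_le M h B \<longrightarrow>
    norm x ^ k * norm (sheared_expansion S t g h ts x) \<le> C * (A * B)"
    using sheared_expansion_bound[where k = k and S = S and t = t and ts = ts] by auto
  ultimately show ?thesis by (intro exI[of _ C] exI[of _ M]) simp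
qed

lemma schwartz_sheared:
  assumes g: "schwartz g" and h: "schwartz h"
  shows "schwartz (sheared S t g h)"
  unfolding schwartz_def
proof (intro conjI ballI allI)
  show "smooth (sheared S t g h)" using assms by (intro smooth_sheared schwartz_smooth)
  fix vs :: "(real \<times> real) list" and k assume "vs \<in> lists Basis"
  from dir_derivs_sheared_bound[OF this, of k S t] obtain C M where
    CM: "\<And>g h A B x. smooth g \<Longrightarrow> smooth h \<Longrightarrow> seminorm_le M g A \<Longrightarrow> seminorm_le M h B \<Longrightarrow>
    norm x ^ k * norm (dir_derivs vs (sheared S t g h) x) \<le> C * (A * B)" by blast
  obtain A where A: "seminorm_le M g A" using schwartz_seminorm_le[OF g] by blast
  obtain B where B: "seminorm_le M h B" using schwartz_seminorm_le[OF h] by blast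
  show "bounded (range (\<lambda>x. norm x ^ k *\<^sub>R dir_derivs vs (sheared S t g h) x))"
    using CM[OF schwartz_smooth[OF g] schwartz_smooth[OF h] A B]
    unfolding bounded_iff by (intro exI[of _ "C * (A * B)"]) auto
qed

lemma sum_bound_uniform:
  fixes F :: "'e \<Rightarrow> 'z \<Rightarrow> real"
  assumes "finite I" and mono: "\<And>M M' z. P M z \<Longrightarrow> M' \<le> M \<Longrightarrow> P M' z"
    and "\<And>e. e \<in> I \<Longrightarrow> \<exists>C (M::nat). \<forall>z. P M z \<longrightarrow> F e z \<le> C * b z"
  shows "\<exists>C M. \<forall>z. P M z \<longrightarrow> (\<Sum>e\<in>I. F e z) \<le> C * b z"
  using assms(1,3)
proof (induction I)
  case empty
  then show ?case by (auto intro!: exI[of _ 0])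
next
  case (insert e I)
  from insert.prems obtain C1 M1 where 1: "\<And>z. P M1 z \<Longrightarrow> F e z \<le> C1 * b z" by blast
  from insert obtain C2 M2 where 2: "\<And>z. P M2 z \<Longrightarrow> (\<Sum>e\<in>I. F e z) \<le> C2 * b z" by blast
  have "(\<Sum>e\<in>insert e I. F e z) \<le> (C1 + C2) * b z" if "P (max M1 M2) z" for z
    using 1[OF mono[OF that, of M1]] 2[OF mono[OF that, of M2]] insert.hyps by (simp add: distrib_right)
  then show ?case by blast
qed

lemma schwartz_norm_sheared_bound:
  obtains C M where "\<And>g h A B. schwartz g \<Longrightarrow> schwartz h \<Longrightarrow> seminorm_le M g A \<Longrightarrow> seminorm_le M h B \<Longrightarrow>
    \<bar>schwartz_norm N (sheared S t g h)\<bar> \<le> C * (A * B)"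
proof -
  let ?I = "{..N} \<times> {vs :: (real \<times> real) list. vs \<in> lists Basis \<and> length vs \<le> N}"
  define F where "F = (\<lambda>(k, vs) (g, h, A::real, B::real).
    \<bar>SUP x. norm x ^ k * norm (dir_derivs vs (sheared S t g h) x)\<bar>)"
  let ?P = "\<lambda>M (g, h, A, B). smooth g \<and> smooth h \<and> seminorm_le M g A \<and> seminorm_le M h B"
  have fin: "finite {vs :: (real \<times> real) list. vs \<in> lists Basis \<and> length vs \<le> N}"
    using finite_lists_length_le[of "Basis :: (real \<times> real) set" N] by (simp add: lists_eq_set)
  have "\<exists>C M. \<forall>z. ?P M z \<longrightarrow> (\<Sum>e\<in>?I. F e z) \<le> C * (\<lambda>(g, h, A, B). A * B) z"
  proof (rule sum_bound_uniform)
    show "finite ?I" using fin by simp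
    fix e assume e: "e \<in> ?I"
    obtain k vs where kvs: "e = (k, vs)" by (cases e)
    with e have "vs \<in> lists Basis" by simp
    from dir_derivs_sheared_bound[OF this, of k S t] obtain C M where
      CM: "\<And>g h A B x. smooth g \<Longrightarrow> smooth h \<Longrightarrow> seminorm_le M g A \<Longrightarrow> seminorm_le M h B \<Longrightarrow>
      norm x ^ k * norm (dir_derivs vs (sheared S t g h) x) \<le> C * (A * B)" by blast
    have "F e (g, h, A, B) \<le> C * (A * B)"
      if "smooth g" "smooth h" "seminorm_le M g A" "seminorm_le M h B"
      for g :: "real \<Rightarrow> real" and h :: "real \<Rightarrow> complex" and A B
    proof -
      let ?f = "\<lambda>x. norm x ^ k * norm (dir_derivs vs (sheared S t g h) x)"
      have le: "?f x \<le> C * (A * B)" for x using CM that by blast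
      then have "bdd_above (range ?f)" by (auto simp: bdd_above_def)
      then have "?f 0 \<le> (SUP x. ?f x)" by (rule cSUP_upper[OF UNIV_I])
      moreover have "0 \<le> ?f 0" by simp
      moreover have "(SUP x. ?f x) \<le> C * (A * B)" by (rule cSUP_least) (use le in auto)
      ultimately show ?thesis unfolding F_def kvs prod.case by (simp only: abs_of_nonneg)
    qed
    then show "\<exists>C M. \<forall>z. ?P M z \<longrightarrow> F e z \<le> C * (\<lambda>(g, h, A, B). A * B) z"
      by (intro exI[of _ C] exI[of _ M]) (simp add: split_paired_all)
  qed (auto intro: seminorm_le_mono)
  then obtain C M where CM: "\<And>z. ?P M z \<Longrightarrow> (\<Sum>e\<in>?I. F e z) \<le> C * (\<lambda>(g, h, A, B). A * B) z"
    by blast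
  show ?thesis
  proof (rule that[of M C])
    fix g :: "real \<Rightarrow> real" and h :: "real \<Rightarrow> complex" and A B assume "schwartz g" "schwartz h" "seminorm_le M g A" "seminorm_le M h B"
    then have "(\<Sum>e\<in>?I. F e (g, h, A, B)) \<le> C * (A * B)"
      using CM[of "(g, h, A, B)"] by (simp add: schwartz_smooth)
    moreover have "\<bar>schwartz_norm N (sheared S t g h)\<bar> \<le> (\<Sum>e\<in>?I. F e (g, h, A, B))"
      unfolding schwartz_norm_def sum.cartesian_product
      by (rule order.trans[OF sum_abs]) (auto simp: F_def intro!: sum_mono)
    ultimately show "\<bar>schwartz_norm N (sheared S t g h)\<bar> \<le> C * (A * B)" by linarith
  qed
qed

text \<open>
  Continuity of a tempered distribution becomes bilinear continuity in the two factors: a bound by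
  a product of one-dimensional seminorms.
\<close>

lemma tempered_sheared_bound:
  assumes f: "tempered_distribution f"
  obtains C M where "C \<ge> 0" "\<And>g h A B. schwartz g \<Longrightarrow> schwartz h \<Longrightarrow> seminorm_le M g A \<Longrightarrow> seminorm_le M h B \<Longrightarrow>
    norm (f (sheared S t g h)) \<le> C * (A * B)"
proof -
  from f obtain C0 N where C0: "\<And>\<phi>. schwartz \<phi> \<Longrightarrow> norm (f \<phi>) \<le> C0 * schwartz_norm N \<phi>"
    unfolding tempered_distribution_def by blast
  obtain C M where CM: "\<And>g h A B. schwartz g \<Longrightarrow> schwartz h \<Longrightarrow> seminorm_le M g A \<Longrightarrow> seminorm_le M h B \<Longrightarrow>
    \<bar>schwartz_norm N (sheared S t g h)\<bar> \<le> C * (A * B)"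
    using schwartz_norm_sheared_bound[of N S t] by metis
  have "norm (f (sheared S t g h)) \<le> \<bar>C0\<bar> * \<bar>C\<bar> * (A * B)"
    if "schwartz g" "schwartz h" "seminorm_le M g A" "seminorm_le M h B" for g h A B
  proof -
    have "norm (f (sheared S t g h)) \<le> \<bar>C0 * schwartz_norm N (sheared S t g h)\<bar>"
      using C0[OF schwartz_sheared[OF that(1,2)]] by (rule order.trans) simp
    also have "\<dots> \<le> \<bar>C0\<bar> * (C * (A * B))"
      unfolding abs_mult by (intro mult_left_mono CM that) auto
    also have "\<dots> \<le> \<bar>C0\<bar> * (\<bar>C\<bar> * (A * B))"
      using seminorm_le_nonneg[OF that(3)] seminorm_le_nonneg[OF that(4)]
      by (intro mult_left_mono mult_right_mono) auto
    finally show ?thesis by (simp add: mult.assoc)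
  qed
  from that[OF _ this] show ?thesis by simp
qed

lemma test_function_sheared:
  assumes g: "smooth g" "\<And>u. \<bar>u\<bar> > R \<Longrightarrow> g u = 0" and h: "smooth h" "\<And>y. \<bar>y\<bar> > R \<Longrightarrow> h y = 0"
  shows "\<exists>K. compact K \<and> (\<forall>x. x \<notin> K \<longrightarrow> sheared S t g h x = 0)"
    "test_function (sheared S t g h)"
proof -
  let ?K = "(\<lambda>(u, y). (u + poly S y, y + t)) ` ({-R..R} \<times> {-R..R})"
  have "compact ?K"
    by (intro compact_continuous_image compact_Times)
       (auto simp: case_prod_unfold intro!: continuous_intros)
  moreover have "sheared S t g h x = 0" if "x \<notin> ?K" for x
  proof -
    let ?u = "fst x - poly S (snd x - t)" and ?y = "snd x - t"
    have "x = (\<lambda>(u, y). (u + poly S y, y + t)) (?u, ?y)" by simp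
    with that have "(?u, ?y) \<notin> {-R..R} \<times> {-R..R}" by blast
    then have "\<bar>?u\<bar> > R \<or> \<bar>?y\<bar> > R" by auto
    then show ?thesis using g h by (auto simp: sheared_def)
  qed
  ultimately show *: "\<exists>K. compact K \<and> (\<forall>x. x \<notin> K \<longrightarrow> sheared S t g h x = 0)" by blast
  then show "test_function (sheared S t g h)"
    using smooth_sheared[OF g(1) h(1)] by (auto simp: test_function_def)
qed

section \<open>Rescaled Schwartz functions\<close>

text \<open>
  The multipliers that act on Schwartz functions below: cutoffs, their complements, and the constant \<open>1\<close>.
\<close>

definition bounded_smooth :: "(real \<Rightarrow> real) \<Rightarrow> bool" where
  "bounded_smooth \<phi> \<longleftrightarrow> smooth \<phi> \<and> (\<forall>i. \<exists>B. \<forall>u. \<bar>nderiv i \<phi> u\<bar> \<le> B)"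

lemma bounded_smooth_one: "bounded_smooth (\<lambda>_. 1)"
  unfolding bounded_smooth_def smooth_const by (auto intro: exI[of _ 1] smooth_const)

lemma bounded_smooth_dilation: "bounded_smooth \<phi> \<Longrightarrow> bounded_smooth (\<lambda>u. \<phi> (c * u))"
proof -
  assume \<phi>: "bounded_smooth \<phi>"
  then have s: "smooth \<phi>" by (simp add: bounded_smooth_def)
  have "\<exists>B. \<forall>u. \<bar>nderiv i (\<lambda>u. \<phi> (c * u)) u\<bar> \<le> B" for i
  proof -
    obtain B where B: "\<And>u. \<bar>nderiv i \<phi> u\<bar> \<le> B" using \<phi> by (auto simp: bounded_smooth_def)
    have "\<bar>nderiv i (\<lambda>u. \<phi> (c * u)) u\<bar> \<le> \<bar>c\<bar> ^ i * B" for u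
      using smooth_affine(2)[OF s, of i c 0] mult_left_mono[OF B, of "\<bar>c\<bar> ^ i"]
      by (simp add: abs_mult power_abs)
    then show ?thesis by blast
  qed
  then show ?thesis using smooth_affine(1)[OF s, of c 0] by (simp add: bounded_smooth_def)
qed

lemma bounded_smooth_complement: "bounded_smooth \<phi> \<Longrightarrow> bounded_smooth (\<lambda>u. 1 - \<phi> u)"
proof -
  assume \<phi>: "bounded_smooth \<phi>"
  then have s: "smooth \<phi>" by (simp add: bounded_smooth_def)
  have s1: "smooth (\<lambda>u. 1 - \<phi> u)"
    using smooth_add(1)[OF smooth_const(1) smooth_scaleR(1)[OF s, of "-1"], of 1] by simp
  have n: "nderiv i (\<lambda>u. 1 - \<phi> u) u = (if i = 0 then 1 else 0) - nderiv i \<phi> u" for i u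
    using smooth_add(2)[OF smooth_const(1) smooth_scaleR(1)[OF s], of i 1 "-1"]
      smooth_scaleR(2)[OF s, of i "-1"] by (simp add: smooth_const)
  have "\<exists>B. \<forall>u. \<bar>nderiv i (\<lambda>u. 1 - \<phi> u) u\<bar> \<le> B" for i
  proof -
    obtain B where B: "\<And>u. \<bar>nderiv i \<phi> u\<bar> \<le> B" using \<phi> by (auto simp: bounded_smooth_def)
    have "\<bar>nderiv i (\<lambda>u. 1 - \<phi> u) u\<bar> \<le> 1 + B" for u
      unfolding n using B[of u] abs_triangle_ineq4[of "if i = 0 then 1 else 0" "nderiv i \<phi> u"] by auto
    then show ?thesis by blast
  qed
  then show ?thesis using s1 by (simp add: bounded_smooth_def)
qed

lemma uniform_bound_upto:
  fixes F :: "nat \<Rightarrow> 'z \<Rightarrow> real"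
  assumes "\<And>m. m \<le> M \<Longrightarrow> \<exists>C. \<forall>z. P z \<longrightarrow> F m z \<le> C * b z" and b: "\<And>z. P z \<Longrightarrow> b z \<ge> 0"
  shows "\<exists>C\<ge>0. \<forall>m\<le>M. \<forall>z. P z \<longrightarrow> F m z \<le> C * b z"
proof -
  obtain C where C: "\<And>m z. m \<le> M \<Longrightarrow> P z \<Longrightarrow> F m z \<le> C m * b z"
    using assms(1) by metis
  have "F m z \<le> (\<Sum>i\<le>M. \<bar>C i\<bar>) * b z" if "m \<le> M" "P z" for m z
  proof -
    have "C m \<le> \<bar>C m\<bar>" by simp
    also have "\<dots> \<le> (\<Sum>i\<le>M. \<bar>C i\<bar>)" using that by (intro member_le_sum) auto
    finally show ?thesis using C[OF that] mult_right_mono[OF _ b[OF that(2)]] by (meson order.trans)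
  qed
  moreover have "(\<Sum>i\<le>M. \<bar>C i\<bar>) \<ge> 0" by (intro sum_nonneg) auto
  ultimately show ?thesis by blast
qed

lemma scaled_term_bound:
  fixes g :: "real \<Rightarrow> 'b::real_normed_vector"
  assumes g: "schwartz g" and \<phi>: "\<exists>B. \<forall>u. \<bar>\<phi> u\<bar> \<le> B"
  shows "\<exists>C\<ge>0. \<forall>\<rho> u. 0 < \<rho> \<and> \<rho> \<le> 1 \<longrightarrow>
    (1 + \<bar>u\<bar>) ^ M * (1 + \<bar>u / \<rho>\<bar>) ^ L *
      norm ((poly p u * \<phi> u) *\<^sub>R nderiv l (\<lambda>u. g (u / \<rho>)) u) \<le> C * (1 / \<rho>) ^ l"
proof -
  obtain B where B: "\<And>u. \<bar>\<phi> u\<bar> \<le> B" using \<phi> by blast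
  obtain Cp D where p: "Cp \<ge> 0" "\<And>u. \<bar>poly p u\<bar> \<le> Cp * (1 + \<bar>u\<bar>) ^ D" using poly_growth[of p] by blast
  obtain Cg where Cg: "Cg \<ge> 0" "\<And>u. (1 + \<bar>u\<bar>) ^ (D + M + L) * norm (nderiv l g u) \<le> Cg"
    using schwartz_decay[OF g] by blast
  have B0: "B \<ge> 0" using B[of 0] by linarith
  have "(1 + \<bar>u\<bar>) ^ M * (1 + \<bar>u / \<rho>\<bar>) ^ L *
      norm ((poly p u * \<phi> u) *\<^sub>R nderiv l (\<lambda>u. g (u / \<rho>)) u) \<le> (Cp * B * Cg) * (1 / \<rho>) ^ l"
    if \<rho>: "0 < \<rho>" "\<rho> \<le> 1" for \<rho> u
  proof -
    let ?v = "u / \<rho>"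
    have "\<bar>u\<bar> \<le> \<bar>?v\<bar>" using \<rho> mult_right_mono[of \<rho> 1 "\<bar>u\<bar>"] by (simp add: field_simps)
    then have uv: "(1 + \<bar>u\<bar>) ^ n \<le> (1 + \<bar>?v\<bar>) ^ n" for n by (intro power_mono) auto
    have n: "nderiv l (\<lambda>u. g (u / \<rho>)) u = (1 / \<rho>) ^ l *\<^sub>R nderiv l g ?v"
      using smooth_affine(2)[OF schwartz_smooth[OF g], of l "1 / \<rho>" 0] by (simp add: fun_eq_iff)
    have "(1 + \<bar>u\<bar>) ^ M * (1 + \<bar>?v\<bar>) ^ L * norm ((poly p u * \<phi> u) *\<^sub>R nderiv l (\<lambda>u. g (u / \<rho>)) u) =
      (1 / \<rho>) ^ l * ((1 + \<bar>u\<bar>) ^ M * (1 + \<bar>?v\<bar>) ^ L * (\<bar>poly p u\<bar> * \<bar>\<phi> u\<bar> * norm (nderiv l g ?v)))"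
      using \<rho> by (simp add: n abs_mult)
    also have "\<dots> \<le> (1 / \<rho>) ^ l * ((1 + \<bar>?v\<bar>) ^ M * (1 + \<bar>?v\<bar>) ^ L * (Cp * (1 + \<bar>?v\<bar>) ^ D * B * norm (nderiv l g ?v)))"
      using \<rho> p B B0
      by (intro mult_left_mono mult_mono uv order.refl order.trans[OF p(2) mult_left_mono[OF uv p(1)]]) auto
    also have "\<dots> = (1 / \<rho>) ^ l * (Cp * B * ((1 + \<bar>?v\<bar>) ^ (D + M + L) * norm (nderiv l g ?v)))"
      by (simp add: power_add mult_ac)
    also have "\<dots> \<le> (1 / \<rho>) ^ l * (Cp * B * Cg)"
      using \<rho> p B0 by (intro mult_left_mono Cg) auto
    finally show ?thesis by (simp add: mult_ac)
  qed
  then show ?thesis using p B0 Cg by (intro exI[of _ "Cp * B * Cg"]) auto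
qed

lemma nderiv_scaled_product:
  fixes g :: "real \<Rightarrow> 'b::real_normed_vector"
  assumes "schwartz g" "smooth \<phi>"
  shows "smooth (\<lambda>u. \<phi> u *\<^sub>R g (u / \<rho>))"
    and "nderiv m (\<lambda>u. \<phi> u *\<^sub>R g (u / \<rho>)) =
      expansion ((expansion_deriv 1 ^^ m) [(1, 0, 0)]) (\<lambda>i. nderiv i \<phi>) (\<lambda>l. nderiv l (\<lambda>u. g (u / \<rho>)))"
  using nderiv_product[OF assms(2) smooth_affine(1)[OF schwartz_smooth[OF assms(1)], of "1 / \<rho>" 0]]
  by simp_all

text \<open>
  Every derivative that falls on \<open>g\<close> costs a factor \<open>1 / \<rho>\<close>, at most \<open>M\<close> of them. The additional weight
  \<open>(1 + \<bar>u / \<rho>\<bar>) ^ L\<close> is free, because \<open>g\<close> decays at scale \<open>\<rho>\<close>; away from \<open>0\<close> it is worth \<open>\<rho> ^ (- L)\<close>.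
\<close>

lemma scaled_product_decay:
  fixes g :: "real \<Rightarrow> 'b::real_normed_vector"
  assumes g: "schwartz g" and \<phi>: "bounded_smooth \<phi>"
  obtains C where "C \<ge> 0" "\<And>\<rho> i u. 0 < \<rho> \<Longrightarrow> \<rho> \<le> 1 \<Longrightarrow> i \<le> M \<Longrightarrow>
    (1 + \<bar>u\<bar>) ^ M * (1 + \<bar>u / \<rho>\<bar>) ^ L * norm (nderiv i (\<lambda>u. \<phi> u *\<^sub>R g (u / \<rho>)) u) \<le> C * (1 / \<rho>) ^ M"
proof -
  have sm: "smooth \<phi>" and bd: "\<And>i. \<exists>B. \<forall>u. \<bar>nderiv i \<phi> u\<bar> \<le> B" using \<phi> by (auto simp: bounded_smooth_def)
  let ?W = "\<lambda>\<rho> u. (1 + \<bar>u\<bar>) ^ M * (1 + \<bar>u / \<rho>\<bar>) ^ L"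
  have W: "?W \<rho> u > 0" for \<rho> u :: real by (intro mult_pos_pos zero_less_power add_pos_nonneg) auto
  have "\<exists>C\<ge>0. \<forall>m\<le>M. \<forall>z. 0 < fst z \<and> fst z \<le> 1 \<longrightarrow>
    ?W (fst z) (snd z) * norm (nderiv m (\<lambda>u. \<phi> u *\<^sub>R g (u / fst z)) (snd z)) \<le> C * (1 / fst z) ^ M"
  proof (rule uniform_bound_upto)
    fix m assume m: "m \<le> M"
    let ?ts = "(expansion_deriv 1 ^^ m) [(1, 0, 0)] :: (real poly \<times> nat \<times> nat) list"
    have "\<exists>C. \<forall>\<rho> u. 0 < \<rho> \<and> \<rho> \<le> 1 \<longrightarrow>
      norm (expansion ?ts (\<lambda>i. nderiv i \<phi>) (\<lambda>l. nderiv l (\<lambda>u. g (u / \<rho>))) u) \<le> C * ((1 / \<rho>) ^ M / ?W \<rho> u)"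
    proof (rule expansion_bound)
      fix p i l assume "(p, i, l) \<in> set ?ts"
      then have l: "l \<le> M" using funpow_expansion_deriv_order m by (meson order.trans)
      let ?t = "\<lambda>\<rho> u. (poly p u * nderiv i \<phi> u) *\<^sub>R nderiv l (\<lambda>u. g (u / \<rho>)) u"
      obtain C where C: "C \<ge> 0" "\<And>\<rho> u. 0 < \<rho> \<Longrightarrow> \<rho> \<le> 1 \<Longrightarrow> ?W \<rho> u * norm (?t \<rho> u) \<le> C * (1 / \<rho>) ^ l"
        using scaled_term_bound[OF g bd[of i], where M = M and L = L and p = p and l = l] by auto
      have "norm (?t \<rho> u) \<le> C * ((1 / \<rho>) ^ M / ?W \<rho> u)" if \<rho>: "0 < \<rho>" "\<rho> \<le> 1" for \<rho> u
      proof -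
        have "(1 / \<rho>) ^ l \<le> (1 / \<rho>) ^ M" using \<rho> l by (intro power_increasing) auto
        then have "?W \<rho> u * norm (?t \<rho> u) \<le> C * (1 / \<rho>) ^ M"
          using C(2)[OF \<rho>, of u] mult_left_mono[OF _ C(1)] by (meson order.trans)
        then have "norm (?t \<rho> u) \<le> C * (1 / \<rho>) ^ M / ?W \<rho> u"
          using W[of u \<rho>] by (simp only: pos_le_divide_eq mult.commute)
        then show ?thesis by (simp only: times_divide_eq_right)
      qed
      then show "\<exists>C. \<forall>\<rho> u. 0 < \<rho> \<and> \<rho> \<le> 1 \<longrightarrow> norm (?t \<rho> u) \<le> C * ((1 / \<rho>) ^ M / ?W \<rho> u)" by blast
    qed
    then obtain C where C: "\<And>\<rho> u. 0 < \<rho> \<Longrightarrow> \<rho> \<le> 1 \<Longrightarrow>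
        norm (nderiv m (\<lambda>u. \<phi> u *\<^sub>R g (u / \<rho>)) u) \<le> C * ((1 / \<rho>) ^ M / ?W \<rho> u)"
      unfolding nderiv_scaled_product[OF g sm] by blast
    have "?W \<rho> u * norm (nderiv m (\<lambda>u. \<phi> u *\<^sub>R g (u / \<rho>)) u) \<le> C * (1 / \<rho>) ^ M"
      if "0 < \<rho>" "\<rho> \<le> 1" for \<rho> u
      using C[OF that, of u] W[of u \<rho>] by (simp only: times_divide_eq_right pos_le_divide_eq mult.commute)
    then show "\<exists>C. \<forall>z. 0 < fst z \<and> fst z \<le> 1 \<longrightarrow>
      ?W (fst z) (snd z) * norm (nderiv m (\<lambda>u. \<phi> u *\<^sub>R g (u / fst z)) (snd z)) \<le> C * (1 / fst z) ^ M"
      by blast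
  qed auto
  then obtain C where C: "C \<ge> 0" "\<forall>m\<le>M. \<forall>z. 0 < fst z \<and> fst z \<le> 1 \<longrightarrow>
    ?W (fst z) (snd z) * norm (nderiv m (\<lambda>u. \<phi> u *\<^sub>R g (u / fst z)) (snd z)) \<le> C * (1 / fst z) ^ M"
    by blast
  show ?thesis
  proof (rule that[OF C(1)])
    fix \<rho> u :: real and i assume "0 < \<rho>" "\<rho> \<le> 1" "i \<le> M"
    then show "?W \<rho> u * norm (nderiv i (\<lambda>u. \<phi> u *\<^sub>R g (u / \<rho>)) u) \<le> C * (1 / \<rho>) ^ M"
      using C(2)[rule_format, of i "(\<rho>, u)"] by (simp only: fst_conv snd_conv simp_thms)
  qed
qed

lemma scaled_seminorm_le:
  fixes g :: "real \<Rightarrow> 'b::real_normed_vector"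
  assumes g: "schwartz g" and \<phi>: "bounded_smooth \<phi>"
  obtains C where "C \<ge> 0"
    "\<And>\<rho>. 0 < \<rho> \<Longrightarrow> \<rho> \<le> 1 \<Longrightarrow> seminorm_le M (\<lambda>u. \<phi> u *\<^sub>R g (u / \<rho>)) (C * (1 / \<rho>) ^ M)"
proof -
  obtain C where C: "C \<ge> 0" "\<And>\<rho> i u. 0 < \<rho> \<Longrightarrow> \<rho> \<le> 1 \<Longrightarrow> i \<le> M \<Longrightarrow>
    (1 + \<bar>u\<bar>) ^ M * (1 + \<bar>u / \<rho>\<bar>) ^ 0 * norm (nderiv i (\<lambda>u. \<phi> u *\<^sub>R g (u / \<rho>)) u) \<le> C * (1 / \<rho>) ^ M"
    using scaled_product_decay[OF g \<phi>, of M 0] by blast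
  show ?thesis
    by (rule that[OF C(1)]) (use C(2) in \<open>simp add: seminorm_le_def\<close>)
qed

text \<open>
  A multiplier that vanishes near \<open>0\<close> removes the part where \<open>g (u / \<rho>)\<close> is concentrated; all seminorms of the rest
  are of arbitrarily high order in \<open>\<rho>\<close>.
\<close>

lemma scaled_far_seminorm_le:
  fixes g :: "real \<Rightarrow> 'b::real_normed_vector"
  assumes g: "schwartz g" and \<phi>: "bounded_smooth \<phi>" and \<delta>: "\<delta> > 0" "\<And>u. \<bar>u\<bar> < \<delta> \<Longrightarrow> \<phi> u = 0"
  obtains C where "C \<ge> 0"
    "\<And>\<rho>. 0 < \<rho> \<Longrightarrow> \<rho> \<le> 1 \<Longrightarrow> seminorm_le M (\<lambda>u. \<phi> u *\<^sub>R g (u / \<rho>)) (C * \<rho> ^ N)"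
proof -
  \<comment> \<open>The loss of \<open>M\<close> powers of \<open>\<rho>\<close> is made up for by \<open>M\<close> of the \<open>L\<close> powers gained far from \<open>0\<close>.\<close>
  define L where "L = N + M"
  obtain C where C: "C \<ge> 0" "\<And>\<rho> i u. 0 < \<rho> \<Longrightarrow> \<rho> \<le> 1 \<Longrightarrow> i \<le> M \<Longrightarrow>
    (1 + \<bar>u\<bar>) ^ M * (1 + \<bar>u / \<rho>\<bar>) ^ L * norm (nderiv i (\<lambda>u. \<phi> u *\<^sub>R g (u / \<rho>)) u) \<le> C * (1 / \<rho>) ^ M"
    using scaled_product_decay[OF g \<phi>, of M L] by blast
  have "(1 + \<bar>u\<bar>) ^ M * norm (nderiv i (\<lambda>u. \<phi> u *\<^sub>R g (u / \<rho>)) u) \<le> C * (1 / \<delta>) ^ L * \<rho> ^ N" (is "?T \<le> _")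
    if \<rho>: "0 < \<rho>" "\<rho> \<le> 1" and i: "i \<le> M" for \<rho> i u
  proof (cases "\<bar>u\<bar> < \<delta>")
    case True
    have "smooth (\<lambda>u. \<phi> u *\<^sub>R g (u / \<rho>))" using nderiv_scaled_product(1)[OF g] \<phi> by (simp add: bounded_smooth_def)
    then have "nderiv i (\<lambda>u. \<phi> u *\<^sub>R g (u / \<rho>)) u = 0"
      by (rule smooth_vanishing_nderiv[of _ "{-\<delta><..<\<delta>}"]) (use True \<delta> in auto)
    then show ?thesis using C(1) \<delta> \<rho> by simp
  next
    case False
    have "(\<delta> / \<rho>) ^ L \<le> (1 + \<bar>u / \<rho>\<bar>) ^ L"
      using False \<rho> \<delta> by (intro power_mono) (auto simp: field_simps)
    then have "(\<delta> / \<rho>) ^ L * ?T \<le> (1 + \<bar>u / \<rho>\<bar>) ^ L * ?T"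
      by (intro mult_right_mono) auto
    also have "\<dots> \<le> C * (1 / \<rho>) ^ M" using C(2)[OF \<rho> i, of u] by (simp only: mult_ac)
    finally have *: "(\<delta> / \<rho>) ^ L * ?T \<le> C * (1 / \<rho>) ^ M" .
    have "?T = (\<rho> / \<delta>) ^ L * ((\<delta> / \<rho>) ^ L * ?T)"
      using \<rho> \<delta> by (simp add: power_divide)
    also have "\<dots> \<le> (\<rho> / \<delta>) ^ L * (C * (1 / \<rho>) ^ M)"
      using * \<rho> \<delta> by (intro mult_left_mono) auto
    also have "\<dots> = C * (1 / \<delta>) ^ L * \<rho> ^ N"
      using \<rho> by (simp add: L_def power_add power_divide)
    finally show ?thesis .
  qed
  then show ?thesis using that[of "C * (1 / \<delta>) ^ L"] C(1) \<delta>(1) by (simp add: seminorm_le_def)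
qed

lemma schwartz_scaled_product:
  fixes g :: "real \<Rightarrow> 'b::real_normed_vector"
  assumes g: "schwartz g" and \<phi>: "bounded_smooth \<phi>" and \<rho>: "0 < \<rho>" "\<rho> \<le> 1"
  shows "schwartz (\<lambda>u. \<phi> u *\<^sub>R g (u / \<rho>))"
  unfolding schwartz_real_iff
proof (intro conjI allI)
  show "smooth (\<lambda>u. \<phi> u *\<^sub>R g (u / \<rho>))" using nderiv_scaled_product(1)[OF g] \<phi> by (simp add: bounded_smooth_def)
  show "\<exists>A. seminorm_le M (\<lambda>u. \<phi> u *\<^sub>R g (u / \<rho>)) A" for M
    using scaled_seminorm_le[OF g \<phi>, of M] \<rho> by metis
qed

lemma schwartz_dilation:
  fixes g :: "real \<Rightarrow> 'b::real_normed_vector"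
  assumes "schwartz g" "0 < \<rho>" "\<rho> \<le> 1"
  shows "schwartz (\<lambda>u. g (u / \<rho>))"
  using schwartz_scaled_product[OF assms(1) bounded_smooth_one assms(2,3)] by simp

section \<open>Moments of iterated integrals\<close>

text \<open>
  For \<open>k \<ge> 1\<close> the monomial grows at least linearly, with a rate that is uniform in \<open>\<bar>c\<bar> \<ge> d\<close>.
\<close>

lemma schwartz_monomial_decay:
  fixes G :: "real \<Rightarrow> real"
  assumes G: "schwartz G" and k: "k \<ge> 1" and d: "d > 0"
  obtains C where "C \<ge> 0" "\<And>c t. \<bar>c\<bar> \<ge> d \<Longrightarrow> (1 + \<bar>t\<bar>) ^ m * \<bar>nderiv i G (c * t ^ k)\<bar> \<le> C"
proof -
  obtain C where C: "C \<ge> 0" "\<And>u. (1 + \<bar>u\<bar>) ^ m * \<bar>nderiv i G u\<bar> \<le> C"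
    using schwartz_decay[OF G, of m i] by auto
  define K where "K = 2 + 1 / d"
  have K0: "K \<ge> 0" using d by (simp add: K_def)
  have "(1 + \<bar>t\<bar>) ^ m * \<bar>nderiv i G (c * t ^ k)\<bar> \<le> K ^ m * C" if c: "\<bar>c\<bar> \<ge> d" for c t
  proof -
    have "\<bar>t\<bar> \<le> 1 + \<bar>t\<bar> ^ k"
    proof (cases "\<bar>t\<bar> \<le> 1")
      case False
      then have "\<bar>t\<bar> ^ 1 \<le> \<bar>t\<bar> ^ k" using k by (intro power_increasing) auto
      then show ?thesis by simp
    qed (simp add: add_increasing2)
    then have "1 + \<bar>t\<bar> \<le> 2 + \<bar>t\<bar> ^ k" by simp
    also have "\<bar>t\<bar> ^ k \<le> 1 / d * \<bar>c * t ^ k\<bar>"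
      using c d mult_right_mono[OF c, of "\<bar>t\<bar> ^ k"] by (simp add: abs_mult power_abs field_simps)
    also have "2 + 1 / d * \<bar>c * t ^ k\<bar> \<le> K * (1 + \<bar>c * t ^ k\<bar>)"
      using d by (simp add: K_def distrib_left distrib_right)
    finally have "(1 + \<bar>t\<bar>) ^ m \<le> (K * (1 + \<bar>c * t ^ k\<bar>)) ^ m" by (intro power_mono) auto
    then have "(1 + \<bar>t\<bar>) ^ m * \<bar>nderiv i G (c * t ^ k)\<bar> \<le>
        (K * (1 + \<bar>c * t ^ k\<bar>)) ^ m * \<bar>nderiv i G (c * t ^ k)\<bar>"
      by (rule mult_right_mono) simp
    also have "\<dots> = K ^ m * ((1 + \<bar>c * t ^ k\<bar>) ^ m * \<bar>nderiv i G (c * t ^ k)\<bar>)"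
      by (simp add: power_mult_distrib)
    also have "\<dots> \<le> K ^ m * C" using K0 by (intro mult_left_mono C) auto
    finally show ?thesis .
  qed
  then show ?thesis using that[of "K ^ m * C"] K0 C(1) by simp
qed

lemma schwartz_monomial_integrable:
  fixes G :: "real \<Rightarrow> real"
  assumes G: "schwartz G" and "k \<ge> 1" "c \<noteq> 0"
  shows "integrable lborel (\<lambda>t. nderiv i G (c * t ^ k) * t ^ m)"
    and "continuous_on UNIV (\<lambda>t. nderiv i G (c * t ^ k) * t ^ m)"
proof -
  show cont: "continuous_on UNIV (\<lambda>t. nderiv i G (c * t ^ k) * t ^ m)"
    by (intro continuous_intros continuous_on_compose2[OF continuous_nderiv[OF schwartz_smooth[OF G], of UNIV]]) auto
  obtain C where C: "\<And>t. (1 + \<bar>t\<bar>) ^ (m + 2) * \<bar>nderiv i G (c * t ^ k)\<bar> \<le> C"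
    using schwartz_monomial_decay[OF assms(1,2), of "\<bar>c\<bar>" "m + 2" i] assms(3) by (metis order.refl zero_less_abs_iff)
  have "(1 + \<bar>t\<bar>) ^ 2 * norm (nderiv i G (c * t ^ k) * t ^ m) \<le> C" for t
  proof -
    have "\<bar>t\<bar> ^ m \<le> (1 + \<bar>t\<bar>) ^ m" by (intro power_mono) auto
    then have "(1 + \<bar>t\<bar>) ^ 2 * (\<bar>nderiv i G (c * t ^ k)\<bar> * \<bar>t\<bar> ^ m) \<le>
       (1 + \<bar>t\<bar>) ^ 2 * (\<bar>nderiv i G (c * t ^ k)\<bar> * (1 + \<bar>t\<bar>) ^ m)"
      by (intro mult_left_mono) auto
    also have "\<dots> = (1 + \<bar>t\<bar>) ^ (m + 2) * \<bar>nderiv i G (c * t ^ k)\<bar>"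
      by (simp only: power_add mult_ac)
    finally show ?thesis using C[of t] by (simp add: abs_mult power_abs)
  qed
  then show "integrable lborel (\<lambda>t. nderiv i G (c * t ^ k) * t ^ m)"
    by (rule decay_integrable[OF borel_measurable_continuous_onI[OF cont]])
qed

text \<open>
  The derivative of \<open>nderiv i G (c * t ^ k) * t ^ Suc m\<close> integrates to \<open>0\<close>. Read from left to right, this
  lowers the order of the derivative by one and the power by \<open>k\<close>; read backwards, it transfers moments from a function
  to its primitive.
\<close>

lemma monomial_moment_by_parts:
  fixes G :: "real \<Rightarrow> real"
  assumes G: "schwartz G" and k: "k \<ge> 1" and c: "c \<noteq> 0"
  shows "c * real k * (LINT t|lborel. nderiv (Suc i) G (c * t ^ k) * t ^ (m + k)) =
    - real (Suc m) * (LINT t|lborel. nderiv i G (c * t ^ k) * t ^ m)"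
proof -
  let ?F = "\<lambda>t. nderiv i G (c * t ^ k) * t ^ Suc m"
  let ?f = "\<lambda>t. c * real k * (nderiv (Suc i) G (c * t ^ k) * t ^ (m + k)) +
    real (Suc m) * (nderiv i G (c * t ^ k) * t ^ m)"
  note I = schwartz_monomial_integrable(1)[OF assms]
  note cont = schwartz_monomial_integrable(2)[OF assms]
  obtain C where C: "\<And>t. (1 + \<bar>t\<bar>) ^ (m + 2) * \<bar>nderiv i G (c * t ^ k)\<bar> \<le> C"
    using schwartz_monomial_decay[OF assms(1,2), of "\<bar>c\<bar>" "m + 2" i] assms(3) by (metis order.refl zero_less_abs_iff)
  have "(LINT t|lborel. ?f t) = 0"
  proof (rule integral_derivative_line)
    fix t :: real
    have "((\<lambda>t. c * t ^ k) has_real_derivative c * (real k * t ^ (k - 1))) (at t)"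
      by (auto intro!: derivative_eq_intros)
    from DERIV_chain2[OF nderiv_field_derivative[OF schwartz_smooth[OF G], of i] this]
    have "((\<lambda>t. nderiv i G (c * t ^ k)) has_real_derivative
        nderiv (Suc i) G (c * t ^ k) * (c * (real k * t ^ (k - 1)))) (at t)" .
    moreover have "((\<lambda>t. t ^ Suc m) has_real_derivative real (Suc m) * t ^ m) (at t)"
      by (rule derivative_eq_intros refl | simp)+
    ultimately have "(?F has_real_derivative
        nderiv i G (c * t ^ k) * (real (Suc m) * t ^ m) +
        nderiv (Suc i) G (c * t ^ k) * (c * (real k * t ^ (k - 1))) * t ^ Suc m) (at t)"
      by (rule DERIV_mult')
    moreover have "t ^ (m + k) = t ^ (k - 1) * t ^ Suc m"
      using k by (cases k) (auto simp: power_add mult_ac)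
    ultimately show "(?F has_real_derivative ?f t) (at t)"
      by (simp only: mult_ac add_ac)
  next
    show "continuous_on UNIV ?f" by (intro continuous_intros cont)
    show "integrable lborel ?f" using I by (intro Bochner_Integration.integrable_add integrable_mult_right) auto
    fix t :: real
    have "\<bar>t\<bar> ^ Suc m \<le> (1 + \<bar>t\<bar>) ^ Suc m" by (intro power_mono) auto
    then have "(1 + \<bar>t\<bar>) * (\<bar>nderiv i G (c * t ^ k)\<bar> * \<bar>t\<bar> ^ Suc m) \<le>
        (1 + \<bar>t\<bar>) * (\<bar>nderiv i G (c * t ^ k)\<bar> * (1 + \<bar>t\<bar>) ^ Suc m)"
      by (intro mult_left_mono) auto
    also have "\<dots> = (1 + \<bar>t\<bar>) ^ (m + 2) * \<bar>nderiv i G (c * t ^ k)\<bar>"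
      by (simp add: power_add power2_eq_square mult_ac)
    finally show "(1 + \<bar>t\<bar>) * \<bar>?F t\<bar> \<le> C" using C[of t] by (simp only: abs_mult power_abs)
  qed
  moreover have "(LINT t|lborel. ?f t) =
     c * real k * (LINT t|lborel. nderiv (Suc i) G (c * t ^ k) * t ^ (m + k)) +
     real (Suc m) * (LINT t|lborel. nderiv i G (c * t ^ k) * t ^ m)"
    using I by (subst Bochner_Integration.integral_add) auto
  ultimately show ?thesis by linarith
qed

lemma vanishing_moments_integral:
  assumes "vanishing_moments n r g" "n \<ge> 1" "r \<ge> 1"
  shows "(LINT t|lborel. g t) = 0"
  using assms unfolding vanishing_moments_def
  by (auto dest!: bspec[of _ _ 1] spec[of _ 0])

text \<open>
  One integration costs one vanishing moment, uniformly in the order: a moment of the primitive against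
  \<open>t ^ m\<close> is a multiple of one of \<open>g\<close> against \<open>t ^ (m + k)\<close>, and \<open>m < k * r\<close> means \<open>m + k < k * Suc r\<close>.
\<close>

lemma vanishing_moments_int_plus:
  assumes g: "schwartz g" and vm: "vanishing_moments n (Suc r) g" and n: "n \<ge> 1"
  shows "schwartz (int_plus g)" "vanishing_moments n r (int_plus g)" "nderiv (Suc i) (int_plus g) = nderiv i g"
proof -
  show s: "schwartz (int_plus g)"
    by (rule int_plus_schwartz[OF g vanishing_moments_integral[OF vm n]]) simp
  show d: "nderiv (Suc i) (int_plus g) = nderiv i g" for i
    using int_plus_smooth(2)[OF schwartz_smooth schwartz_integrable(2)] g by blast
  show "vanishing_moments n r (int_plus g)"
    unfolding vanishing_moments_def
  proof (intro ballI allI impI)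
    fix \<sigma> :: real and k m :: nat
    assume \<sigma>: "\<sigma> \<in> {1, -1}" and k: "k \<in> {1..n}" and m: "m < k * r"
    have "m + k < k * Suc r" using m by simp
    then have "(LINT t|lborel. g (\<sigma> * t ^ k) * t ^ (m + k)) = 0"
      using vm \<sigma> k unfolding vanishing_moments_def by blast
    then show "(LINT t|lborel. int_plus g (\<sigma> * t ^ k) * t ^ m) = 0"
      using monomial_moment_by_parts[OF s, of k \<sigma> 0 m] \<sigma> k d[of 0] by auto
  qed
qed

lemma funpow_int_plus:
  assumes g: "schwartz g" and vm: "vanishing_moments n r g" and n: "n \<ge> 1" and "j \<le> r"
  shows "schwartz ((int_plus ^^ j) g)" "vanishing_moments n (r - j) ((int_plus ^^ j) g)"
    "nderiv j ((int_plus ^^ j) g) = g"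
proof -
  have "schwartz ((int_plus ^^ j) g) \<and> vanishing_moments n (r - j) ((int_plus ^^ j) g) \<and>
    nderiv j ((int_plus ^^ j) g) = g" using \<open>j \<le> r\<close>
  proof (induction j)
    case (Suc j)
    then have r: "r - j = Suc (r - Suc j)" by simp
    from Suc show ?case
      using vanishing_moments_int_plus[of "(int_plus ^^ j) g" n "r - Suc j"] n r by simp
  qed (use g vm in simp)
  then show "schwartz ((int_plus ^^ j) g)" "vanishing_moments n (r - j) ((int_plus ^^ j) g)"
    "nderiv j ((int_plus ^^ j) g) = g" by auto
qed

text \<open>
  Integrating by parts \<open>i\<close> times leads to the moment of \<open>G\<close> itself against \<open>t ^ m\<close>; a dilation then reduces the
  coefficient \<open>c\<close> to its sign.
\<close>

lemma derivative_monomial_moments: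
  assumes G: "schwartz G" and vm: "vanishing_moments n r G" and k: "k \<in> {1..n}" and c: "c \<noteq> 0"
    and m: "m < k * r"
  shows "(LINT t|lborel. nderiv i G (c * t ^ k) * t ^ (k * i + m)) = 0"
proof (induction i)
  case 0
  define \<sigma> where "\<sigma> = sgn c"
  define b where "b = root k \<bar>c\<bar>"
  have b: "b > 0" "b ^ k = \<bar>c\<bar>" using c k by (auto simp: b_def real_root_pow_pos2)
  have \<sigma>: "\<sigma> \<in> {1, -1}" "\<sigma> * \<bar>c\<bar> = c" using c by (auto simp: \<sigma>_def sgn_if)
  have "0 = (LINT t|lborel. G (\<sigma> * t ^ k) * t ^ m)"
    using vm \<sigma> k m unfolding vanishing_moments_def by auto
  also have "\<dots> = \<bar>b\<bar> *\<^sub>R (LINT t|lborel. G (\<sigma> * (0 + b * t) ^ k) * (0 + b * t) ^ m)"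
    using b by (intro lborel_integral_real_affine) auto
  also have "(\<lambda>t. G (\<sigma> * (0 + b * t) ^ k) * (0 + b * t) ^ m) = (\<lambda>t. b ^ m * (G (c * t ^ k) * t ^ m))"
    using b \<sigma> by (simp add: power_mult_distrib fun_eq_iff flip: mult.assoc)
  finally show ?case using b by simp
next
  case (Suc i)
  then show ?case
    using monomial_moment_by_parts[OF G, of k c i "k * i + m"] k c
    by (auto simp: algebra_simps)
qed

section \<open>Iterated integrals of the delta acting on functions\<close>

text \<open>
  The integral of \<open>g\<close> against the \<open>j\<close>-fold integral of the delta at \<open>w\<close>. By duality it is the \<open>j\<close>-fold
  iterated integral of \<open>g\<close> in the opposite direction, evaluated at \<open>w\<close>.
\<close>

definition delta_adjoint :: "real \<Rightarrow> nat \<Rightarrow> (real \<Rightarrow> real) \<Rightarrow> real \<Rightarrow> real" where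
  "delta_adjoint \<sigma> j g w =
     (if j = 0 then g w else LINT u|lborel. iter_int_delta \<sigma> j (u - w) * g u)"

lemma abs_diff_power_le: "\<bar>u - w\<bar> ^ i \<le> (1 + \<bar>w\<bar>) ^ i * (1 + \<bar>u::real\<bar>) ^ i"
proof -
  have "\<bar>u - w\<bar> \<le> (1 + \<bar>w\<bar>) * (1 + \<bar>u\<bar>)"
  proof -
    have "(1 + \<bar>w\<bar>) * (1 + \<bar>u\<bar>) = 1 + \<bar>w\<bar> + \<bar>u\<bar> + \<bar>w\<bar> * \<bar>u\<bar>" by (simp add: algebra_simps)
    moreover have "0 \<le> \<bar>w\<bar> * \<bar>u\<bar>" by simp
    ultimately show ?thesis using abs_triangle_ineq4[of u w] by linarith
  qed
  then show ?thesis by (metis abs_ge_zero power_mono power_mult_distrib)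
qed

lemma iter_int_delta_measurable [measurable]: "iter_int_delta \<sigma> j \<in> borel_measurable borel"
  unfolding iter_int_delta_def[abs_def] by measurable

lemma abs_iter_int_delta_le:
  assumes "\<sigma> \<in> {1, -1}"
  shows "\<bar>iter_int_delta \<sigma> j (u - w)\<bar> \<le> (1 + \<bar>w\<bar>) ^ (j - 1) * (1 + \<bar>u\<bar>) ^ (j - 1)"
proof -
  have "\<bar>\<sigma>\<bar> = 1" using assms by auto
  then have "\<bar>iter_int_delta \<sigma> j (u - w)\<bar> = \<bar>u - w\<bar> ^ (j - 1) / fact (j - 1) * indicator {0<..} (\<sigma> * (u - w))"
    by (simp add: iter_int_delta_def abs_mult power_abs)
  also have "\<dots> \<le> \<bar>u - w\<bar> ^ (j - 1) * 1"
    by (intro mult_mono) (auto simp: divide_le_eq mult_ge1_I mult_le_cancel_left1 indicator_def)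
  finally show ?thesis using abs_diff_power_le[of u w "j - 1"] by simp
qed

lemma iter_int_delta_integrable:
  assumes [measurable]: "g \<in> borel_measurable borel" and \<sigma>: "\<sigma> \<in> {1, -1}"
    and C: "\<And>u. (1 + \<bar>u\<bar>) ^ (j + 1) * \<bar>g u\<bar> \<le> C" and j: "j \<ge> 1"
  shows "integrable lborel (\<lambda>u. iter_int_delta \<sigma> j (u - w) * g u)"
proof (rule decay_integrable)
  fix u
  have "(1 + \<bar>u\<bar>) ^ 2 * norm (iter_int_delta \<sigma> j (u - w) * g u) \<le>
     (1 + \<bar>u\<bar>) ^ 2 * ((1 + \<bar>w\<bar>) ^ (j - 1) * (1 + \<bar>u\<bar>) ^ (j - 1) * \<bar>g u\<bar>)"
    unfolding real_norm_def abs_mult by (intro mult_left_mono mult_right_mono abs_iter_int_delta_le \<sigma>) auto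
  also have "\<dots> = (1 + \<bar>w\<bar>) ^ (j - 1) * ((1 + \<bar>u\<bar>) ^ (2 + (j - 1)) * \<bar>g u\<bar>)"
    by (simp only: power_add mult_ac)
  also have "2 + (j - 1) = j + 1" using j by simp
  also have "(1 + \<bar>w\<bar>) ^ (j - 1) * ((1 + \<bar>u\<bar>) ^ (j + 1) * \<bar>g u\<bar>) \<le> (1 + \<bar>w\<bar>) ^ (j - 1) * C"
    by (intro mult_left_mono C) auto
  finally show "(1 + \<bar>u\<bar>) ^ 2 * norm (iter_int_delta \<sigma> j (u - w) * g u) \<le> (1 + \<bar>w\<bar>) ^ (j - 1) * C" .
qed measurable

lemma schwartz_measurable:
  fixes g :: "real \<Rightarrow> 'b::{banach, second_countable_topology}"
  assumes "schwartz g" shows "nderiv i g \<in> borel_measurable borel" "g \<in> borel_measurable borel"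
  using continuous_nderiv[OF schwartz_smooth[OF assms], of UNIV] smooth_continuous[OF schwartz_smooth[OF assms], of UNIV]
  by (auto intro: borel_measurable_continuous_onI)

lemma schwartz_iter_int_delta_integrable:
  assumes "schwartz g" "\<sigma> \<in> {1, -1}" "j \<ge> 1"
  shows "integrable lborel (\<lambda>u. iter_int_delta \<sigma> j (u - w) * nderiv i g u)"
proof -
  obtain C where "\<And>u. (1 + \<bar>u\<bar>) ^ (j + 1) * \<bar>nderiv i g u\<bar> \<le> C"
    using schwartz_decay[OF assms(1), of "j + 1" i] by auto
  then show ?thesis using assms schwartz_measurable[OF assms(1)] by (intro iter_int_delta_integrable) auto
qed

text \<open>
  Integration by parts on the half-line on which the kernel lives. For \<open>j = 0\<close> the kernel jumps and leaves the boundary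
  value at \<open>w\<close>; for \<open>j > 0\<close> it vanishes there.
\<close>

lemma delta_adjoint_Suc:
  assumes b: "schwartz b" and \<sigma>: "\<sigma> \<in> {1, -1}"
  shows "delta_adjoint \<sigma> (Suc j) (nderiv 1 b) w = - \<sigma> * delta_adjoint \<sigma> j b w"
proof (cases j)
  case 0
  obtain C where C: "\<And>u. (1 + \<bar>u\<bar>) ^ 1 * \<bar>nderiv 0 b u\<bar> \<le> C"
    using schwartz_decay[OF b, of 1 0] by auto
  have "(LINT u|lborel. indicator {0<..} (\<sigma> * (u - w)) * nderiv 1 b u) = - \<sigma> * b w"
  proof (rule integral_derivative_half_line)
    show "(1 + \<bar>u\<bar>) * \<bar>b u\<bar> \<le> C" for u using C[of u] by simp
    show "isCont b w"
      using smooth_continuous[OF schwartz_smooth[OF b], of UNIV] by (simp add: continuous_on_eq_continuous_at)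
  qed (use nderiv_field_derivative[OF schwartz_smooth[OF b], of 0] schwartz_integrable[OF b] \<sigma>
      continuous_nderiv[OF schwartz_smooth[OF b]] in auto)
  then show ?thesis by (simp add: 0 delta_adjoint_def iter_int_delta_def mult_ac)
next
  case (Suc i)
  let ?P = "\<lambda>i u. (\<sigma> * (u - w)) ^ i / fact i"
  let ?F = "\<lambda>u. ?P (Suc i) u * b u"
  let ?f = "\<lambda>u. \<sigma> * (?P i u * b u) + ?P (Suc i) u * nderiv 1 b u"
  have P: "(?P (Suc i) has_real_derivative \<sigma> * ?P i u) (at u)" for u
  proof -
    have "((\<lambda>u. \<sigma> * (u - w)) has_real_derivative \<sigma>) (at u)"
      by (auto intro!: derivative_eq_intros)
    from DERIV_cdivide[OF DERIV_power_Suc[OF this, of i], of "fact (Suc i)"]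
    have "((\<lambda>u. (\<sigma> * (u - w)) ^ Suc i / fact (Suc i)) has_real_derivative
      ((1 + real i) * (\<sigma> * (\<sigma> * (u - w)) ^ i)) / fact (Suc i)) (at u)" .
    moreover have "((1 + real i) * (\<sigma> * (\<sigma> * (u - w)) ^ i)) / fact (Suc i) = \<sigma> * ?P i u"
      by (simp add: fact_Suc)
    ultimately show ?thesis by simp
  qed
  have bd: "(b has_real_derivative nderiv 1 b u) (at u)" for u
    using nderiv_field_derivative[OF schwartz_smooth[OF b], of 0] by simp
  have Pb: "\<bar>?P l u\<bar> \<le> (1 + \<bar>w\<bar>) ^ l * (1 + \<bar>u\<bar>) ^ l" for l u
  proof -
    have "\<bar>?P l u\<bar> = \<bar>u - w\<bar> ^ l / fact l" using \<sigma> by (auto simp: abs_mult power_abs)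
    also have "\<dots> \<le> \<bar>u - w\<bar> ^ l" by (simp add: divide_le_eq mult_le_cancel_left1)
    finally show ?thesis using abs_diff_power_le[of u w l] by simp
  qed
  have dec: "\<exists>C. \<forall>u. (1 + \<bar>u\<bar>) ^ e * \<bar>?P l u * nderiv m b u\<bar> \<le> C" for l m e
  proof -
    obtain C where C: "\<And>u. (1 + \<bar>u\<bar>) ^ (e + l) * \<bar>nderiv m b u\<bar> \<le> C"
      using schwartz_decay[OF b, of "e + l" m] by auto
    have "(1 + \<bar>u\<bar>) ^ e * \<bar>?P l u * nderiv m b u\<bar> \<le> (1 + \<bar>w\<bar>) ^ l * C" for u
    proof -
      have "(1 + \<bar>u\<bar>) ^ e * \<bar>?P l u * nderiv m b u\<bar> \<le>
         (1 + \<bar>u\<bar>) ^ e * ((1 + \<bar>w\<bar>) ^ l * (1 + \<bar>u\<bar>) ^ l * \<bar>nderiv m b u\<bar>)"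
        unfolding abs_mult by (intro mult_left_mono mult_right_mono Pb[unfolded abs_mult]) auto
      also have "\<dots> = (1 + \<bar>w\<bar>) ^ l * ((1 + \<bar>u\<bar>) ^ (e + l) * \<bar>nderiv m b u\<bar>)"
        by (simp only: power_add mult_ac)
      also have "\<dots> \<le> (1 + \<bar>w\<bar>) ^ l * C" by (intro mult_left_mono C) auto
      finally show ?thesis .
    qed
    then show ?thesis by blast
  qed
  have cont: "continuous_on UNIV (\<lambda>u. ?P l u * nderiv m b u)" for l m
    by (intro continuous_intros continuous_nderiv schwartz_smooth b) auto
  have int: "integrable lborel (\<lambda>u. ?P l u * nderiv m b u)" for l m
  proof -
    obtain C where "\<And>u. (1 + \<bar>u\<bar>) ^ 2 * \<bar>?P l u * nderiv m b u\<bar> \<le> C" using dec by blast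
    then show ?thesis
      by (intro decay_integrable[of _ C] borel_measurable_continuous_onI cont) simp
  qed
  obtain C where C: "\<And>u. (1 + \<bar>u\<bar>) ^ 1 * \<bar>?P (Suc i) u * nderiv 0 b u\<bar> \<le> C" using dec by blast
  have "(LINT u|lborel. indicator {0<..} (\<sigma> * (u - w)) * ?f u) = - \<sigma> * ?F w"
  proof (rule integral_derivative_half_line[where F = "?F" and w = w, OF _ _ _ _ _ \<sigma>])
    show "(?F has_real_derivative ?f u) (at u)" for u
      using DERIV_mult[OF P bd, of u] by (simp only: mult_ac add_ac)
    then show "isCont ?F w" by (rule DERIV_isCont)
    show "continuous_on UNIV ?f" using cont[of i 0] cont[of "Suc i" 1]
      by (intro continuous_on_add continuous_on_mult_left) auto
    show "integrable lborel ?f" using int[of i 0] int[of "Suc i" 1]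
      by (intro Bochner_Integration.integrable_add integrable_mult_right) auto
    show "(1 + \<bar>u\<bar>) * \<bar>?F u\<bar> \<le> C" for u using C[of u] by simp
  qed
  also have "?F w = 0" by simp
  also have "(\<lambda>u. indicator {0<..} (\<sigma> * (u - w)) * ?f u) =
    (\<lambda>u. \<sigma> * (iter_int_delta \<sigma> (Suc i) (u - w) * b u) + iter_int_delta \<sigma> (Suc (Suc i)) (u - w) * nderiv 1 b u)"
    by (simp add: iter_int_delta_def fun_eq_iff indicator_def)
  also have "(LINT u|lborel. \<sigma> * (iter_int_delta \<sigma> (Suc i) (u - w) * b u) +
        iter_int_delta \<sigma> (Suc (Suc i)) (u - w) * nderiv 1 b u) =
     \<sigma> * delta_adjoint \<sigma> j b w + delta_adjoint \<sigma> (Suc j) (nderiv 1 b) w"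
    using schwartz_iter_int_delta_integrable[OF b \<sigma>, of "Suc i" w 0]
      schwartz_iter_int_delta_integrable[OF b \<sigma>, of "Suc (Suc i)" w 1]
    by (subst Bochner_Integration.integral_add) (auto simp: delta_adjoint_def Suc)
  finally show ?thesis by simp
qed

text \<open>
  Hence the two signs of a feasible function lead to the same function \<open>B\<close>, up to a sign.
\<close>

lemma delta_adjoint_nderiv:
  assumes B: "schwartz B" and \<sigma>: "\<sigma> \<in> {1, -1}"
  shows "delta_adjoint \<sigma> j (nderiv j B) w = (- \<sigma>) ^ j * B w"
proof (induction j)
  case 0
  show ?case by (simp add: delta_adjoint_def)
next
  case (Suc j)
  have "nderiv (Suc j) B = nderiv 1 (nderiv j B)"
    using nderiv_add[OF schwartz_smooth[OF B], of 1 j] by simp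
  then show ?case
    using delta_adjoint_Suc[OF schwartz_nderiv[OF B] \<sigma>, of j j w] Suc by simp
qed

lemma delta_adjoint_measurable [measurable]:
  assumes [measurable]: "g \<in> borel_measurable borel"
  shows "delta_adjoint \<sigma> j g \<in> borel_measurable borel"
proof (cases "j = 0")
  case False
  then have "delta_adjoint \<sigma> j g = (\<lambda>w. LINT u|lborel. iter_int_delta \<sigma> j (u - w) * g u)"
    by (simp add: delta_adjoint_def fun_eq_iff)
  also have "\<dots> \<in> borel_measurable borel" by measurable
  finally show ?thesis .
qed (simp add: delta_adjoint_def[abs_def])

lemma delta_adjoint_scale:
  assumes a: "a > 0" and \<sigma>: "\<sigma> \<in> {1, -1}"
  shows "a ^ j * delta_adjoint \<sigma> j g (w / a) = delta_adjoint \<sigma> j (\<lambda>u. g (u / a)) w"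
proof (cases j)
  case (Suc i)
  have "delta_adjoint \<sigma> j g (w / a) = \<bar>1 / a\<bar> *\<^sub>R (LINT u|lborel. iter_int_delta \<sigma> j ((0 + 1 / a * u) - w / a) * g (0 + 1 / a * u))"
    unfolding delta_adjoint_def using Suc a by (simp only: if_False nat.distinct, intro lborel_integral_real_affine) auto
  also have "(\<lambda>u. iter_int_delta \<sigma> j ((0 + 1 / a * u) - w / a) * g (0 + 1 / a * u)) =
     (\<lambda>u. (1 / a ^ i) * (iter_int_delta \<sigma> j (u - w) * g (u / a)))"
  proof
    fix u
    have "0 + 1 / a * u - w / a = (u - w) / a" by (simp add: diff_divide_distrib)
    moreover have "iter_int_delta \<sigma> j ((u - w) / a) = 1 / a ^ i * iter_int_delta \<sigma> j (u - w)"
      using a Suc by (simp add: iter_int_delta_def indicator_def power_divide zero_less_divide_iff)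
    ultimately show "iter_int_delta \<sigma> j ((0 + 1 / a * u) - w / a) * g (0 + 1 / a * u) =
       (1 / a ^ i) * (iter_int_delta \<sigma> j (u - w) * g (u / a))" by simp
  qed
  finally show ?thesis using a Suc by (simp add: delta_adjoint_def)
qed (simp add: delta_adjoint_def)

lemma far_decay:
  fixes g :: "real \<Rightarrow> real"
  assumes g: "schwartz g"
  obtains C where "C \<ge> 0" "\<And>a u. 0 < a \<Longrightarrow> a \<le> 1 \<Longrightarrow> \<bar>u\<bar> \<ge> 1 \<Longrightarrow> (1 + \<bar>u\<bar>) ^ m * \<bar>g (u / a)\<bar> \<le> C * a ^ N"
proof -
  obtain C where C: "C \<ge> 0" "\<And>u. (1 + \<bar>u\<bar>) ^ (m + N) * \<bar>nderiv 0 g u\<bar> \<le> C"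
    using schwartz_decay[OF g, of "m + N" 0] by auto
  have "(1 + \<bar>u\<bar>) ^ m * \<bar>g (u / a)\<bar> \<le> C * a ^ N" if a: "0 < a" "a \<le> 1" and u: "\<bar>u\<bar> \<ge> 1" for a u
  proof -
    have 1: "\<bar>u\<bar> \<le> \<bar>u / a\<bar>" using a mult_right_mono[of a 1 "\<bar>u\<bar>"] by (simp add: field_simps)
    have 2: "1 / a \<le> 1 + \<bar>u / a\<bar>" using a u by (simp add: field_simps)
    have "(1 + \<bar>u\<bar>) ^ m * (1 / a) ^ N * \<bar>g (u / a)\<bar> \<le> (1 + \<bar>u / a\<bar>) ^ m * (1 + \<bar>u / a\<bar>) ^ N * \<bar>g (u / a)\<bar>"
      using 1 2 a by (intro mult_right_mono mult_mono power_mono) auto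
    also have "\<dots> \<le> C" using C(2)[of "u / a"] by (simp add: power_add mult_ac)
    finally show ?thesis using a by (simp add: power_divide field_simps)
  qed
  then show ?thesis using C that by blast
qed

text \<open>
  The kernel grows polynomially, and the part of \<open>g (u / a)\<close> that the cutoff removes lives on \<open>\<bar>u\<bar> \<ge> 1\<close>, where it is
  of arbitrarily high order in \<open>a\<close>. By homogeneity of the kernel, the part without cutoff scales exactly.
\<close>

lemma delta_adjoint_cutoff:
  fixes g \<kappa> :: "real \<Rightarrow> real"
  assumes g: "schwartz g" and \<sigma>: "\<sigma> \<in> {1, -1}"
    and [measurable]: "\<kappa> \<in> borel_measurable borel"
    and \<kappa>: "\<And>u. \<bar>u\<bar> \<le> 1 \<Longrightarrow> \<kappa> u = 1" "\<And>u. \<bar>\<kappa> u\<bar> \<le> B"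
  obtains C where "C \<ge> 0" "\<And>a w. 0 < a \<Longrightarrow> a \<le> 1 \<Longrightarrow> \<bar>w\<bar> \<le> W \<Longrightarrow>
    \<bar>delta_adjoint \<sigma> j (\<lambda>u. \<kappa> u * g (u / a)) w - a ^ j * delta_adjoint \<sigma> j g (w / a)\<bar> \<le> C * a ^ N"
proof -
  obtain C where C: "C \<ge> 0" "\<And>a u. 0 < a \<Longrightarrow> a \<le> 1 \<Longrightarrow> \<bar>u\<bar> \<ge> 1 \<Longrightarrow>
      (1 + \<bar>u\<bar>) ^ (j + 1) * \<bar>g (u / a)\<bar> \<le> C * a ^ N"
    using far_decay[OF g, of "j + 1" N] by metis
  have B0: "B \<ge> 0" using \<kappa>(2)[of 0] by linarith
  have diff: "(1 + \<bar>u\<bar>) ^ (j + 1) * \<bar>(\<kappa> u - 1) * g (u / a)\<bar> \<le> (B + 1) * C * a ^ N"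
    if a: "0 < a" "a \<le> 1" for a u
  proof (cases "\<bar>u\<bar> \<le> 1")
    case True
    then show ?thesis using \<kappa> C a B0 by simp
  next
    case False
    have "\<bar>\<kappa> u - 1\<bar> \<le> B + 1" using \<kappa>(2)[of u] by linarith
    then have "\<bar>\<kappa> u - 1\<bar> * ((1 + \<bar>u\<bar>) ^ (j + 1) * \<bar>g (u / a)\<bar>) \<le> (B + 1) * (C * a ^ N)"
      using False B0 by (intro mult_mono[OF _ C(2)[OF a]]) auto
    then show ?thesis by (simp only: abs_mult mult_ac)
  qed
  note gm [measurable] = schwartz_measurable(2)[OF g]
  show ?thesis
  proof (cases "j = 0")
    case True
    have "\<bar>(\<kappa> w - 1) * g (w / a)\<bar> \<le> (B + 1) * C * a ^ N" if a: "0 < a" "a \<le> 1" for a w :: real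
      using diff[OF a, of w] mult_right_mono[of 1 "1 + \<bar>w\<bar>" "\<bar>(\<kappa> w - 1) * g (w / a)\<bar>"] True by simp
    then show ?thesis
      using that[of "(B + 1) * C"] B0 C True by (simp add: delta_adjoint_def algebra_simps)
  next
    case False
    define I where "I = (LINT u|lborel. inverse (1 + u ^ 2 :: real))"
    have I0: "I \<ge> 0" unfolding I_def by (intro integral_nonneg_AE) auto
    define C' where "C' = (1 + \<bar>W\<bar>) ^ (j - 1) * ((B + 1) * C)"
    have C'0: "C' \<ge> 0" using B0 C by (simp add: C'_def)
    show ?thesis
    proof (rule that[of "C' * I"])
      fix a w :: real assume a: "0 < a" "a \<le> 1" and w: "\<bar>w\<bar> \<le> W"
      let ?K = "\<lambda>u. iter_int_delta \<sigma> j (u - w)"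
      have ga: "schwartz (\<lambda>u. g (u / a))" by (rule schwartz_dilation[OF g a])
      have i1: "integrable lborel (\<lambda>u. ?K u * g (u / a))"
        using schwartz_iter_int_delta_integrable[OF ga \<sigma>, of j w 0] False by simp
      have i2: "integrable lborel (\<lambda>u. ?K u * ((\<kappa> u - 1) * g (u / a)))"
        by (rule iter_int_delta_integrable[OF _ \<sigma> diff[OF a]]) (use False in auto)
      have "delta_adjoint \<sigma> j (\<lambda>u. \<kappa> u * g (u / a)) w - a ^ j * delta_adjoint \<sigma> j g (w / a) =
         (LINT u|lborel. ?K u * g (u / a) + ?K u * ((\<kappa> u - 1) * g (u / a))) - (LINT u|lborel. ?K u * g (u / a))"
        unfolding delta_adjoint_scale[OF a(1) \<sigma>] using False by (simp add: delta_adjoint_def algebra_simps)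
      also have "\<dots> = (LINT u|lborel. ?K u * ((\<kappa> u - 1) * g (u / a)))"
        by (subst Bochner_Integration.integral_add[OF i1 i2]) simp
      also have "norm \<dots> \<le> (LINT u|lborel. C' * a ^ N * inverse (1 + u ^ 2))"
      proof (rule Bochner_Integration.integral_norm_bound_integral[OF i2])
        show "integrable lborel (\<lambda>u::real. C' * a ^ N * inverse (1 + u ^ 2))"
          by (rule integrable_mult_right[OF integrable_inverse_quadratic])
        fix u :: real
        have p: "1 + u\<^sup>2 > 0" by (simp add: add_pos_nonneg)
        have "(1 + u ^ 2) * \<bar>?K u * ((\<kappa> u - 1) * g (u / a))\<bar> \<le>
          (1 + \<bar>u\<bar>) ^ 2 * (((1 + \<bar>w\<bar>) ^ (j - 1) * (1 + \<bar>u\<bar>) ^ (j - 1)) * \<bar>(\<kappa> u - 1) * g (u / a)\<bar>)"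
          unfolding abs_mult[of "?K u"]
          by (intro mult_mono mult_right_mono abs_iter_int_delta_le \<sigma>) (auto simp: power2_sum)
        also have "\<dots> = (1 + \<bar>w\<bar>) ^ (j - 1) * ((1 + \<bar>u\<bar>) ^ (2 + (j - 1)) * \<bar>(\<kappa> u - 1) * g (u / a)\<bar>)"
          by (simp only: power_add mult_ac)
        also have "2 + (j - 1) = j + 1" using False by simp
        also have "(1 + \<bar>w\<bar>) ^ (j - 1) * ((1 + \<bar>u\<bar>) ^ (j + 1) * \<bar>(\<kappa> u - 1) * g (u / a)\<bar>) \<le>
          (1 + \<bar>W\<bar>) ^ (j - 1) * ((B + 1) * C * a ^ N)"
          by (intro mult_mono power_mono diff a) (use w B0 C a in auto)
        also have "\<dots> = C' * a ^ N" by (simp add: C'_def)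
        finally show "norm (?K u * ((\<kappa> u - 1) * g (u / a))) \<le> C' * a ^ N * inverse (1 + u\<^sup>2)"
          using p by (simp add: field_simps)
      qed
      also have "\<dots> = C' * I * a ^ N" by (simp add: I_def)
      finally show "\<bar>delta_adjoint \<sigma> j (\<lambda>u. \<kappa> u * g (u / a)) w - a ^ j * delta_adjoint \<sigma> j g (w / a)\<bar> \<le> C' * I * a ^ N"
        by simp
    qed (use C'0 I0 in simp)
  qed
qed

section \<open>Pairing a feasible function with a sheared product\<close>

lemma lborel_integral_translate:
  fixes f :: "real \<Rightarrow> 'b::{banach, second_countable_topology}"
  shows "(LINT y|lborel. f (y - t)) = (LINT y|lborel. f y)"
  using lborel_integral_real_affine[of 1 "\<lambda>y. f (y - t)" t] by simp

text \<open>
  Fubini with the inner integral along \<open>x\<^sub>1\<close>: for fixed \<open>x\<^sub>2\<close> the shear is a translation of \<open>x\<^sub>1\<close>, and the singularity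
  sits at the deviation of \<open>q\<close> from the shearing curve.
\<close>

lemma feasible_pairing_sheared:
  fixes q :: "real \<Rightarrow> real"
  assumes \<sigma>: "\<sigma> \<in> {1, -1}" and q: "continuous_on UNIV q"
    and G: "smooth G" "\<And>u. \<bar>u\<bar> > R \<Longrightarrow> G u = 0"
    and H: "smooth H" "\<And>y. \<bar>y\<bar> > R \<Longrightarrow> H y = 0"
  shows "feasible_pairing \<sigma> j q (sheared S t G H) =
    (LINT y|lborel. delta_adjoint \<sigma> j G (q (y + t) - poly S y) *\<^sub>R H y)"
proof (cases "j = 0")
  case True
  have "feasible_pairing \<sigma> j q (sheared S t G H) =
     (LINT y|lborel. G (q ((y - t) + t) - poly S (y - t)) *\<^sub>R H (y - t))"
    by (simp add: feasible_pairing_def True sheared_def)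
  also have "\<dots> = (LINT y|lborel. G (q (y + t) - poly S y) *\<^sub>R H y)"
    by (rule lborel_integral_translate[where f = "\<lambda>y. G (q (y + t) - poly S y) *\<^sub>R H y"])
  finally show ?thesis by (simp add: True delta_adjoint_def)
next
  case False
  let ?\<Theta> = "sheared S t G H"
  let ?f = "\<lambda>x y. of_real (iter_int_delta \<sigma> j (x - q y)) * ?\<Theta> (x, y)"
  have [measurable]: "q \<in> borel_measurable borel" by (rule borel_measurable_continuous_onI[OF q])
  have contG: "continuous_on A G" and contH: "continuous_on A H" for A
    using G H by (auto intro: smooth_continuous)
  have cont\<Theta>: "continuous_on UNIV ?\<Theta>"
    unfolding sheared_def[abs_def]
    by (intro continuous_intros continuous_on_compose2[OF contG[of UNIV]] continuous_on_compose2[OF contH[of UNIV]]) auto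
  obtain K where K: "compact K" "\<And>x. x \<notin> K \<Longrightarrow> ?\<Theta> x = 0"
    using test_function_sheared(1)[of G R H S t] G H by blast
  have int: "integrable (lborel \<Otimes>\<^sub>M lborel) (case_prod ?f)"
  proof -
    let ?P = "\<lambda>x. (\<sigma> * (fst x - q (snd x))) ^ (j - 1) / fact (j - 1) :: real"
    have "continuous_on K (\<lambda>x. of_real (?P x) * ?\<Theta> x)"
      by (intro continuous_intros continuous_on_compose2[OF q] continuous_on_subset[OF cont\<Theta>]) auto
    from borel_integrable_compact[OF K(1) this]
    have "integrable lborel (\<lambda>x. indicator K x *\<^sub>R (of_real (?P x) * ?\<Theta> x))" .
    moreover have "{x. \<sigma> * (fst x - q (snd x)) > 0} \<in> sets (lborel :: (real \<times> real) measure)"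
    proof -
      have "open ((\<lambda>x. \<sigma> * (fst x - q (snd x))) -` {0<..})"
        by (intro open_vimage continuous_intros continuous_on_compose2[OF q]) auto
      also have "(\<lambda>x. \<sigma> * (fst x - q (snd x))) -` {0<..} = {x. \<sigma> * (fst x - q (snd x)) > 0}" by auto
      finally show ?thesis by simp
    qed
    ultimately have "integrable lborel (\<lambda>x. indicator {x. \<sigma> * (fst x - q (snd x)) > 0} x *\<^sub>R
        (indicator K x *\<^sub>R (of_real (?P x) * ?\<Theta> x)))"
      by (rule integrable_mult_indicator[rotated])
    also have "(\<lambda>x. indicator {x. \<sigma> * (fst x - q (snd x)) > 0} x *\<^sub>R
        (indicator K x *\<^sub>R (of_real (?P x) * ?\<Theta> x))) = case_prod ?f"
      using K(2) by (auto simp: fun_eq_iff iter_int_delta_def indicator_def)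
    finally show ?thesis by (simp add: lborel_prod)
  qed
  have inner: "(LINT x|lborel. ?f x y) = delta_adjoint \<sigma> j G (q y - poly S (y - t)) *\<^sub>R H (y - t)" for y
  proof -
    let ?w = "q y - poly S (y - t)"
    have cpt: "integrable lborel (\<lambda>u. iter_int_delta \<sigma> j (u - ?w) * G u)"
    proof -
      obtain B where B: "\<And>u. \<bar>u\<bar> \<le> R \<Longrightarrow> \<bar>G u\<bar> \<le> B"
        using continuous_interval_bounded[OF contG] by metis
      have "(1 + \<bar>u\<bar>) ^ (j + 1) * \<bar>G u\<bar> \<le> (1 + \<bar>R\<bar>) ^ (j + 1) * \<bar>B\<bar>" for u
      proof (cases "\<bar>u\<bar> > R")
        case False
        then have "\<bar>G u\<bar> \<le> \<bar>B\<bar>" using B[of u] abs_ge_self[of B] by fastforce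
        then show ?thesis using False by (intro mult_mono power_mono) auto
      qed (simp add: G)
      then show ?thesis using False \<sigma>
        by (intro iter_int_delta_integrable[where C = "(1 + \<bar>R\<bar>) ^ (j + 1) * \<bar>B\<bar>"] borel_measurable_continuous_onI contG) auto
    qed
    have "(LINT x|lborel. ?f x y) =
        (LINT x|lborel. (iter_int_delta \<sigma> j ((x - poly S (y - t)) - ?w) * G (x - poly S (y - t))) *\<^sub>R H (y - t))"
      by (simp add: sheared_def scaleR_conv_of_real mult_ac)
    also have "\<dots> = (LINT u|lborel. (iter_int_delta \<sigma> j (u - ?w) * G u) *\<^sub>R H (y - t))"
      by (rule lborel_integral_translate[where f = "\<lambda>u. (iter_int_delta \<sigma> j (u - ?w) * G u) *\<^sub>R H (y - t)"])
    also have "\<dots> = (LINT u|lborel. iter_int_delta \<sigma> j (u - ?w) * G u) *\<^sub>R H (y - t)"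
      using cpt by (intro Bochner_Integration.integral_scaleR_left) auto
    finally show ?thesis using False by (simp add: delta_adjoint_def)
  qed
  have "feasible_pairing \<sigma> j q ?\<Theta> = integral\<^sup>L (lborel \<Otimes>\<^sub>M lborel) (\<lambda>(x, y). ?f x y)"
    using False by (simp add: feasible_pairing_def lborel_prod case_prod_unfold)
  also have "\<dots> = (LINT y|lborel. LINT x|lborel. ?f x y)"
    by (rule lborel_pair.integral_snd[OF int, symmetric])
  also have "\<dots> = (LINT y|lborel. delta_adjoint \<sigma> j G (q ((y - t) + t) - poly S (y - t)) *\<^sub>R H (y - t))"
    unfolding inner by simp
  also have "\<dots> = (LINT y|lborel. delta_adjoint \<sigma> j G (q (y + t) - poly S y) *\<^sub>R H y)"
    by (rule lborel_integral_translate[where f = "\<lambda>y. delta_adjoint \<sigma> j G (q (y + t) - poly S y) *\<^sub>R H y"])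
  finally show ?thesis .
qed

section \<open>Localization\<close>

lemma powr_nat_mult: "a > 0 \<Longrightarrow> (a powr x) ^ n = a powr (x * real n)"
  by (simp add: powr_powr powr_realpow[symmetric])

text \<open>
  Both cutoffs change the rescaled factors by functions whose seminorms are of arbitrarily high order in
  \<open>a\<close>, while the seminorms of the other factor grow at most like a fixed power of \<open>1 / a\<close>.
\<close>

lemma localization:
  assumes f: "tempered_distribution f" and \<alpha>: "\<alpha> > 0" and \<delta>: "\<delta> > 0"
    and g: "schwartz g" and h: "schwartz h"
    and \<kappa>: "bounded_smooth \<kappa>" "\<And>u. \<bar>u\<bar> \<le> 1 \<Longrightarrow> \<kappa> u = 1"
  obtains C where "\<And>a. 0 < a \<Longrightarrow> a \<le> 1 \<Longrightarrow>
    norm (f (sheared S t (\<lambda>u. g (u / a)) (\<lambda>y. h (y / a powr \<alpha>))) -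
      f (sheared S t (\<lambda>u. \<kappa> u * g (u / a)) (\<lambda>y. \<kappa> (y / \<delta>) *\<^sub>R h (y / a powr \<alpha>)))) \<le> C * a ^ N"
proof -
  obtain C0 M where C0: "C0 \<ge> 0" and bound: "\<And>g h A B. schwartz g \<Longrightarrow> schwartz h \<Longrightarrow>
      seminorm_le M g A \<Longrightarrow> seminorm_le M h B \<Longrightarrow> norm (f (sheared S t g h)) \<le> C0 * (A * B)"
    using tempered_sheared_bound[OF f, of S t] by metis
  define \<kappa>' where "\<kappa>' = (\<lambda>y. \<kappa> (y / \<delta>))"
  have \<kappa>': "bounded_smooth \<kappa>'" unfolding \<kappa>'_def using bounded_smooth_dilation[OF \<kappa>(1), of "1 / \<delta>"] by simp
  have far: "\<bar>y\<bar> < 1 \<Longrightarrow> 1 - \<kappa> y = 0" "\<bar>y\<bar> < \<delta> \<Longrightarrow> 1 - \<kappa>' y = 0" for y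
    using \<kappa>(2)[of y] \<kappa>(2)[of "y / \<delta>"] \<delta> by (auto simp: \<kappa>'_def)
  \<comment> \<open>\<open>N1\<close> and \<open>N2\<close> also compensate the loss of \<open>M\<close> powers of the other scale.\<close>
  define N1 where "N1 = N + nat \<lceil>\<alpha> * M\<rceil>"
  define N2 where "N2 = nat \<lceil>(N + M) / \<alpha>\<rceil>"
  obtain C1 where C1: "\<And>\<rho>. 0 < \<rho> \<Longrightarrow> \<rho> \<le> 1 \<Longrightarrow>
      seminorm_le M (\<lambda>u. (1 - \<kappa> u) *\<^sub>R g (u / \<rho>)) (C1 * \<rho> ^ N1)"
    using scaled_far_seminorm_le[OF g bounded_smooth_complement[OF \<kappa>(1)] zero_less_one far(1), of M N1] by blast
  obtain C2 where C2: "\<And>\<rho>. 0 < \<rho> \<Longrightarrow> \<rho> \<le> 1 \<Longrightarrow>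
      seminorm_le M (\<lambda>u. 1 *\<^sub>R h (u / \<rho>)) (C2 * (1 / \<rho>) ^ M)"
    using scaled_seminorm_le[OF h bounded_smooth_one, of M] by auto
  obtain C3 where C3: "\<And>\<rho>. 0 < \<rho> \<Longrightarrow> \<rho> \<le> 1 \<Longrightarrow>
      seminorm_le M (\<lambda>u. \<kappa> u *\<^sub>R g (u / \<rho>)) (C3 * (1 / \<rho>) ^ M)"
    using scaled_seminorm_le[OF g \<kappa>(1), of M] by auto
  obtain C4 where C4: "\<And>\<rho>. 0 < \<rho> \<Longrightarrow> \<rho> \<le> 1 \<Longrightarrow>
      seminorm_le M (\<lambda>u. (1 - \<kappa>' u) *\<^sub>R h (u / \<rho>)) (C4 * \<rho> ^ N2)"
    using scaled_far_seminorm_le[OF h bounded_smooth_complement[OF \<kappa>'] \<delta> far(2), of M N2] by blast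
  have "norm (f (sheared S t (\<lambda>u. g (u / a)) (\<lambda>y. h (y / a powr \<alpha>))) -
      f (sheared S t (\<lambda>u. \<kappa> u * g (u / a)) (\<lambda>y. \<kappa>' y *\<^sub>R h (y / a powr \<alpha>)))) \<le>
      (C0 * \<bar>C1 * C2\<bar> + C0 * \<bar>C3 * C4\<bar>) * a ^ N" if a: "0 < a" "a \<le> 1" for a
  proof -
    define \<rho> where "\<rho> = a powr \<alpha>"
    have \<rho>: "0 < \<rho>" "\<rho> \<le> 1" using a \<alpha> by (auto simp: \<rho>_def powr_le1)
    let ?ga = "\<lambda>u. g (u / a)" and ?ha = "\<lambda>y. h (y / \<rho>)"
    let ?g1 = "\<lambda>u. \<kappa> u *\<^sub>R g (u / a)" and ?g2 = "\<lambda>u. (1 - \<kappa> u) *\<^sub>R g (u / a)"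
    let ?h1 = "\<lambda>y. \<kappa>' y *\<^sub>R h (y / \<rho>)" and ?h2 = "\<lambda>y. (1 - \<kappa>' y) *\<^sub>R h (y / \<rho>)"
    have s: "schwartz ?g1" "schwartz ?g2" "schwartz ?h1" "schwartz ?h2" "schwartz (\<lambda>y. 1 *\<^sub>R ?ha y)"
      by (rule schwartz_scaled_product[OF g \<kappa>(1) a] schwartz_scaled_product[OF g bounded_smooth_complement[OF \<kappa>(1)] a]
          schwartz_scaled_product[OF h \<kappa>' \<rho>] schwartz_scaled_product[OF h bounded_smooth_complement[OF \<kappa>'] \<rho>]
          schwartz_scaled_product[OF h bounded_smooth_one \<rho>])+
    have add: "f (\<lambda>x. \<phi> x + \<psi> x) = f \<phi> + f \<psi>" if "schwartz \<phi>" "schwartz \<psi>" for \<phi> \<psi>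
      using f that unfolding tempered_distribution_def by blast
    have "sheared S t ?ga ?ha = (\<lambda>x. sheared S t ?g2 (\<lambda>y. 1 *\<^sub>R ?ha y) x + sheared S t ?g1 (\<lambda>y. 1 *\<^sub>R ?ha y) x)"
      by (simp add: sheared_def fun_eq_iff algebra_simps)
    then have 1: "f (sheared S t ?ga ?ha) = f (sheared S t ?g2 (\<lambda>y. 1 *\<^sub>R ?ha y)) + f (sheared S t ?g1 (\<lambda>y. 1 *\<^sub>R ?ha y))"
      using add[OF schwartz_sheared[OF s(2,5)] schwartz_sheared[OF s(1,5)]] by simp
    have "sheared S t ?g1 (\<lambda>y. 1 *\<^sub>R ?ha y) = (\<lambda>x. sheared S t ?g1 ?h2 x + sheared S t ?g1 ?h1 x)"
      by (simp add: sheared_def fun_eq_iff algebra_simps)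
    then have 2: "f (sheared S t ?g1 (\<lambda>y. 1 *\<^sub>R ?ha y)) = f (sheared S t ?g1 ?h2) + f (sheared S t ?g1 ?h1)"
      using add[OF schwartz_sheared[OF s(1,4)] schwartz_sheared[OF s(1,3)]] by simp
    have "norm (f (sheared S t ?g2 (\<lambda>y. 1 *\<^sub>R ?ha y))) \<le> C0 * ((C1 * a ^ N1) * (C2 * (1 / \<rho>) ^ M))"
      by (rule bound[OF s(2,5) C1[OF a] C2[OF \<rho>]])
    also have "\<dots> = C0 * (C1 * C2) * (a ^ N1 * (1 / \<rho>) ^ M)" by simp
    also have "\<dots> \<le> C0 * \<bar>C1 * C2\<bar> * a ^ N"
    proof (rule mult_mono[OF mult_left_mono[OF abs_ge_self C0]])
      have "a ^ N1 * (1 / \<rho>) ^ M = a powr (real N1 - \<alpha> * M)"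
        using a by (simp add: \<rho>_def power_divide powr_nat_mult powr_diff powr_realpow)
      also have "\<dots> \<le> a powr (real N)"
        using a \<alpha> by (intro powr_mono') (auto simp: N1_def of_nat_nat)
      finally show "a ^ N1 * (1 / \<rho>) ^ M \<le> a ^ N" using a by (simp add: powr_realpow)
    qed (use C0 a \<rho> in auto)
    finally have 3: "norm (f (sheared S t ?g2 (\<lambda>y. 1 *\<^sub>R ?ha y))) \<le> C0 * \<bar>C1 * C2\<bar> * a ^ N" .
    have "norm (f (sheared S t ?g1 ?h2)) \<le> C0 * ((C3 * (1 / a) ^ M) * (C4 * \<rho> ^ N2))"
      by (rule bound[OF s(1,4) C3[OF a] C4[OF \<rho>]])
    also have "\<dots> = C0 * (C3 * C4) * ((1 / a) ^ M * \<rho> ^ N2)" by simp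
    also have "\<dots> \<le> C0 * \<bar>C3 * C4\<bar> * a ^ N"
    proof (rule mult_mono[OF mult_left_mono[OF abs_ge_self C0]])
      have "(1 / a) ^ M * \<rho> ^ N2 = a powr (\<alpha> * real N2 - real M)"
        using a by (simp add: \<rho>_def power_divide powr_nat_mult powr_diff powr_realpow)
      also have "\<dots> \<le> a powr (real N)"
      proof (intro powr_mono' a(2) less_imp_le[OF a(1)])
        have "(real N + real M) / \<alpha> \<le> real N2" unfolding N2_def using real_nat_ceiling_ge[of "real (N + M) / \<alpha>"] by simp
        then show "real N \<le> \<alpha> * real N2 - real M" using \<alpha> by (simp add: field_simps)
      qed
      finally show "(1 / a) ^ M * \<rho> ^ N2 \<le> a ^ N" using a by (simp add: powr_realpow)
    qed (use C0 a \<rho> in auto)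
    finally have 4: "norm (f (sheared S t ?g1 ?h2)) \<le> C0 * \<bar>C3 * C4\<bar> * a ^ N" .
    have "f (sheared S t ?ga ?ha) - f (sheared S t ?g1 ?h1) =
        f (sheared S t ?g2 (\<lambda>y. 1 *\<^sub>R ?ha y)) + f (sheared S t ?g1 ?h2)"
      unfolding 1 2 by simp
    then have "norm (f (sheared S t ?ga ?ha) - f (sheared S t ?g1 ?h1)) \<le>
      norm (f (sheared S t ?g2 (\<lambda>y. 1 *\<^sub>R ?ha y))) + norm (f (sheared S t ?g1 ?h2))"
      by (simp only: norm_triangle_ineq)
    then show ?thesis using 3 4 by (simp add: \<rho>_def distrib_right)
  qed
  then show ?thesis using that unfolding \<kappa>'_def by blast
qed

lemma compactly_supported_integrable:
  fixes F :: "real \<Rightarrow> 'b::{banach, second_countable_topology}"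
  assumes [measurable]: "F \<in> borel_measurable borel" and B: "B \<ge> 0"
    and F: "\<And>y. norm (F y) \<le> B * indicator {-R..R} y"
  shows "integrable lborel F" "norm (LINT y|lborel. F y) \<le> B * (2 * \<bar>R\<bar>)"
proof -
  have "integrable lborel (indicator {-R..R} :: real \<Rightarrow> real)"
    by (cases "R \<ge> 0") (auto intro!: integrable_real_indicator)
  then have i: "integrable lborel (\<lambda>y. B * indicator {-R..R} y :: real)"
    by (rule integrable_mult_right)
  show int: "integrable lborel F"
    by (rule Bochner_Integration.integrable_bound[OF i]) (use F B in auto)
  have "norm (LINT y|lborel. F y) \<le> (LINT y|lborel. B * indicator {-R..R} y)"
    by (rule Bochner_Integration.integral_norm_bound_integral[OF int i]) (rule F)
  also have "\<dots> = B * measure lborel {-R..R}" by simp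
  also have "measure lborel {-R..R} \<le> 2 * \<bar>R\<bar>"
    by (cases "R \<ge> 0") auto
  then have "B * measure lborel {-R..R} \<le> B * (2 * \<bar>R\<bar>)"
    using B by (rule mult_left_mono)
  finally show "norm (LINT y|lborel. F y) \<le> B * (2 * \<bar>R\<bar>)" .
qed

text \<open>
  After localization the argument is a test function, so that the distribution is given by the pairing;
  then the cutoff in the first variable is dropped again, at a cost of order \<open>a ^ N\<close>, in order to express the inner
  integral by \<open>A\<close>.
\<close>

lemma tempered_feasible_representation:
  assumes f: "tempered_distribution f"
    and pairing: "\<And>\<phi>. test_function \<phi> \<Longrightarrow> f \<phi> = feasible_pairing \<sigma> j q \<phi>"
    and \<sigma>: "\<sigma> \<in> {1, -1}" and q: "continuous_on UNIV q" and \<alpha>: "\<alpha> > 0" and \<delta>: "\<delta> > 0"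
    and A: "schwartz A" "nderiv j A = g" and h: "schwartz h"
    and \<kappa>: "bounded_smooth \<kappa>" "\<And>u. \<bar>u\<bar> \<le> 1 \<Longrightarrow> \<kappa> u = 1" "\<And>u. \<bar>u\<bar> \<ge> 2 \<Longrightarrow> \<kappa> u = 0"
  obtains C where "\<And>a. 0 < a \<Longrightarrow> a \<le> 1 \<Longrightarrow>
    norm (f (sheared S t (\<lambda>u. g (u / a)) (\<lambda>y. h (y / a powr \<alpha>))) -
      ((- \<sigma>) ^ j * a ^ j) *\<^sub>R
        (LINT y|lborel. A ((q (y + t) - poly S y) / a) *\<^sub>R (\<kappa> (y / \<delta>) *\<^sub>R h (y / a powr \<alpha>)))) \<le> C * a ^ N"
proof -
  have g: "schwartz g" using schwartz_nderiv[OF A(1), of j] A(2) by simp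
  define p where "p y = q (y + t) - poly S y" for y
  have contp: "continuous_on UNIV p"
    unfolding p_def[abs_def] by (intro continuous_intros continuous_on_compose2[OF q]) auto
  have [measurable]: "p \<in> borel_measurable borel" by (rule borel_measurable_continuous_onI[OF contp])
  have smk: "smooth \<kappa>" using \<kappa> by (simp add: bounded_smooth_def)
  have \<kappa>m [measurable]: "\<kappa> \<in> borel_measurable borel"
    using smk by (intro borel_measurable_continuous_onI smooth_continuous)
  note [measurable] = schwartz_measurable(2)[OF g] schwartz_measurable(2)[OF h] schwartz_measurable(2)[OF A(1)]
  obtain W where W: "\<And>y. \<bar>y\<bar> \<le> 2 * \<delta> \<Longrightarrow> \<bar>p y\<bar> \<le> W"
    using continuous_interval_bounded[OF continuous_on_subset[OF contp subset_UNIV]] by metis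
  obtain B where B: "\<And>u. \<bar>\<kappa> u\<bar> \<le> B"
    using \<kappa>(1) unfolding bounded_smooth_def by (metis nderiv_0)
  have B0: "B \<ge> 0" using B[of 0] by linarith
  obtain Bh where Bh: "Bh \<ge> 0" "\<And>u. norm (h u) \<le> Bh"
    using schwartz_decay[OF h, of 0 0] by auto
  obtain BA where BA: "BA \<ge> 0" "\<And>u. \<bar>A u\<bar> \<le> BA"
    using schwartz_decay[OF A(1), of 0 0] by auto
  obtain C1 where C1: "\<And>a. 0 < a \<Longrightarrow> a \<le> 1 \<Longrightarrow>
    norm (f (sheared S t (\<lambda>u. g (u / a)) (\<lambda>y. h (y / a powr \<alpha>))) -
      f (sheared S t (\<lambda>u. \<kappa> u * g (u / a)) (\<lambda>y. \<kappa> (y / \<delta>) *\<^sub>R h (y / a powr \<alpha>)))) \<le> C1 * a ^ N"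
    using localization[OF f \<alpha> \<delta> g h \<kappa>(1,2), of S t N] by blast
  obtain C2 where C2: "C2 \<ge> 0" "\<And>a w. 0 < a \<Longrightarrow> a \<le> 1 \<Longrightarrow> \<bar>w\<bar> \<le> W \<Longrightarrow>
    \<bar>delta_adjoint \<sigma> j (\<lambda>u. \<kappa> u * g (u / a)) w - a ^ j * delta_adjoint \<sigma> j g (w / a)\<bar> \<le> C2 * a ^ N"
    using delta_adjoint_cutoff[where \<kappa> = \<kappa> and W = W and j = j and N = N, OF g \<sigma> \<kappa>m \<kappa>(2) B] by auto
  define C where "C = C1 + C2 * (B * Bh) * (2 * \<bar>2 * \<delta>\<bar>)"
  have "norm (f (sheared S t (\<lambda>u. g (u / a)) (\<lambda>y. h (y / a powr \<alpha>))) -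
      ((- \<sigma>) ^ j * a ^ j) *\<^sub>R (LINT y|lborel. A (p y / a) *\<^sub>R (\<kappa> (y / \<delta>) *\<^sub>R h (y / a powr \<alpha>)))) \<le> C * a ^ N"
    if a: "0 < a" "a \<le> 1" for a
  proof -
    define \<rho> where "\<rho> = a powr \<alpha>"
    have \<rho>: "0 < \<rho>" "\<rho> \<le> 1" using a \<alpha> by (auto simp: \<rho>_def powr_le1)
    let ?G = "\<lambda>u. \<kappa> u * g (u / a)" and ?H = "\<lambda>y. \<kappa> (y / \<delta>) *\<^sub>R h (y / \<rho>)"
    let ?F2 = "\<lambda>y. ((- \<sigma>) ^ j * a ^ j * A (p y / a)) *\<^sub>R ?H y"
    let ?D = "\<lambda>y. (delta_adjoint \<sigma> j ?G (p y) - a ^ j * delta_adjoint \<sigma> j g (p y / a)) *\<^sub>R ?H y"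
    have smG: "smooth ?G"
      using nderiv_scaled_product(1)[OF g smk, of a] by simp
    have smH: "smooth ?H"
      using nderiv_scaled_product(1)[OF h, of "\<lambda>y. \<kappa> (y / \<delta>)" \<rho>] smooth_affine(1)[OF smk, of "1 / \<delta>" 0] by simp
    have H0: "?H y = 0" if "\<bar>y\<bar> > 2 * \<delta>" for y
      using \<kappa>(3)[of "y / \<delta>"] that \<delta> by (simp add: field_simps)
    have G0: "?G u = 0" if "\<bar>u\<bar> > 2" for u
      using \<kappa>(3)[of u] that by simp
    have R: "?G u = 0" "?H u = 0" if "\<bar>u\<bar> > 2 + 2 * \<delta>" for u
      using that \<delta> G0[of u] H0[of u] by auto
    have Hb: "norm (?H y) \<le> B * Bh * indicator {- (2 * \<delta>)..2 * \<delta>} y" for y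
    proof (cases "\<bar>y\<bar> > 2 * \<delta>")
      case False
      then show ?thesis
        using mult_mono[OF B[of "y / \<delta>"] Bh(2)[of "y / \<rho>"] B0 norm_ge_zero] by (auto simp: indicator_def)
    next
      case True
      have "norm (?H y) = 0" unfolding H0[OF True] by simp
      then show ?thesis using B0 Bh(1) by (simp only:) simp
    qed
    have bndD: "norm (?D y) \<le> C2 * a ^ N * (B * Bh) * indicator {- (2 * \<delta>)..2 * \<delta>} y" for y
    proof (cases "\<bar>y\<bar> > 2 * \<delta>")
      case False
      then have "\<bar>p y\<bar> \<le> W" by (intro W) simp
      from C2(2)[OF a this] have "norm (?D y) \<le> C2 * a ^ N * norm (?H y)"
        unfolding norm_scaleR by (intro mult_right_mono) auto
      also have "\<dots> \<le> C2 * a ^ N * (B * Bh * indicator {- (2 * \<delta>)..2 * \<delta>} y)"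
        using C2(1) a by (intro mult_left_mono Hb) auto
      finally show ?thesis by (simp add: mult.assoc)
    next
      case True
      have "norm (?D y) = 0" unfolding H0[OF True] by simp
      then show ?thesis using B0 Bh(1) C2(1) a by (simp only:) simp
    qed
    have "f (sheared S t ?G ?H) = (LINT y|lborel. delta_adjoint \<sigma> j ?G (p y) *\<^sub>R ?H y)"
      unfolding p_def
      using pairing[OF test_function_sheared(2)[OF smG R(1) smH R(2)]]
        feasible_pairing_sheared[OF \<sigma> q smG R(1) smH R(2)] by simp
    also have "\<dots> = (LINT y|lborel. ?D y + ?F2 y)"
      using delta_adjoint_nderiv[OF A(1) \<sigma>, of j, unfolded A(2)]
      by (simp add: algebra_simps)
    also have "\<dots> = (LINT y|lborel. ?D y) + (LINT y|lborel. ?F2 y)"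
    proof (rule Bochner_Integration.integral_add)
      have bnd: "norm (?F2 y) \<le> a ^ j * BA * (B * Bh) * indicator {- (2 * \<delta>)..2 * \<delta>} y" for y
      proof -
        have "norm (?F2 y) = a ^ j * \<bar>A (p y / a)\<bar> * norm (?H y)"
          using \<sigma> a by (auto simp: abs_mult power_abs)
        also have "\<dots> \<le> a ^ j * BA * (B * Bh * indicator {- (2 * \<delta>)..2 * \<delta>} y)"
          using a BA by (intro mult_mono mult_left_mono Hb BA) auto
        finally show ?thesis by (simp add: mult.assoc)
      qed
      show "integrable lborel ?F2"
        by (rule compactly_supported_integrable(1)[OF _ _ bnd]) (use a BA B0 Bh in auto)
    next
      show "integrable lborel ?D"
        by (rule compactly_supported_integrable(1)[OF _ _ bndD]) (use a C2 B0 Bh in auto)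
    qed
    finally have eq: "f (sheared S t ?G ?H) - (LINT y|lborel. ?F2 y) = (LINT y|lborel. ?D y)" by simp
    have "norm (LINT y|lborel. ?D y) \<le> C2 * a ^ N * (B * Bh) * (2 * \<bar>2 * \<delta>\<bar>)"
      by (rule compactly_supported_integrable(2)[OF _ _ bndD]) (use a C2 B0 Bh in auto)
    moreover have "(LINT y|lborel. ?F2 y) = ((- \<sigma>) ^ j * a ^ j) *\<^sub>R (LINT y|lborel. A (p y / a) *\<^sub>R ?H y)"
      by (simp flip: scaleR_scaleR integral_scaleR_right)
    ultimately have "norm (f (sheared S t ?G ?H) - ((- \<sigma>) ^ j * a ^ j) *\<^sub>R (LINT y|lborel. A (p y / a) *\<^sub>R ?H y)) \<le>
      C2 * a ^ N * (B * Bh) * (2 * \<bar>2 * \<delta>\<bar>)"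
      using eq by simp
    from norm_triangle_mono[OF C1[OF a, folded \<rho>_def] this]
    have "norm (f (sheared S t (\<lambda>u. g (u / a)) (\<lambda>y. h (y / \<rho>))) -
        ((- \<sigma>) ^ j * a ^ j) *\<^sub>R (LINT y|lborel. A (p y / a) *\<^sub>R ?H y)) \<le>
      C1 * a ^ N + C2 * a ^ N * (B * Bh) * (2 * \<bar>2 * \<delta>\<bar>)"
      by (simp only: diff_add_cancel add_diff_eq)
    also have "\<dots> = C * a ^ N" by (simp add: C_def algebra_simps)
    finally show ?thesis by (simp only: \<rho>_def)
  qed
  then show ?thesis using that unfolding p_def by blast
qed

section \<open>Taylor expansion\<close>

text \<open>
  By the mean value inequality alone, hence without the factor \<open>1 / fact M\<close>.
\<close>

lemma taylor_bound:
  fixes D :: "nat \<Rightarrow> real \<Rightarrow> 'b::real_normed_vector"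
  assumes D: "\<And>m x. (D m has_vector_derivative D (Suc m) x) (at x)"
    and B: "\<And>z. \<bar>z\<bar> \<le> \<bar>y\<bar> \<Longrightarrow> norm (D M z) \<le> B"
  shows "norm (D 0 y - (\<Sum>m<M. (y ^ m / fact m) *\<^sub>R D m 0)) \<le> B * \<bar>y\<bar> ^ M"
  using assms
proof (induction M arbitrary: D y)
  case 0
  then show ?case by simp
next
  case (Suc M)
  let ?S = "{- \<bar>y\<bar>..\<bar>y\<bar>}"
  let ?R = "\<lambda>z. D 0 z - (D 0 0 + (\<Sum>m<M. (z ^ Suc m / fact (Suc m)) *\<^sub>R D (Suc m) 0))"
  let ?R' = "\<lambda>z. D 1 z - (\<Sum>m<M. (z ^ m / fact m) *\<^sub>R D (Suc m) 0)"
  have B0: "B \<ge> 0" using order.trans[OF norm_ge_zero Suc.prems(2)[of 0]] by simp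
  have pow: "((\<lambda>z. z ^ Suc m / fact (Suc m)) has_real_derivative z ^ m / fact m) (at z within A)"
    for m and z :: real and A
  proof -
    have "((\<lambda>z. z ^ Suc m / fact (Suc m)) has_real_derivative (1 + real m) * (1 * z ^ m) / fact (Suc m)) (at z within A)"
      by (rule DERIV_cdivide[OF DERIV_power_Suc[OF DERIV_ident]])
    also have "(1 + real m) * (1 * z ^ m) / fact (Suc m) = z ^ m / fact m"
      by (simp add: fact_Suc)
    finally show ?thesis .
  qed
  have summand: "((\<lambda>z. (z ^ Suc m / fact (Suc m)) *\<^sub>R D (Suc m) 0) has_vector_derivative (z ^ m / fact m) *\<^sub>R D (Suc m) 0) (at z within A)"
    for m z A
    using has_vector_derivative_scaleR[OF pow has_vector_derivative_const] by simp
  have der: "(?R has_vector_derivative ?R' z) (at z within ?S)" for z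
  proof -
    have "(D 0 has_vector_derivative D 1 z) (at z within ?S)"
      using Suc.prems(1)[of 0 z] by (simp add: has_vector_derivative_at_within)
    moreover have "((\<lambda>z. \<Sum>m<M. (z ^ Suc m / fact (Suc m)) *\<^sub>R D (Suc m) 0) has_vector_derivative
        (\<Sum>m<M. (z ^ m / fact m) *\<^sub>R D (Suc m) 0)) (at z within ?S)"
      by (rule has_vector_derivative_sum) (rule summand)
    ultimately have "(?R has_vector_derivative D 1 z - (0 + (\<Sum>m<M. (z ^ m / fact m) *\<^sub>R D (Suc m) 0))) (at z within ?S)"
      by (rule has_vector_derivative_diff[OF _ has_vector_derivative_add[OF has_vector_derivative_const]])
    then show ?thesis by simp
  qed
  have bnd: "norm (?R' z) \<le> B * \<bar>y\<bar> ^ M" if "z \<in> ?S" for z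
  proof -
    have z: "\<bar>z\<bar> \<le> \<bar>y\<bar>" using that by auto
    have "norm (?R' z) \<le> B * \<bar>z\<bar> ^ M"
      using Suc.IH[of "\<lambda>m. D (Suc m)" z] Suc.prems z by simp
    also have "\<dots> \<le> B * \<bar>y\<bar> ^ M" using z B0 by (intro mult_left_mono power_mono) auto
    finally show ?thesis .
  qed
  have "norm (?R y - ?R 0) \<le> B * \<bar>y\<bar> ^ M * norm (y - 0)"
  proof (rule differentiable_bound[where S = ?S])
    fix z assume z: "z \<in> ?S"
    show "(?R has_derivative (\<lambda>h. h *\<^sub>R ?R' z)) (at z within ?S)"
      using der[of z] unfolding has_vector_derivative_def .
    show "onorm (\<lambda>h. h *\<^sub>R ?R' z) \<le> B * \<bar>y\<bar> ^ M"
      by (rule onorm_le) (use mult_left_mono[OF bnd[OF z] abs_ge_zero] in \<open>simp add: mult.commute\<close>)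
  qed auto
  then show ?case unfolding sum.lessThan_Suc_shift by (simp add: mult_ac)
qed

lemma smooth_taylor_bound:
  fixes p :: "real \<Rightarrow> real"
  assumes p: "smooth p"
  obtains C where "C \<ge> 0" "\<And>y. \<bar>y\<bar> \<le> 1 \<Longrightarrow> \<bar>p y - (\<Sum>m<M. y ^ m / fact m * nderiv m p 0)\<bar> \<le> C * \<bar>y\<bar> ^ M"
proof -
  obtain B where B: "\<And>y. \<bar>y\<bar> \<le> 1 \<Longrightarrow> \<bar>nderiv M p y\<bar> \<le> B"
    using continuous_interval_bounded[OF continuous_nderiv[OF p]] by metis
  have "B \<ge> 0" using B[of 0] by auto
  moreover have "\<bar>p y - (\<Sum>m<M. y ^ m / fact m * nderiv m p 0)\<bar> \<le> B * \<bar>y\<bar> ^ M" if "\<bar>y\<bar> \<le> 1" for y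
    using taylor_bound[of "\<lambda>m. nderiv m p" y M B, OF nderiv_has_vector_derivative[OF p]] B that by auto
  ultimately show ?thesis using that by blast
qed

lemma sum_lessThan_add: "(\<Sum>m<K + L. f m) = (\<Sum>m<K. f m) + (\<Sum>i<L. f (K + i :: nat) :: real)"
  by (induction L) auto

lemma flat_taylor_bound:
  fixes p :: "real \<Rightarrow> real"
  assumes p: "smooth p" and 0: "\<And>l. l < K \<Longrightarrow> nderiv l p 0 = 0"
  obtains C where "C \<ge> 0" "\<And>y. \<bar>y\<bar> \<le> 1 \<Longrightarrow> \<bar>p y\<bar> \<le> C * \<bar>y\<bar> ^ K"
  using smooth_taylor_bound[OF p, of K] 0 by auto

text \<open>
  The polynomial \<open>Q\<close> consists of the next \<open>L\<close> Taylor coefficients. Its being a polynomial is what makes the expansion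
  calculus applicable to \<open>A (w ^ K * poly Q y)\<close>.
\<close>

lemma flat_taylor_factorization:
  fixes p :: "real \<Rightarrow> real"
  assumes p: "smooth p" and 0: "\<And>l. l < K \<Longrightarrow> nderiv l p 0 = 0" and K: "nderiv K p 0 \<noteq> 0" and L: "L \<ge> 1"
  obtains Q C where "poly Q 0 \<noteq> 0" "C \<ge> 0"
    "\<And>y. \<bar>y\<bar> \<le> 1 \<Longrightarrow> \<bar>p y - y ^ K * poly Q y\<bar> \<le> C * \<bar>y\<bar> ^ (K + L)"
proof -
  define Q where "Q = (\<Sum>i<L. monom (nderiv (K + i) p 0 / fact (K + i)) i)"
  have Q: "poly Q y = (\<Sum>i<L. nderiv (K + i) p 0 / fact (K + i) * y ^ i)" for y
    by (simp add: Q_def poly_sum poly_monom)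
  have "(\<Sum>m<K + L. y ^ m / fact m * nderiv m p 0) = y ^ K * poly Q y" for y
    unfolding sum_lessThan_add Q using 0
    by (simp add: sum_distrib_left power_add mult_ac)
  moreover obtain L' where "L = Suc L'" using L by (cases L) auto
  then have "poly Q 0 \<noteq> 0" using K by (simp add: Q sum.lessThan_Suc_shift)
  moreover obtain C where "C \<ge> 0" "\<And>y. \<bar>y\<bar> \<le> 1 \<Longrightarrow>
      \<bar>p y - (\<Sum>m<K + L. y ^ m / fact m * nderiv m p 0)\<bar> \<le> C * \<bar>y\<bar> ^ (K + L)"
    using smooth_taylor_bound[OF p, of "K + L"] by metis
  ultimately show ?thesis using that by auto
qed

section \<open>Asymptotics of the localized integral\<close>

text \<open>
  The curve \<open>p\<close> enters at scale \<open>a\<close>, the window \<open>h\<close> at the coarser or finer scale \<open>a powr \<alpha>\<close>; the cutoff \<open>\<kappa>\<close> confines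
  \<open>y\<close> to a neighbourhood of \<open>0\<close> whose size \<open>\<delta>\<close> can be adapted to \<open>p\<close>.
\<close>

definition local_integral ::
  "(real \<Rightarrow> real) \<Rightarrow> (real \<Rightarrow> real) \<Rightarrow> (real \<Rightarrow> real) \<Rightarrow> (real \<Rightarrow> complex) \<Rightarrow> real \<Rightarrow> real \<Rightarrow> real \<Rightarrow> complex" where
  "local_integral A p \<kappa> h \<delta> \<alpha> a =
     (LINT y|lborel. A (p y / a) *\<^sub>R (\<kappa> (y / \<delta>) *\<^sub>R h (y / a powr \<alpha>)))"

lemma schwartz_lipschitz:
  fixes A :: "real \<Rightarrow> real"
  assumes "schwartz A"
  obtains L where "L \<ge> 0" "\<And>u v. \<bar>A u - A v\<bar> \<le> L * \<bar>u - v\<bar>"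
proof -
  obtain L where L: "L \<ge> 0" "\<And>u. \<bar>nderiv 1 A u\<bar> \<le> L"
    using schwartz_decay[OF assms, of 0 1] by auto
  have "\<bar>A u - A v\<bar> \<le> L * \<bar>u - v\<bar>" for u v
    using field_differentiable_bound[of UNIV A "nderiv 1 A" L u v] L
      nderiv_field_derivative[OF schwartz_smooth[OF assms], of 0] by simp
  then show ?thesis using that L by blast
qed

lemma scaled_weight_integral:
  fixes h :: "real \<Rightarrow> 'b::{banach, second_countable_topology}"
  assumes h: "schwartz h" and \<rho>: "\<rho> > 0"
  shows "integrable lborel (\<lambda>y. \<bar>y\<bar> ^ m * norm (h (y / \<rho>)))"
    "(LINT y|lborel. \<bar>y\<bar> ^ m * norm (h (y / \<rho>))) = \<rho> ^ (m + 1) * (LINT v|lborel. \<bar>v\<bar> ^ m * norm (h v))"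
proof -
  note [measurable] = schwartz_measurable(2)[OF h]
  let ?f = "\<lambda>v. \<bar>v\<bar> ^ m * norm (h v)"
  have f: "integrable lborel ?f"
    by (rule Bochner_Integration.integrable_bound[OF schwartz_weighted_integrable[OF h, of m 0]])
       (auto simp: power_abs intro!: mult_right_mono power_mono)
  have eq: "(\<lambda>y. \<bar>y\<bar> ^ m * norm (h (y / \<rho>))) = (\<lambda>y. \<rho> ^ m * ?f (0 + 1 / \<rho> * y))"
    using \<rho> by (simp add: fun_eq_iff abs_mult power_divide power_mult_distrib)
  show "integrable lborel (\<lambda>y. \<bar>y\<bar> ^ m * norm (h (y / \<rho>)))"
    unfolding eq using \<rho> by (intro integrable_mult_right lborel_integrable_real_affine f) auto
  have "(LINT v|lborel. ?f v) = \<bar>1 / \<rho>\<bar> *\<^sub>R (LINT y|lborel. ?f (0 + 1 / \<rho> * y))"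
    using \<rho> by (intro lborel_integral_real_affine) auto
  then show "(LINT y|lborel. \<bar>y\<bar> ^ m * norm (h (y / \<rho>))) = \<rho> ^ (m + 1) * (LINT v|lborel. \<bar>v\<bar> ^ m * norm (h v))"
    unfolding eq using \<rho> by (simp add: field_simps)
qed

locale windowed_curve =
  fixes A p \<kappa> :: "real \<Rightarrow> real" and h :: "real \<Rightarrow> complex"
  assumes A: "schwartz A" and p: "smooth p" and h: "schwartz h"
    and \<kappa>: "bounded_smooth \<kappa>" "\<And>u. \<bar>u\<bar> \<le> 1 \<Longrightarrow> \<kappa> u = 1" "\<And>u. \<bar>u\<bar> \<ge> 2 \<Longrightarrow> \<kappa> u = 0"
begin

lemma measurability [measurable]:
  "A \<in> borel_measurable borel" "p \<in> borel_measurable borel"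
  "\<kappa> \<in> borel_measurable borel" "h \<in> borel_measurable borel"
  using schwartz_measurable(2)[OF A] schwartz_measurable(2)[OF h] p \<kappa>(1)
  by (auto simp: bounded_smooth_def intro: borel_measurable_continuous_onI smooth_continuous)

lemma window_vanishes: "\<delta> > 0 \<Longrightarrow> \<bar>y\<bar> \<ge> 2 * \<delta> \<Longrightarrow> \<kappa> (y / \<delta>) = 0"
  by (rule \<kappa>(3)) (simp add: field_simps)

lemma window_bound: obtains B where "B \<ge> 0" "\<And>u. \<bar>\<kappa> u\<bar> \<le> B"
proof -
  obtain B where "\<And>u. \<bar>\<kappa> u\<bar> \<le> B" using \<kappa>(1) unfolding bounded_smooth_def by (metis nderiv_0)
  then show ?thesis using that[of B] by (metis abs_ge_zero order.trans)
qed

text \<open>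
  On the support of the cutoff \<open>\<bar>p y\<bar>\<close> stays above a positive constant \<open>c\<close>, so \<open>A\<close> is evaluated at distance at
  least \<open>c / a\<close> from \<open>0\<close>.
\<close>

lemma local_integral_off_curve:
  assumes p0: "p 0 \<noteq> 0"
  obtains \<delta> where "\<delta> > 0"
    "\<And>N. \<exists>C. \<forall>a. 0 < a \<and> a \<le> 1 \<longrightarrow> norm (local_integral A p \<kappa> h \<delta> \<alpha> a) \<le> C * a ^ N"
proof -
  define c where "c = \<bar>p 0\<bar> / 2"
  have c: "c > 0" using p0 by (simp add: c_def)
  have "isCont p 0" using smooth_continuous[OF p, of UNIV] by (simp add: continuous_on_eq_continuous_at)
  then obtain d where d: "d > 0" "\<And>y. \<bar>y\<bar> < d \<Longrightarrow> \<bar>p y - p 0\<bar> < c"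
    using c unfolding continuous_at_eps_delta by (auto simp: dist_real_def)
  define \<delta> where "\<delta> = d / 4"
  have pc: "\<bar>p y\<bar> \<ge> c" if "\<bar>y\<bar> \<le> 2 * \<delta>" for y
    using d(2)[of y] d(1) that unfolding \<delta>_def c_def by linarith
  obtain B where B: "B \<ge> 0" "\<And>u. \<bar>\<kappa> u\<bar> \<le> B" using window_bound by blast
  obtain Bh where Bh: "Bh \<ge> 0" "\<And>u. norm (h u) \<le> Bh"
    using schwartz_decay[OF h, of 0 0] by auto
  have "\<exists>C. \<forall>a. 0 < a \<and> a \<le> 1 \<longrightarrow> norm (local_integral A p \<kappa> h \<delta> \<alpha> a) \<le> C * a ^ N" for N
  proof -
    obtain CA where CA: "CA \<ge> 0" "\<And>u. (1 + \<bar>u\<bar>) ^ N * \<bar>A u\<bar> \<le> CA"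
      using schwartz_decay[OF A, of N 0] by auto
    have "norm (local_integral A p \<kappa> h \<delta> \<alpha> a) \<le> (CA / c ^ N * (B * Bh) * (2 * \<bar>2 * \<delta>\<bar>)) * a ^ N"
      if a: "0 < a" "a \<le> 1" for a
    proof -
      have "norm (A (p y / a) *\<^sub>R (\<kappa> (y / \<delta>) *\<^sub>R h (y / a powr \<alpha>))) \<le>
        CA / c ^ N * a ^ N * (B * Bh) * indicator {- (2 * \<delta>)..2 * \<delta>} y" for y
      proof (cases "\<bar>y\<bar> \<le> 2 * \<delta>")
        case True
        have "(c / a) ^ N * \<bar>A (p y / a)\<bar> \<le> (1 + \<bar>p y / a\<bar>) ^ N * \<bar>A (p y / a)\<bar>"
          using pc[OF True] c a by (intro mult_right_mono power_mono) (auto simp: field_simps)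
        also have "\<dots> \<le> CA" by (rule CA)
        finally have 1: "\<bar>A (p y / a)\<bar> \<le> CA / c ^ N * a ^ N"
          using c a by (simp add: power_divide field_simps)
        have "\<bar>A (p y / a)\<bar> * (\<bar>\<kappa> (y / \<delta>)\<bar> * norm (h (y / a powr \<alpha>))) \<le> CA / c ^ N * a ^ N * (B * Bh)"
          using B Bh CA c a by (intro mult_mono 1 B Bh) auto
        then show ?thesis using True by (auto simp: indicator_def abs_mult mult.assoc)
      next
        case False
        then show ?thesis using window_vanishes[of \<delta> y] d by (auto simp: indicator_def \<delta>_def)
      qed
      from compactly_supported_integrable(2)[OF _ _ this] show ?thesis
        unfolding local_integral_def using CA c a B Bh by (simp add: mult_ac)
    qed
    then show ?thesis by blast
  qed
  moreover have "\<delta> > 0" using d by (simp add: \<delta>_def)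
  ultimately show ?thesis using that by blast
qed

text \<open>
  Replacing \<open>A (p y / a) * \<kappa> (2 * y)\<close> by \<open>A 0\<close> costs at most a multiple of \<open>\<bar>y\<bar> ^ Suc n / a\<close>: near \<open>0\<close> because \<open>A\<close> is
  Lipschitz and \<open>p\<close> vanishes to order \<open>n\<close>, and elsewhere because \<open>\<bar>y\<bar>\<close> is bounded below. On the scale of the window
  this is of order \<open>a powr (\<alpha> * (n + 1) - 1)\<close>.
\<close>

lemma local_integral_osculating:
  assumes flat: "\<And>l. l \<le> n \<Longrightarrow> nderiv l p 0 = 0"
  obtains C where "\<And>a. 0 < a \<Longrightarrow> a \<le> 1 \<Longrightarrow>
    norm (local_integral A p \<kappa> h (1 / 2) \<alpha> a - (a powr \<alpha> * A 0) *\<^sub>R (LINT v|lborel. h v)) \<le>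
      C * a powr (\<alpha> + (\<alpha> * (real n + 1) - 1))"
proof -
  obtain Cp where Cp: "Cp \<ge> 0" "\<And>y. \<bar>y\<bar> \<le> 1 \<Longrightarrow> \<bar>p y\<bar> \<le> Cp * \<bar>y\<bar> ^ (Suc n)"
    using flat_taylor_bound[OF p, of "Suc n"] flat by (metis less_Suc_eq_le)
  obtain L where L: "L \<ge> 0" "\<And>u v. \<bar>A u - A v\<bar> \<le> L * \<bar>u - v\<bar>" using schwartz_lipschitz[OF A] by metis
  obtain B where B: "B \<ge> 0" "\<And>u. \<bar>\<kappa> u\<bar> \<le> B" using window_bound by blast
  define C where "C = L * Cp * B + \<bar>A 0\<bar> * (B + 1) * 2 ^ Suc n"
  define I where "I = (LINT v|lborel. \<bar>v\<bar> ^ Suc n * norm (h v))"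
  have "norm (local_integral A p \<kappa> h (1 / 2) \<alpha> a - (a powr \<alpha> * A 0) *\<^sub>R (LINT v|lborel. h v)) \<le>
      (C * I) * a powr (\<alpha> + (\<alpha> * (real n + 1) - 1))" if a: "0 < a" "a \<le> 1" for a
  proof -
    define \<rho> where "\<rho> = a powr \<alpha>"
    have \<rho>: "0 < \<rho>" using a by (simp add: \<rho>_def)
    let ?F = "\<lambda>y. A (p y / a) *\<^sub>R (\<kappa> (y / (1 / 2)) *\<^sub>R h (y / \<rho>))"
    let ?D = "\<lambda>y. (A (p y / a) * \<kappa> (y / (1 / 2)) - A 0) *\<^sub>R h (y / \<rho>)"
    have hi: "integrable lborel (\<lambda>y. h (y / \<rho>))"
      using lborel_integrable_real_affine[OF schwartz_integrable(2)[OF h], of "1 / \<rho>" 0] \<rho> by simp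
    have hI: "(LINT y|lborel. h (y / \<rho>)) = \<rho> *\<^sub>R (LINT v|lborel. h v)"
      using lborel_integral_real_affine[of "1 / \<rho>" h 0] \<rho> by simp
    have bnd: "\<bar>A (p y / a) * \<kappa> (y / (1 / 2)) - A 0\<bar> \<le> C / a * \<bar>y\<bar> ^ Suc n" for y
    proof -
      have "\<bar>A (p y / a) - A 0\<bar> * \<bar>\<kappa> (y / (1 / 2))\<bar> \<le> L * Cp * B / a * \<bar>y\<bar> ^ Suc n"
      proof (cases "\<bar>y\<bar> \<le> 1")
        case True
        have "\<bar>A (p y / a) - A 0\<bar> \<le> L * \<bar>p y / a - 0\<bar>" by (rule L)
        also have "\<dots> \<le> L * (Cp * \<bar>y\<bar> ^ Suc n / a)"
          using L(1) a Cp(2)[OF True] by (intro mult_left_mono) (auto simp: divide_right_mono simp del: power_Suc)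
        finally have "\<bar>A (p y / a) - A 0\<bar> * \<bar>\<kappa> (y / (1 / 2))\<bar> \<le> L * (Cp * \<bar>y\<bar> ^ Suc n / a) * B"
          using L Cp a by (intro mult_mono B) auto
        then show ?thesis by (simp add: mult_ac)
      next
        case False
        then show ?thesis using window_vanishes[of "1 / 2" y] L Cp B a by simp
      qed
      moreover have "\<bar>A 0\<bar> * \<bar>\<kappa> (y / (1 / 2)) - 1\<bar> \<le> \<bar>A 0\<bar> * (B + 1) * 2 ^ Suc n / a * \<bar>y\<bar> ^ Suc n"
      proof (cases "\<bar>y\<bar> \<le> 1 / 2")
        case True
        then show ?thesis using \<kappa>(2)[of "y / (1 / 2)"] B a by simp
      next
        case False
        have "1 \<le> (2 * \<bar>y\<bar>) ^ Suc n" using False by (intro one_le_power) auto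
        also have "\<dots> \<le> (2 * \<bar>y\<bar>) ^ Suc n / a" using a by (simp add: le_divide_eq mult_left_le del: power_Suc)
        finally have 1: "1 \<le> (2 * \<bar>y\<bar>) ^ Suc n / a" .
        have "\<bar>\<kappa> (y / (1 / 2)) - 1\<bar> \<le> B + 1" using B(2)[of "y / (1 / 2)"] by linarith
        then have "\<bar>A 0\<bar> * \<bar>\<kappa> (y / (1 / 2)) - 1\<bar> * 1 \<le> \<bar>A 0\<bar> * (B + 1) * ((2 * \<bar>y\<bar>) ^ Suc n / a)"
          using 1 B by (intro mult_mono mult_left_mono) auto
        then show ?thesis by (simp add: power_mult_distrib mult_ac)
      qed
      moreover have "\<bar>A (p y / a) * \<kappa> (y / (1 / 2)) - A 0\<bar> \<le>
          \<bar>A (p y / a) - A 0\<bar> * \<bar>\<kappa> (y / (1 / 2))\<bar> + \<bar>A 0\<bar> * \<bar>\<kappa> (y / (1 / 2)) - 1\<bar>"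
        unfolding abs_mult[symmetric]
        by (rule order.trans[OF _ abs_triangle_ineq]) (simp add: algebra_simps)
      ultimately show ?thesis by (simp add: C_def add_divide_distrib distrib_right)
    qed
    have nb: "norm (?D y) \<le> C / a * (\<bar>y\<bar> ^ Suc n * norm (h (y / \<rho>)))" for y
      using mult_right_mono[OF bnd norm_ge_zero[of "h (y / \<rho>)"], of y] by (simp add: mult_ac)
    have wi: "integrable lborel (\<lambda>y. C / a * (\<bar>y\<bar> ^ Suc n * norm (h (y / \<rho>))))"
      by (intro integrable_mult_right scaled_weight_integral(1) h \<rho>)
    have Di: "integrable lborel ?D"
    proof (rule Bochner_Integration.integrable_bound[OF wi])
      show "AE y in lborel. norm (?D y) \<le> norm (C / a * (\<bar>y\<bar> ^ Suc n * norm (h (y / \<rho>))))"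
        unfolding real_norm_def by (intro AE_I2 order.trans[OF nb abs_ge_self])
    qed measurable
    have "local_integral A p \<kappa> h (1 / 2) \<alpha> a = (LINT y|lborel. ?D y + A 0 *\<^sub>R h (y / \<rho>))"
      by (simp add: local_integral_def \<rho>_def algebra_simps)
    also have "\<dots> = (LINT y|lborel. ?D y) + (a powr \<alpha> * A 0) *\<^sub>R (LINT v|lborel. h v)"
      using hi hI by (subst Bochner_Integration.integral_add[OF Di]) (auto simp: \<rho>_def mult.commute)
    finally have "norm (local_integral A p \<kappa> h (1 / 2) \<alpha> a - (a powr \<alpha> * A 0) *\<^sub>R (LINT v|lborel. h v)) =
      norm (LINT y|lborel. ?D y)" by (simp only: add_diff_cancel_right')
    also have "\<dots> \<le> (LINT y|lborel. C / a * (\<bar>y\<bar> ^ Suc n * norm (h (y / \<rho>))))"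
      by (rule Bochner_Integration.integral_norm_bound_integral[OF Di wi nb])
    also have "\<dots> = C / a * (\<rho> ^ (Suc n + 1) * I)"
      unfolding I_def by (simp only: integral_mult_right_zero scaled_weight_integral(2)[OF h \<rho>])
    also have "\<dots> = (C * I) * (\<rho> ^ (Suc n + 1) / a)" by simp
    also have "\<rho> ^ (Suc n + 1) / a = a powr (\<alpha> + (\<alpha> * (real n + 1) - 1))"
    proof -
      have "\<alpha> + (\<alpha> * (real n + 1) - 1) = \<alpha> * real (Suc n + 1) - 1" by (simp add: algebra_simps)
      then show ?thesis using a by (simp only: \<rho>_def powr_nat_mult powr_diff powr_one)
    qed
    finally show ?thesis .
  qed
  then show ?thesis by (rule that)
qed

end

text \<open>
  The Taylor coefficients at \<open>y = 0\<close> of the integrand with frozen \<open>w\<close>, multiplied by \<open>w ^ m\<close>, are combinations of the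
  moments in \<open>derivative_monomial_moments\<close>: each order of differentiation of \<open>G\<close> comes with a factor \<open>w ^ K\<close>.
\<close>

lemma moment_expansion:
  fixes G :: "real \<Rightarrow> real" and \<eta> :: "nat \<Rightarrow> real \<Rightarrow> complex"
  assumes G: "schwartz G" and vm: "vanishing_moments n r G" and K: "K \<in> {1..n}"
    and Q: "poly Q 0 \<noteq> 0" and m: "m < K * r"
  shows "integrable lborel (\<lambda>w. w ^ m *\<^sub>R expansion ts (\<lambda>i y. w ^ (K * i) * nderiv i G (w ^ K * poly Q y)) \<eta> 0)"
      (is "integrable _ (?f ts)")
    and "(LINT w|lborel. w ^ m *\<^sub>R expansion ts (\<lambda>i y. w ^ (K * i) * nderiv i G (w ^ K * poly Q y)) \<eta> 0) = 0"
proof -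
  have "integrable lborel (?f ts) \<and> (LINT w|lborel. ?f ts w) = 0"
  proof (induction ts)
    case (Cons a ts)
    obtain u i l where a: "a = (u, i, l)" by (cases a)
    let ?t = "\<lambda>w. (poly u 0 * (nderiv i G (poly Q 0 * w ^ K) * w ^ (K * i + m))) *\<^sub>R \<eta> l 0"
    have eq: "?f (a # ts) = (\<lambda>w. ?t w + ?f ts w)"
      by (simp add: a fun_eq_iff algebra_simps power_add)
    have i: "integrable lborel (\<lambda>w. nderiv i G (poly Q 0 * w ^ K) * w ^ (K * i + m))"
      using schwartz_monomial_integrable(1)[OF G _ Q] K by simp
    then have i': "integrable lborel ?t" by (intro integrable_scaleR_left integrable_mult_right) auto
    have "(LINT w|lborel. ?t w) = (poly u 0 * (LINT w|lborel. nderiv i G (poly Q 0 * w ^ K) * w ^ (K * i + m))) *\<^sub>R \<eta> l 0"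
      using i by simp
    also have "\<dots> = 0" using derivative_monomial_moments[OF G vm K Q m, of i] by simp
    finally show ?case
      unfolding eq using Cons i' by (subst Bochner_Integration.integral_add) auto
  qed simp
  then show "integrable lborel (?f ts)" "(LINT w|lborel. ?f ts w) = 0" by auto
qed

context windowed_curve
begin

lemma window_nderiv_bound:
  assumes \<delta>: "\<delta> > 0"
  obtains C where "C \<ge> 0"
    "\<And>\<rho> l y. 0 < \<rho> \<Longrightarrow> \<rho> \<le> 1 \<Longrightarrow> l \<le> M \<Longrightarrow>
      norm (nderiv l (\<lambda>y. \<kappa> (y / \<delta>) *\<^sub>R h (y / \<rho>)) y) \<le> C * (1 / \<rho>) ^ M"
proof -
  have t: "bounded_smooth (\<lambda>y. \<kappa> (y / \<delta>))" using bounded_smooth_dilation[OF \<kappa>(1), of "1 / \<delta>"] by simp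
  obtain C where C: "C \<ge> 0" "\<And>\<rho>. 0 < \<rho> \<Longrightarrow> \<rho> \<le> 1 \<Longrightarrow>
      seminorm_le M (\<lambda>u. \<kappa> (u / \<delta>) *\<^sub>R h (u / \<rho>)) (C * (1 / \<rho>) ^ M)"
    using scaled_seminorm_le[OF h t, of M] by blast
  show ?thesis using that[OF C(1)] seminorm_le_nderiv[OF C(2)] by blast
qed

lemma smooth_window: "\<delta> > 0 \<Longrightarrow> smooth (\<lambda>y. \<kappa> (y / \<delta>) *\<^sub>R h (y / \<rho>))"
  using bounded_smooth_dilation[OF \<kappa>(1), of "1 / \<delta>"] nderiv_scaled_product(1)[OF h, of "\<lambda>y. \<kappa> (y / \<delta>)" \<rho>]
  by (simp add: bounded_smooth_def)

lemma polynomial_curve_nderiv: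
  assumes \<delta>: "\<delta> > 0"
  shows "smooth (\<lambda>y. A (w ^ K * poly Q y) *\<^sub>R (\<kappa> (y / \<delta>) *\<^sub>R h (y / \<rho>)))"
    "nderiv m (\<lambda>y. A (w ^ K * poly Q y) *\<^sub>R (\<kappa> (y / \<delta>) *\<^sub>R h (y / \<rho>))) =
      expansion ((expansion_deriv (pderiv Q) ^^ m) [(1, 0, 0)])
        (\<lambda>i y. w ^ (K * i) * nderiv i A (w ^ K * poly Q y))
        (\<lambda>l. nderiv l (\<lambda>y. \<kappa> (y / \<delta>) *\<^sub>R h (y / \<rho>)))"
proof -
  let ?\<gamma> = "\<lambda>i y. w ^ (K * i) * nderiv i A (w ^ K * poly Q y)"
  have *: "(?\<gamma> i has_real_derivative poly (pderiv Q) y * ?\<gamma> (Suc i) y) (at y)" for i y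
  proof -
    have "((\<lambda>y. w ^ K * poly Q y) has_real_derivative w ^ K * poly (pderiv Q) y) (at y)"
      by (intro DERIV_cmult poly_DERIV)
    from DERIV_cmult[OF DERIV_chain2[OF nderiv_field_derivative[OF schwartz_smooth[OF A], of i] this], of "w ^ (K * i)"]
    show ?thesis by (simp add: power_add mult_ac)
  qed
  show "smooth (\<lambda>y. A (w ^ K * poly Q y) *\<^sub>R (\<kappa> (y / \<delta>) *\<^sub>R h (y / \<rho>)))"
    using nderiv_expansion(1)[where \<gamma> = ?\<gamma>, OF * smooth_window[OF \<delta>, of \<rho>]] by simp
  show "nderiv m (\<lambda>y. A (w ^ K * poly Q y) *\<^sub>R (\<kappa> (y / \<delta>) *\<^sub>R h (y / \<rho>))) =
      expansion ((expansion_deriv (pderiv Q) ^^ m) [(1, 0, 0)]) ?\<gamma>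
        (\<lambda>l. nderiv l (\<lambda>y. \<kappa> (y / \<delta>) *\<^sub>R h (y / \<rho>)))"
    using nderiv_expansion(2)[where \<gamma> = ?\<gamma>, OF * smooth_window[OF \<delta>, of \<rho>], of m] by simp
qed

text \<open>
  On the support of the window \<open>\<bar>poly Q y\<bar> \<ge> d\<close>, so that the derivatives of \<open>A\<close> at \<open>w ^ K * poly Q y\<close> decay in \<open>w\<close> uniformly
  in \<open>y\<close>. The exponent \<open>M + 2\<close> leaves integrability in \<open>w\<close> after multiplication by \<open>w ^ M\<close>.
\<close>

lemma polynomial_curve_nderiv_bound:
  assumes \<delta>: "\<delta> > 0" and K: "K \<ge> 1" and d: "d > 0" "\<And>y. \<bar>y\<bar> \<le> 2 * \<delta> \<Longrightarrow> \<bar>poly Q y\<bar> \<ge> d"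
  obtains C where "C \<ge> 0" "\<And>\<rho> w y. 0 < \<rho> \<Longrightarrow> \<rho> \<le> 1 \<Longrightarrow>
    norm (nderiv M (\<lambda>y. A (w ^ K * poly Q y) *\<^sub>R (\<kappa> (y / \<delta>) *\<^sub>R h (y / \<rho>))) y) \<le>
      C * ((1 / \<rho>) ^ M / (1 + \<bar>w\<bar>) ^ (M + 2))"
proof -
  let ?ts = "(expansion_deriv (pderiv Q) ^^ M) [(1, 0, 0)]"
  let ?\<gamma> = "\<lambda>w i y. w ^ (K * i) * nderiv i A (w ^ K * poly Q y)"
  let ?\<eta> = "\<lambda>\<rho> l. nderiv l (\<lambda>y. \<kappa> (y / \<delta>) *\<^sub>R h (y / \<rho>))"
  obtain C\<eta> where C\<eta>: "C\<eta> \<ge> 0"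
    "\<And>\<rho> l y. 0 < \<rho> \<Longrightarrow> \<rho> \<le> 1 \<Longrightarrow> l \<le> M \<Longrightarrow> norm (?\<eta> \<rho> l y) \<le> C\<eta> * (1 / \<rho>) ^ M"
    using window_nderiv_bound[OF \<delta>] by metis
  have "\<exists>C. \<forall>z y. (0 < fst z \<and> fst z \<le> 1 \<and> \<bar>y\<bar> \<le> 2 * \<delta>) \<longrightarrow>
    norm (expansion ?ts (?\<gamma> (snd z)) (?\<eta> (fst z)) y) \<le> C * ((1 / fst z) ^ M / (1 + \<bar>snd z\<bar>) ^ (M + 2))"
  proof (rule expansion_bound)
    fix u i l assume "(u, i, l) \<in> set ?ts"
    then have l: "l \<le> M" using funpow_expansion_deriv_order by blast
    obtain Cu D where Cu: "Cu \<ge> 0" "\<And>y. \<bar>poly u y\<bar> \<le> Cu * (1 + \<bar>y\<bar>) ^ D" using poly_growth[of u] by metis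
    obtain CA where CA: "CA \<ge> 0" "\<And>c t. \<bar>c\<bar> \<ge> d \<Longrightarrow> (1 + \<bar>t\<bar>) ^ (K * i + (M + 2)) * \<bar>nderiv i A (c * t ^ K)\<bar> \<le> CA"
      using schwartz_monomial_decay[OF A K d(1)] by metis
    define P where "P = Cu * (1 + 2 * \<delta>) ^ D"
    have P0: "P \<ge> 0" using Cu \<delta> by (simp add: P_def)
    have "norm ((poly u y * ?\<gamma> w i y) *\<^sub>R ?\<eta> \<rho> l y) \<le> (P * CA * C\<eta>) * ((1 / \<rho>) ^ M / (1 + \<bar>w\<bar>) ^ (M + 2))"
      if \<rho>: "0 < \<rho>" "\<rho> \<le> 1" and y: "\<bar>y\<bar> \<le> 2 * \<delta>" for \<rho> w y
    proof -
      have pos: "(1 + \<bar>w\<bar>) ^ (M + 2) > 0" by (intro zero_less_power) auto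
      have 1: "\<bar>poly u y\<bar> \<le> P"
        using y unfolding P_def by (intro order.trans[OF Cu(2)] mult_left_mono power_mono Cu(1)) auto
      have "(1 + \<bar>w\<bar>) ^ (M + 2) * \<bar>?\<gamma> w i y\<bar> \<le>
        (1 + \<bar>w\<bar>) ^ (M + 2) * ((1 + \<bar>w\<bar>) ^ (K * i) * \<bar>nderiv i A (poly Q y * w ^ K)\<bar>)"
        unfolding abs_mult power_abs mult.commute[of "poly Q y"]
        by (intro mult_left_mono mult_right_mono power_mono) auto
      also have "\<dots> \<le> CA" using CA(2)[OF d(2)[OF y], of w] by (simp add: power_add mult_ac)
      finally have 2: "\<bar>?\<gamma> w i y\<bar> \<le> CA / (1 + \<bar>w\<bar>) ^ (M + 2)"
        using pos by (simp add: pos_le_divide_eq mult.commute)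
      have "norm ((poly u y * ?\<gamma> w i y) *\<^sub>R ?\<eta> \<rho> l y) = \<bar>poly u y\<bar> * \<bar>?\<gamma> w i y\<bar> * norm (?\<eta> \<rho> l y)"
        by (simp add: abs_mult)
      also have "\<dots> \<le> P * (CA / (1 + \<bar>w\<bar>) ^ (M + 2)) * (C\<eta> * (1 / \<rho>) ^ M)"
        by (intro mult_mono 1 2 C\<eta> \<rho> l) (use P0 CA pos in auto)
      finally show ?thesis by (simp add: mult_ac)
    qed
    then show "\<exists>C. \<forall>z y. (0 < fst z \<and> fst z \<le> 1 \<and> \<bar>y\<bar> \<le> 2 * \<delta>) \<longrightarrow>
      norm ((poly u y * ?\<gamma> (snd z) i y) *\<^sub>R ?\<eta> (fst z) l y) \<le> C * ((1 / fst z) ^ M / (1 + \<bar>snd z\<bar>) ^ (M + 2))"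
      by (intro exI[of _ "P * CA * C\<eta>"]) auto
  qed
  then obtain C where C: "\<And>\<rho> w y. 0 < \<rho> \<Longrightarrow> \<rho> \<le> 1 \<Longrightarrow> \<bar>y\<bar> \<le> 2 * \<delta> \<Longrightarrow>
    norm (expansion ?ts (?\<gamma> w) (?\<eta> \<rho>) y) \<le> C * ((1 / \<rho>) ^ M / (1 + \<bar>w\<bar>) ^ (M + 2))"
    by auto
  show ?thesis
  proof (rule that[of "\<bar>C\<bar>"])
    fix \<rho> w y :: real assume \<rho>: "0 < \<rho>" "\<rho> \<le> 1"
    show "norm (nderiv M (\<lambda>y. A (w ^ K * poly Q y) *\<^sub>R (\<kappa> (y / \<delta>) *\<^sub>R h (y / \<rho>))) y) \<le>
      \<bar>C\<bar> * ((1 / \<rho>) ^ M / (1 + \<bar>w\<bar>) ^ (M + 2))"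
    proof (cases "\<bar>y\<bar> \<le> 2 * \<delta>")
      case True
      have "C * ((1 / \<rho>) ^ M / (1 + \<bar>w\<bar>) ^ (M + 2)) \<le> \<bar>C\<bar> * ((1 / \<rho>) ^ M / (1 + \<bar>w\<bar>) ^ (M + 2))"
        using \<rho> by (intro mult_right_mono) auto
      with C[OF \<rho> True, of w] show ?thesis
        unfolding polynomial_curve_nderiv(2)[OF \<delta>] by linarith
    next
      case False
      have "nderiv M (\<lambda>y. A (w ^ K * poly Q y) *\<^sub>R (\<kappa> (y / \<delta>) *\<^sub>R h (y / \<rho>))) y = 0"
        by (rule smooth_vanishing_nderiv[OF polynomial_curve_nderiv(1)[OF \<delta>], of "- {- (2 * \<delta>)..2 * \<delta>}"])
           (use False window_vanishes[OF \<delta>] in \<open>auto simp: abs_le_iff\<close>)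
      then show ?thesis using \<rho> by simp
    qed
  qed simp
qed

text \<open>
  Taylor expansion in \<open>y\<close> with \<open>w\<close> frozen, evaluated at \<open>y = b * w\<close>. All \<open>K * r\<close> main terms integrate to \<open>0\<close>; the remainder
  carries \<open>b ^ (K * r)\<close> from the powers of \<open>y\<close> and \<open>(1 / \<rho>) ^ (K * r)\<close> from differentiating the window.
\<close>

lemma polynomial_curve_integral:
  assumes vm: "vanishing_moments n r A" and K: "K \<in> {1..n}"
    and \<delta>: "\<delta> > 0" and d: "d > 0" "\<And>y. \<bar>y\<bar> \<le> 2 * \<delta> \<Longrightarrow> \<bar>poly Q y\<bar> \<ge> d"
  obtains C where "\<And>\<rho> b. 0 < \<rho> \<Longrightarrow> \<rho> \<le> 1 \<Longrightarrow> b > 0 \<Longrightarrow>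
    norm (LINT w|lborel. A (w ^ K * poly Q (b * w)) *\<^sub>R (\<kappa> (b * w / \<delta>) *\<^sub>R h (b * w / \<rho>))) \<le>
      C * (b / \<rho>) ^ (K * r)"
proof -
  let ?M = "K * r"
  let ?E = "\<lambda>\<rho> w y. A (w ^ K * poly Q y) *\<^sub>R (\<kappa> (y / \<delta>) *\<^sub>R h (y / \<rho>))"
  have K1: "K \<ge> 1" using K by simp
  have Q0: "poly Q 0 \<noteq> 0" using d(2)[of 0] d(1) \<delta> by auto
  obtain C where C: "C \<ge> 0" "\<And>\<rho> w y. 0 < \<rho> \<Longrightarrow> \<rho> \<le> 1 \<Longrightarrow>
    norm (nderiv ?M (?E \<rho> w) y) \<le> C * ((1 / \<rho>) ^ ?M / (1 + \<bar>w\<bar>) ^ (?M + 2))"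
    using polynomial_curve_nderiv_bound[OF \<delta> K1 d, of ?M] by blast
  define I where "I = (LINT u|lborel. inverse (1 + u ^ 2 :: real))"
  have "norm (LINT w|lborel. ?E \<rho> w (b * w)) \<le> (C * I) * (b / \<rho>) ^ ?M"
    if \<rho>: "0 < \<rho>" "\<rho> \<le> 1" and b: "b > 0" for \<rho> b
  proof -
    \<comment> \<open>\<open>?T\<close> is the Taylor polynomial of degree less than \<open>?M\<close> at \<open>y = b * w\<close>.\<close>
    let ?T = "\<lambda>w. \<Sum>m<?M. (b ^ m / fact m) *\<^sub>R (w ^ m *\<^sub>R nderiv m (?E \<rho> w) 0)"
    let ?R = "\<lambda>w. ?E \<rho> w (b * w) - ?T w"
    have mom: "integrable lborel (\<lambda>w. w ^ m *\<^sub>R nderiv m (?E \<rho> w) 0)"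
      "(LINT w|lborel. w ^ m *\<^sub>R nderiv m (?E \<rho> w) 0) = 0" if "m < ?M" for m
      unfolding polynomial_curve_nderiv(2)[OF \<delta>]
      using moment_expansion[OF A vm K Q0 that] by blast+
    have sm: "integrable lborel (\<lambda>w. (b ^ m / fact m) *\<^sub>R (w ^ m *\<^sub>R nderiv m (?E \<rho> w) 0))"
      "(LINT w|lborel. (b ^ m / fact m) *\<^sub>R (w ^ m *\<^sub>R nderiv m (?E \<rho> w) 0)) = 0" if "m < ?M" for m
      by (intro integrable_scaleR_right mom that)
         (simp only: Bochner_Integration.integral_scaleR_right mom(2)[OF that] scaleR_zero_right)
    have Ti: "integrable lborel ?T"
      by (rule Bochner_Integration.integrable_sum) (rule sm(1), simp)
    have "(LINT w|lborel. ?T w) =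
        (\<Sum>m<?M. LINT w|lborel. (b ^ m / fact m) *\<^sub>R (w ^ m *\<^sub>R nderiv m (?E \<rho> w) 0))"
      by (rule Bochner_Integration.integral_sum) (rule sm(1), simp)
    also have "\<dots> = 0" by (intro sum.neutral ballI sm(2)) simp
    finally have T0: "(LINT w|lborel. ?T w) = 0" .
    have Rb: "norm (?R w) \<le> C * (b / \<rho>) ^ ?M * inverse (1 + w ^ 2)" for w
    proof -
      have "norm (?E \<rho> w (b * w) - (\<Sum>m<?M. ((b * w) ^ m / fact m) *\<^sub>R nderiv m (?E \<rho> w) 0)) \<le>
          C * ((1 / \<rho>) ^ ?M / (1 + \<bar>w\<bar>) ^ (?M + 2)) * \<bar>b * w\<bar> ^ ?M"
        using taylor_bound[of "\<lambda>m. nderiv m (?E \<rho> w)" "b * w" ?M,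
            OF nderiv_has_vector_derivative[OF polynomial_curve_nderiv(1)[OF \<delta>]] C(2)[OF \<rho>]] by simp
      also have "(\<Sum>m<?M. ((b * w) ^ m / fact m) *\<^sub>R nderiv m (?E \<rho> w) 0) = ?T w"
        by (simp add: power_mult_distrib)
      also have "C * ((1 / \<rho>) ^ ?M / (1 + \<bar>w\<bar>) ^ (?M + 2)) * \<bar>b * w\<bar> ^ ?M =
          C * (b / \<rho>) ^ ?M * (\<bar>w\<bar> ^ ?M / (1 + \<bar>w\<bar>) ^ (?M + 2))"
        using b by (simp add: abs_mult power_mult_distrib power_divide)
      also have "\<dots> \<le> C * (b / \<rho>) ^ ?M * inverse (1 + w ^ 2)"
      proof (rule mult_left_mono)
        have p: "1 + w\<^sup>2 > 0" by (simp add: add_pos_nonneg)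
        have p2: "(1 + \<bar>w\<bar>) ^ (?M + 2) > 0" by (intro zero_less_power) auto
        have "\<bar>w\<bar> ^ ?M * (1 + w\<^sup>2) \<le> (1 + \<bar>w\<bar>) ^ ?M * (1 + \<bar>w\<bar>) ^ 2"
          by (intro mult_mono power_mono) (auto simp: power2_sum)
        then show "\<bar>w\<bar> ^ ?M / (1 + \<bar>w\<bar>) ^ (?M + 2) \<le> inverse (1 + w\<^sup>2)"
          using p p2 by (simp add: divide_simps power_add power2_eq_square mult_ac)
      qed (use C b \<rho> in auto)
      finally show ?thesis .
    qed
    have bi: "integrable lborel (\<lambda>w. C * (b / \<rho>) ^ ?M * inverse (1 + w ^ 2))"
      by (rule integrable_mult_right[OF integrable_inverse_quadratic])
    have "?R \<in> borel_measurable lborel"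
    proof (rule borel_measurable_diff)
      have [measurable]: "(\<lambda>w. poly Q (b * w)) \<in> borel_measurable borel"
        by (intro borel_measurable_continuous_onI continuous_intros)
      show "(\<lambda>w. ?E \<rho> w (b * w)) \<in> borel_measurable lborel" by measurable
    qed (use Ti in auto)
    then have Ri: "integrable lborel ?R"
      by (rule Bochner_Integration.integrable_bound[OF bi]) (unfold real_norm_def, intro AE_I2 order.trans[OF Rb abs_ge_self])
    have "(LINT w|lborel. ?E \<rho> w (b * w)) = (LINT w|lborel. ?R w + ?T w)" by simp
    also have "\<dots> = (LINT w|lborel. ?R w)"
      by (subst Bochner_Integration.integral_add[OF Ri Ti]) (simp only: T0 add_0_right)
    finally have "norm (LINT w|lborel. ?E \<rho> w (b * w)) \<le> (LINT w|lborel. C * (b / \<rho>) ^ ?M * inverse (1 + w ^ 2))"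
      using Bochner_Integration.integral_norm_bound_integral[OF Ri bi Rb] by (simp only:)
    also have "\<dots> = (C * I) * (b / \<rho>) ^ ?M" by (simp add: I_def)
    finally show ?thesis .
  qed
  then show ?thesis by (rule that)
qed

text \<open>
  The curve is replaced by \<open>y ^ K * poly Q y\<close> with a Taylor error of such high order that it is negligible, and
  \<open>y = b * w\<close> with \<open>b ^ K = a\<close> removes the scale \<open>a\<close> from the first factor. The Jacobian \<open>b\<close> is at most
  \<open>a powr \<alpha>\<close>, as \<open>\<alpha> * K \<le> 1\<close>.
\<close>

lemma local_integral_partial_contact:
  assumes vm: "vanishing_moments n r A" and K: "K \<in> {1..n}"
    and flat: "\<And>l. l < K \<Longrightarrow> nderiv l p 0 = 0" "nderiv K p 0 \<noteq> 0"
    and \<alpha>: "\<alpha> > 0" "\<alpha> * real K \<le> 1"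
  obtains \<delta> C where "\<delta> > 0" "\<And>a. 0 < a \<Longrightarrow> a \<le> 1 \<Longrightarrow>
    norm (local_integral A p \<kappa> h \<delta> \<alpha> a) \<le> C * a powr (\<alpha> + real r * (1 - real K * \<alpha>))"
proof -
  \<comment> \<open>Then \<open>\<alpha> * L \<ge> r + 1\<close>, which outweighs both the division by \<open>a\<close> and the gain \<open>r * (1 - K * \<alpha>) \<le> r\<close> of the main part.\<close>
  define L where "L = Suc (nat \<lceil>(real r + 1) / \<alpha>\<rceil>)"
  have "L \<ge> 1" by (simp add: L_def)
  then obtain Q Cp where Q: "poly Q 0 \<noteq> 0" "Cp \<ge> 0"
    "\<And>y. \<bar>y\<bar> \<le> 1 \<Longrightarrow> \<bar>p y - y ^ K * poly Q y\<bar> \<le> Cp * \<bar>y\<bar> ^ (K + L)"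
    using flat_taylor_factorization[OF p flat, of L] by blast
  define d where "d = \<bar>poly Q 0\<bar> / 2"
  have d: "d > 0" using Q by (simp add: d_def)
  have "isCont (poly Q) 0" by simp
  then obtain e where e: "e > 0" "\<And>y. \<bar>y\<bar> < e \<Longrightarrow> \<bar>poly Q y - poly Q 0\<bar> < d"
    using d unfolding continuous_at_eps_delta by (auto simp: dist_real_def)
  define \<delta> where "\<delta> = min (1 / 2) (e / 4)"
  have \<delta>: "\<delta> > 0" "2 * \<delta> \<le> 1" using e by (auto simp: \<delta>_def)
  have Qd: "\<bar>poly Q y\<bar> \<ge> d" if "\<bar>y\<bar> \<le> 2 * \<delta>" for y
  proof -
    have "\<bar>y\<bar> < e" using that e(1) unfolding \<delta>_def by linarith
    from e(2)[OF this] show ?thesis unfolding d_def by linarith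
  qed
  obtain C1 where C1: "\<And>\<rho> b. 0 < \<rho> \<Longrightarrow> \<rho> \<le> 1 \<Longrightarrow> b > 0 \<Longrightarrow>
    norm (LINT w|lborel. A (w ^ K * poly Q (b * w)) *\<^sub>R (\<kappa> (b * w / \<delta>) *\<^sub>R h (b * w / \<rho>))) \<le>
      C1 * (b / \<rho>) ^ (K * r)"
    using polynomial_curve_integral[OF vm K \<delta>(1) d Qd] by blast
  obtain Lip where Lip: "Lip \<ge> 0" "\<And>u v. \<bar>A u - A v\<bar> \<le> Lip * \<bar>u - v\<bar>" using schwartz_lipschitz[OF A] by metis
  obtain B where B: "B \<ge> 0" "\<And>u. \<bar>\<kappa> u\<bar> \<le> B" using window_bound by blast
  define I where "I = (LINT v|lborel. \<bar>v\<bar> ^ (K + L) * norm (h v))"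
  have I0: "I \<ge> 0" unfolding I_def by (intro integral_nonneg_AE) auto
  let ?e = "\<alpha> + real r * (1 - real K * \<alpha>)"
  have "norm (local_integral A p \<kappa> h \<delta> \<alpha> a) \<le> (\<bar>C1\<bar> + Lip * Cp * B * I) * a powr ?e"
    if a: "0 < a" "a \<le> 1" for a
  proof -
    define \<rho> where "\<rho> = a powr \<alpha>"
    have \<rho>: "0 < \<rho>" "\<rho> \<le> 1" using a \<alpha> by (auto simp: \<rho>_def powr_le1)
    define b where "b = a powr (1 / real K)"
    have b: "b > 0" using a by (simp add: b_def)
    have bK: "b ^ K = a" using a K by (simp add: b_def powr_nat_mult)
    let ?H = "\<lambda>y. \<kappa> (y / \<delta>) *\<^sub>R h (y / \<rho>)"
    let ?G = "\<lambda>y. A (y ^ K * poly Q y / a) *\<^sub>R ?H y"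
    let ?D = "\<lambda>y. (A (p y / a) - A (y ^ K * poly Q y / a)) *\<^sub>R ?H y"
    have [measurable]: "poly Q \<in> borel_measurable borel"
      by (intro borel_measurable_continuous_onI continuous_intros)
    have "(LINT y|lborel. ?G y) = \<bar>b\<bar> *\<^sub>R (LINT w|lborel. ?G (0 + b * w))"
      using b by (intro lborel_integral_real_affine) auto
    also have "(\<lambda>w. ?G (0 + b * w)) = (\<lambda>w. A (w ^ K * poly Q (b * w)) *\<^sub>R (\<kappa> (b * w / \<delta>) *\<^sub>R h (b * w / \<rho>)))"
      using a by (simp add: power_mult_distrib bK fun_eq_iff)
    finally have "norm (LINT y|lborel. ?G y) \<le> b * (C1 * (b / \<rho>) ^ (K * r))"
      using C1[OF \<rho> b] b by simp
    also have "\<dots> \<le> b * (\<bar>C1\<bar> * (b / \<rho>) ^ (K * r))"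
      using b \<rho> by (intro mult_left_mono mult_right_mono) auto
    also have "\<dots> = \<bar>C1\<bar> * (b * (b / \<rho>) ^ (K * r))" by simp
    also have "b * (b / \<rho>) ^ (K * r) = a powr (1 / real K + real r * (1 - real K * \<alpha>))"
    proof -
      have "b / \<rho> = a powr (1 / real K - \<alpha>)" using a by (simp add: b_def \<rho>_def powr_diff)
      then have "(b / \<rho>) ^ (K * r) = a powr ((1 / real K - \<alpha>) * real (K * r))"
        using a by (simp add: powr_nat_mult)
      also have "(1 / real K - \<alpha>) * real (K * r) = real r * (1 - real K * \<alpha>)"
        using K by (simp add: field_simps)
      finally show ?thesis using a by (simp add: b_def powr_add)
    qed
    also have "\<bar>C1\<bar> * a powr (1 / real K + real r * (1 - real K * \<alpha>)) \<le> \<bar>C1\<bar> * a powr ?e"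
    proof (intro mult_left_mono powr_mono' a(2) less_imp_le[OF a(1)])
      show "?e \<le> 1 / real K + real r * (1 - real K * \<alpha>)" using \<alpha> K by (simp add: field_simps)
    qed simp
    finally have 1: "norm (LINT y|lborel. ?G y) \<le> \<bar>C1\<bar> * a powr ?e" .
    \<comment> \<open>Outside \<open>{-1..1}\<close>, where the Taylor estimate is not available, the cutoff vanishes.\<close>
    have nb: "norm (?D y) \<le> Lip * Cp * B / a * (\<bar>y\<bar> ^ (K + L) * norm (h (y / \<rho>)))" for y
    proof (cases "\<bar>y\<bar> \<le> 1")
      case True
      have "\<bar>A (p y / a) - A (y ^ K * poly Q y / a)\<bar> \<le> Lip * \<bar>p y / a - y ^ K * poly Q y / a\<bar>" by (rule Lip)
      also have "\<bar>p y / a - y ^ K * poly Q y / a\<bar> = \<bar>p y - y ^ K * poly Q y\<bar> / a"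
        using a by (simp add: diff_divide_distrib[symmetric])
      also have "Lip * (\<bar>p y - y ^ K * poly Q y\<bar> / a) \<le> Lip * (Cp * \<bar>y\<bar> ^ (K + L) / a)"
        using a Lip by (intro mult_left_mono divide_right_mono Q True) auto
      finally have "norm (?D y) \<le> Lip * (Cp * \<bar>y\<bar> ^ (K + L) / a) * (B * norm (h (y / \<rho>)))"
        unfolding norm_scaleR real_norm_def using a Lip Q
        by (intro mult_mono mult_right_mono B) auto
      then show ?thesis by (simp add: mult_ac)
    next
      case False
      then show ?thesis using window_vanishes[OF \<delta>(1), of y] \<delta>(2) Lip Q B a by simp
    qed
    have wi: "integrable lborel (\<lambda>y. Lip * Cp * B / a * (\<bar>y\<bar> ^ (K + L) * norm (h (y / \<rho>))))"
      by (intro integrable_mult_right scaled_weight_integral(1) h \<rho>)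
    have Di: "integrable lborel ?D"
    proof (rule Bochner_Integration.integrable_bound[OF wi])
      show "AE y in lborel. norm (?D y) \<le> norm (Lip * Cp * B / a * (\<bar>y\<bar> ^ (K + L) * norm (h (y / \<rho>))))"
        unfolding real_norm_def by (intro AE_I2 order.trans[OF nb abs_ge_self])
    qed measurable
    have "norm (LINT y|lborel. ?D y) \<le> (LINT y|lborel. Lip * Cp * B / a * (\<bar>y\<bar> ^ (K + L) * norm (h (y / \<rho>))))"
      by (rule Bochner_Integration.integral_norm_bound_integral[OF Di wi nb])
    also have "\<dots> = Lip * Cp * B / a * (\<rho> ^ (K + L + 1) * I)"
      unfolding I_def by (simp only: integral_mult_right_zero scaled_weight_integral(2)[OF h \<rho>(1)])
    also have "\<dots> = (Lip * Cp * B * I) * (\<rho> ^ (K + L + 1) / a)" by simp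
    also have "\<rho> ^ (K + L + 1) / a = a powr (\<alpha> * real (K + L + 1) - 1)"
      using a by (simp add: \<rho>_def powr_nat_mult powr_diff del: power_Suc of_nat_add of_nat_Suc)
    also have "(Lip * Cp * B * I) * a powr (\<alpha> * real (K + L + 1) - 1) \<le> (Lip * Cp * B * I) * a powr ?e"
    proof (intro mult_left_mono powr_mono' a(2) less_imp_le[OF a(1)])
      have "(real r + 1) / \<alpha> \<le> real L" unfolding L_def using real_nat_ceiling_ge[of "(real r + 1) / \<alpha>"] by simp
      then have "real r + 1 \<le> \<alpha> * real L" using \<alpha> by (simp add: field_simps)
      moreover have "real r * (1 - real K * \<alpha>) \<le> real r" using \<alpha> by (simp add: mult_left_le)
      moreover have "\<alpha> * real (K + L + 1) = \<alpha> * real K + \<alpha> * real L + \<alpha>" by (simp add: algebra_simps)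
      moreover have "\<alpha> * real K \<ge> 0" using \<alpha> by simp
      ultimately show "?e \<le> \<alpha> * real (K + L + 1) - 1" by linarith
    qed (use Lip Q B I0 in auto)
    finally have 2: "norm (LINT y|lborel. ?D y) \<le> (Lip * Cp * B * I) * a powr ?e" .
    obtain BA where BA: "BA \<ge> 0" "\<And>u. \<bar>A u\<bar> \<le> BA" using schwartz_decay[OF A, of 0 0] by auto
    have hB: "integrable lborel (\<lambda>y. BA * B * (\<bar>y\<bar> ^ 0 * norm (h (y / \<rho>))))"
      by (intro integrable_mult_right scaled_weight_integral(1) h \<rho>)
    have Gi: "integrable lborel ?G"
    proof (rule Bochner_Integration.integrable_bound[OF hB])
      have "norm (?G y) \<le> BA * (B * norm (h (y / \<rho>)))" for y
        unfolding norm_scaleR real_norm_def using BA B by (intro mult_mono mult_right_mono BA B) auto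
      then show "AE y in lborel. norm (?G y) \<le> norm (BA * B * (\<bar>y\<bar> ^ 0 * norm (h (y / \<rho>))))"
        using BA B by (intro AE_I2) (simp add: mult.assoc)
    qed measurable
    have "local_integral A p \<kappa> h \<delta> \<alpha> a = (LINT y|lborel. ?D y + ?G y)"
      by (simp add: local_integral_def \<rho>_def algebra_simps)
    also have "\<dots> = (LINT y|lborel. ?D y) + (LINT y|lborel. ?G y)"
      by (rule Bochner_Integration.integral_add[OF Di Gi])
    finally have "norm (local_integral A p \<kappa> h \<delta> \<alpha> a) \<le> (Lip * Cp * B * I) * a powr ?e + \<bar>C1\<bar> * a powr ?e"
      using norm_triangle_mono[OF 2 1] by simp
    then show ?thesis by (simp add: distrib_right add.commute)
  qed
  then show ?thesis using that \<delta>(1) by blast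
qed

end

section \<open>The Taylorlet transform\<close>

definition shear_poly :: "nat \<Rightarrow> (nat \<Rightarrow> real) \<Rightarrow> real poly" where
  "shear_poly n s = (\<Sum>l\<le>n. monom (s l / fact l) l)"

definition deviation :: "nat \<Rightarrow> (nat \<Rightarrow> real) \<Rightarrow> real \<Rightarrow> (real \<Rightarrow> real) \<Rightarrow> real \<Rightarrow> real" where
  "deviation n s t q y = q (y + t) - poly (shear_poly n s) y"

text \<open>
  So the highest approximation order is the order to which the deviation vanishes at \<open>0\<close>.
\<close>

lemma deviation_nderiv:
  assumes q: "smooth q"
  shows "smooth (deviation n s t q)"
    and "l \<le> n \<Longrightarrow> nderiv l (deviation n s t q) 0 = (deriv ^^ l) q t - s l"
proof -
  let ?S = "shear_poly n s"
  have 1: "smooth (\<lambda>y. q (y + t))" "nderiv l (\<lambda>y. q (y + t)) = (\<lambda>y. nderiv l q (y + t))"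
    using smooth_affine(1)[OF q, of 1 t] smooth_affine(2)[OF q, of l 1 t] by simp_all
  have sp: "smooth (poly ?S)" by (rule smooth_poly)
  have 2: "smooth (\<lambda>y. - poly ?S y)" "nderiv l (\<lambda>y. - poly ?S y) = (\<lambda>y. - nderiv l (poly ?S) y)"
    using smooth_scaleR(1)[OF sp, of "-1"] smooth_scaleR(2)[OF sp, of l "-1"] by simp_all
  have eq: "deviation n s t q = (\<lambda>y. q (y + t) + - poly ?S y)" by (simp add: deviation_def fun_eq_iff)
  show "smooth (deviation n s t q)" unfolding eq by (rule smooth_add(1)[OF 1(1) 2(1)])
  assume l: "l \<le> n"
  have "coeff ?S l = s l / fact l" using l by (simp add: shear_poly_def coeff_sum)
  then have "nderiv l (poly ?S) 0 = s l"
    by (simp add: smooth_poly poly_0_coeff_0 coeff_higher_pderiv pochhammer_fact[symmetric])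
  then show "nderiv l (deviation n s t q) 0 = (deriv ^^ l) q t - s l"
    unfolding eq smooth_add(2)[OF 1(1) 2(1)] higher_deriv_eq_nderiv[OF q] by (simp add: 1 2)
qed

lemma taylorlet_tensor:
  "taylorlet n \<alpha> (tensor g h) a s t = (\<lambda>x. of_real (a powr (- (1 + \<alpha>) / 2)) *
     sheared (shear_poly n s) t (\<lambda>u. g (u / a)) (\<lambda>y. h (y / a powr \<alpha>)) x)"
  by (simp add: taylorlet_def tensor_def sheared_def shear_poly_def poly_sum poly_monom
      scaleR_conv_of_real fun_eq_iff)

text \<open>
  The amplitude \<open>a powr (- (1 + \<alpha>) / 2)\<close> of the Taylorlet only shifts the exponent, so the error remains of arbitrarily
  high order \<open>E\<close>.
\<close>

lemma taylorlet_transform_representation: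
  assumes f: "tempered_distribution f"
    and pairing: "\<And>\<phi>. test_function \<phi> \<Longrightarrow> f \<phi> = feasible_pairing \<sigma> j q \<phi>"
    and \<sigma>: "\<sigma> \<in> {1, -1}" and q: "smooth q" and \<alpha>: "\<alpha> > 0" and \<delta>: "\<delta> > 0"
    and A: "schwartz A" "nderiv j A = g" and h: "schwartz h"
    and \<kappa>: "bounded_smooth \<kappa>" "\<And>u. \<bar>u\<bar> \<le> 1 \<Longrightarrow> \<kappa> u = 1" "\<And>u. \<bar>u\<bar> \<ge> 2 \<Longrightarrow> \<kappa> u = 0"
  obtains C where "\<And>a. 0 < a \<Longrightarrow> a \<le> 1 \<Longrightarrow>
    norm (taylorlet_transform n \<alpha> (tensor g h) f a s t -
      ((- \<sigma>) ^ j * a powr (real j - (1 + \<alpha>) / 2)) *\<^sub>R local_integral A (deviation n s t q) \<kappa> h \<delta> \<alpha> a)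
    \<le> C * a powr E"
proof -
  define N where "N = nat \<lceil>E + (1 + \<alpha>) / 2\<rceil>"
  let ?S = "shear_poly n s"
  obtain C where C: "\<And>a. 0 < a \<Longrightarrow> a \<le> 1 \<Longrightarrow>
    norm (f (sheared ?S t (\<lambda>u. g (u / a)) (\<lambda>y. h (y / a powr \<alpha>))) -
      ((- \<sigma>) ^ j * a ^ j) *\<^sub>R local_integral A (deviation n s t q) \<kappa> h \<delta> \<alpha> a) \<le> C * a ^ N"
    using tempered_feasible_representation[OF f pairing \<sigma> smooth_continuous[OF q] \<alpha> \<delta> A h \<kappa>, of ?S t N]
    unfolding local_integral_def deviation_def by blast
  have g: "schwartz g" using schwartz_nderiv[OF A(1), of j] A(2) by simp
  have "norm (taylorlet_transform n \<alpha> (tensor g h) f a s t -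
      ((- \<sigma>) ^ j * a powr (real j - (1 + \<alpha>) / 2)) *\<^sub>R local_integral A (deviation n s t q) \<kappa> h \<delta> \<alpha> a)
    \<le> \<bar>C\<bar> * a powr E" if a: "0 < a" "a \<le> 1" for a
  proof -
    let ?c = "a powr (- (1 + \<alpha>) / 2)"
    let ?\<Theta> = "sheared ?S t (\<lambda>u. g (u / a)) (\<lambda>y. h (y / a powr \<alpha>))"
    let ?J = "local_integral A (deviation n s t q) \<kappa> h \<delta> \<alpha> a"
    have "schwartz ?\<Theta>"
      using a \<alpha> by (intro schwartz_sheared schwartz_dilation g h) (auto simp: powr_le1)
    then have "taylorlet_transform n \<alpha> (tensor g h) f a s t = of_real ?c * f ?\<Theta>"
      using f unfolding taylorlet_transform_def taylorlet_tensor tempered_distribution_def by blast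
    moreover have "a powr (real j - (1 + \<alpha>) / 2) = ?c * a ^ j"
    proof -
      have "real j - (1 + \<alpha>) / 2 = - (1 + \<alpha>) / 2 + real j" by (simp add: field_simps)
      then show ?thesis using a by (simp only: powr_add powr_realpow)
    qed
    ultimately have "taylorlet_transform n \<alpha> (tensor g h) f a s t -
        ((- \<sigma>) ^ j * a powr (real j - (1 + \<alpha>) / 2)) *\<^sub>R ?J = ?c *\<^sub>R (f ?\<Theta> - ((- \<sigma>) ^ j * a ^ j) *\<^sub>R ?J)"
      by (simp add: scaleR_conv_of_real algebra_simps)
    then have "norm (taylorlet_transform n \<alpha> (tensor g h) f a s t -
        ((- \<sigma>) ^ j * a powr (real j - (1 + \<alpha>) / 2)) *\<^sub>R ?J) = ?c * norm (f ?\<Theta> - ((- \<sigma>) ^ j * a ^ j) *\<^sub>R ?J)"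
      by simp
    also have "\<dots> \<le> ?c * (C * a ^ N)" by (intro mult_left_mono C a) auto
    also have "\<dots> = C * a powr (real N - (1 + \<alpha>) / 2)"
    proof -
      have "real N - (1 + \<alpha>) / 2 = - (1 + \<alpha>) / 2 + real N" by (simp add: field_simps)
      then show ?thesis using a by (simp only: powr_add powr_realpow mult_ac)
    qed
    also have "\<dots> \<le> \<bar>C\<bar> * a powr (real N - (1 + \<alpha>) / 2)" by (intro mult_right_mono) auto
    also have "\<dots> \<le> \<bar>C\<bar> * a powr E"
    proof (intro mult_left_mono powr_mono' a(2) less_imp_le[OF a(1)])
      show "E \<le> real N - (1 + \<alpha>) / 2"
        unfolding N_def using real_nat_ceiling_ge[of "E + (1 + \<alpha>) / 2"] by simp
    qed simp
    finally show ?thesis .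
  qed
  then show ?thesis by (rule that)
qed

lemma bigo_at_right_0I:
  fixes F :: "real \<Rightarrow> 'b::real_normed_vector"
  assumes "\<And>a. 0 < a \<Longrightarrow> a \<le> 1 \<Longrightarrow> norm (F a) \<le> C * a powr e"
  shows "(\<lambda>a. norm (F a)) \<in> O[at_right 0](\<lambda>a. a powr e)"
proof (rule bigoI)
  show "eventually (\<lambda>a. norm (norm (F a)) \<le> C * norm (a powr e)) (at_right 0)"
    using assms by (intro eventually_at_rightI[of 0 1]) auto
qed

lemma exact_orderI:
  assumes z: "z \<noteq> 0" and \<beta>: "\<beta> > 0"
    and F: "\<And>a. 0 < a \<Longrightarrow> a \<le> 1 \<Longrightarrow> norm (F a - (a powr e) *\<^sub>R z) \<le> C * a powr (e + \<beta>)"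
  shows "exact_order F e"
proof -
  define \<epsilon> where "\<epsilon> = norm z / 2"
  have \<epsilon>: "\<epsilon> > 0" using z by (simp add: \<epsilon>_def)
  \<comment> \<open>Below \<open>a0\<close> the error is at most half of the main term.\<close>
  define a0 where "a0 = min 1 ((\<epsilon> / (\<bar>C\<bar> + 1)) powr (1 / \<beta>))"
  have "\<epsilon> * a powr e \<le> norm (F a) \<and> norm (F a) \<le> 3 * \<epsilon> * a powr e" if a: "0 < a" "a < a0" for a
  proof -
    have a1: "a \<le> 1" using a by (simp add: a0_def)
    have "a powr \<beta> \<le> ((\<epsilon> / (\<bar>C\<bar> + 1)) powr (1 / \<beta>)) powr \<beta>"
      using a \<beta> by (intro powr_mono2) (auto simp: a0_def)
    also have "\<dots> = \<epsilon> / (\<bar>C\<bar> + 1)" using \<beta> \<epsilon> by (simp add: powr_powr)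
    finally have "(\<bar>C\<bar> + 1) * a powr \<beta> \<le> \<epsilon>" by (simp add: field_simps)
    moreover have "C * a powr \<beta> \<le> (\<bar>C\<bar> + 1) * a powr \<beta>" by (intro mult_right_mono) auto
    ultimately have "C * a powr \<beta> \<le> \<epsilon>" by linarith
    then have "C * a powr \<beta> * a powr e \<le> \<epsilon> * a powr e" by (intro mult_right_mono) auto
    then have 1: "norm (F a - (a powr e) *\<^sub>R z) \<le> \<epsilon> * a powr e"
      using F[OF a(1) a1] by (simp add: powr_add mult_ac)
    have 2: "norm ((a powr e) *\<^sub>R z) = 2 * (\<epsilon> * a powr e)" by (simp add: \<epsilon>_def)
    show ?thesis
      using 1 2 norm_triangle_ineq2[of "(a powr e) *\<^sub>R z" "F a"] norm_triangle_ineq2[of "F a" "(a powr e) *\<^sub>R z"]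
        norm_minus_commute[of "F a" "(a powr e) *\<^sub>R z"] by linarith
  qed
  moreover have "a0 > 0" using \<epsilon> by (simp add: a0_def)
  ultimately show ?thesis using \<epsilon> unfolding exact_order_def
    by (intro exI[of _ \<epsilon>] conjI exI[of _ "3 * \<epsilon>"] exI[of _ a0]) auto
qed

theorem theorem9:
  fixes r n j :: nat
    and \<tau> :: "real \<times> real \<Rightarrow> complex"
    and f :: "(real \<times> real \<Rightarrow> complex) \<Rightarrow> complex"
    and q :: "real \<Rightarrow> real"
    and s :: "nat \<Rightarrow> real"
    and t :: real
  assumes "r \<ge> 1" and "n \<ge> 1"
    and "analyzing_taylorlet n r \<tau>"
    and "j < r"
    and "tempered_distribution f"
    and "feasible j q f"
  shows "(\<forall>\<alpha>>0. s 0 \<noteq> q t \<longrightarrow>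
            (\<forall>N>0. (\<lambda>a. norm (taylorlet_transform n \<alpha> \<tau> f a s t))
                      \<in> O[at_right 0](\<lambda>a. a powr N))) \<and>
         (\<forall>\<alpha> k. 0 < \<alpha> \<and> \<alpha> < 1 / real n \<and> k < n \<and> highest_approx_order n q s t k \<longrightarrow>
            (\<lambda>a. norm (taylorlet_transform n \<alpha> \<tau> f a s t))
              \<in> O[at_right 0](\<lambda>a. a powr (real j + (\<alpha> - 1) / 2 +
                    (real r - real j) * (1 - (real k + 1) * \<alpha>)))) \<and>
         (\<forall>\<alpha>. \<alpha> > 1 / (real n + 1) \<and> restrictive_taylorlet n r \<tau> \<and>
              highest_approx_order n q s t n \<longrightarrow>
            exact_order (\<lambda>a. taylorlet_transform n \<alpha> \<tau> f a s t) (real j + (\<alpha> - 1) / 2))"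
proof -
  from \<open>feasible j q f\<close> obtain \<sigma> where q: "smooth q" and \<sigma>: "\<sigma> \<in> {1, -1}"
    and pairing: "\<And>\<phi>. test_function \<phi> \<Longrightarrow> f \<phi> = feasible_pairing \<sigma> j q \<phi>"
    unfolding feasible_def by blast
  obtain \<kappa> :: "real \<Rightarrow> real" where \<kappa>: "bounded_smooth \<kappa>" "\<And>u. \<bar>u\<bar> \<le> 1 \<Longrightarrow> \<kappa> u = 1" "\<And>u. \<bar>u\<bar> \<ge> 2 \<Longrightarrow> \<kappa> u = 0"
    using smooth_cutoff unfolding bounded_smooth_def by metis
  define p where "p = deviation n s t q"
  have p: "smooth p" and dp: "\<And>l. l \<le> n \<Longrightarrow> nderiv l p 0 = (deriv ^^ l) q t - s l"
    unfolding p_def by (intro deviation_nderiv q; assumption)+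
  have represent: "\<exists>C. \<forall>a. 0 < a \<and> a \<le> 1 \<longrightarrow>
      norm (taylorlet_transform n \<alpha> (tensor g h) f a s t -
        ((- \<sigma>) ^ j * a powr (real j - (1 + \<alpha>) / 2)) *\<^sub>R local_integral A p \<kappa> h \<delta> \<alpha> a) \<le> C * a powr E"
    if "\<alpha> > 0" "\<delta> > 0" "schwartz A" "nderiv j A = g" "schwartz h" for \<alpha> \<delta> A g h E
    by (rule taylorlet_transform_representation[OF \<open>tempered_distribution f\<close> pairing \<sigma> q that \<kappa>,
          of n s t E, folded p_def]) blast+
  obtain g h where \<tau>: "\<tau> = tensor g h" and g: "schwartz g" and h: "schwartz h" and vm: "vanishing_moments n r g"
    using \<open>analyzing_taylorlet n r \<tau>\<close> unfolding analyzing_taylorlet_def by blast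
  define A where "A = (int_plus ^^ j) g"
  have primitive: "schwartz A" "nderiv j A = g" and vmA: "vanishing_moments n (r - j) A"
    using funpow_int_plus[OF g vm \<open>n \<ge> 1\<close>, of j] \<open>j < r\<close> by (auto simp: A_def)
  interpret windowed_curve A p \<kappa> h
    by unfold_locales (use primitive p h \<kappa> in auto)

  have upper: "(\<lambda>a. norm (taylorlet_transform n \<alpha> \<tau> f a s t)) \<in> O[at_right 0](\<lambda>a. a powr E)"
    if \<alpha>: "\<alpha> > 0" and \<delta>: "\<delta> > 0" and E: "E = real j - (1 + \<alpha>) / 2 + e"
      and J: "\<And>a. 0 < a \<Longrightarrow> a \<le> 1 \<Longrightarrow> norm (local_integral A p \<kappa> h \<delta> \<alpha> a) \<le> C1 * a powr e"
    for \<alpha> \<delta> e E C1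
  proof -
    let ?J = "local_integral A p \<kappa> h \<delta> \<alpha>" and ?c = "\<lambda>a. (- \<sigma>) ^ j * a powr (real j - (1 + \<alpha>) / 2)"
    obtain C where C: "\<And>a. 0 < a \<Longrightarrow> a \<le> 1 \<Longrightarrow>
      norm (taylorlet_transform n \<alpha> \<tau> f a s t - ?c a *\<^sub>R ?J a) \<le> C * a powr E"
      using represent[OF \<alpha> \<delta> primitive h] unfolding \<tau> by blast
    have "norm (taylorlet_transform n \<alpha> \<tau> f a s t) \<le> (C + C1) * a powr E" if a: "0 < a" "a \<le> 1" for a
    proof -
      have "norm (?c a *\<^sub>R ?J a) = a powr (real j - (1 + \<alpha>) / 2) * norm (?J a)"
        using \<sigma> by (auto simp: abs_mult power_abs)
      also have "\<dots> \<le> a powr (real j - (1 + \<alpha>) / 2) * (C1 * a powr e)"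
        by (intro mult_left_mono J a) auto
      finally have "norm (?c a *\<^sub>R ?J a) \<le> C1 * a powr E" by (simp add: E powr_add mult_ac)
      with C[OF a] norm_triangle_sub[of "taylorlet_transform n \<alpha> \<tau> f a s t" "?c a *\<^sub>R ?J a"]
      show ?thesis by (simp add: distrib_right)
    qed
    then show ?thesis by (rule bigo_at_right_0I)
  qed

  have part1: "(\<lambda>a. norm (taylorlet_transform n \<alpha> \<tau> f a s t)) \<in> O[at_right 0](\<lambda>a. a powr N)"
    if \<alpha>: "\<alpha> > 0" and s0: "s 0 \<noteq> q t" for \<alpha> N
  proof -
    have "p 0 \<noteq> 0" using dp[of 0] s0 by simp
    then obtain \<delta> where \<delta>: "\<delta> > 0"
      "\<And>N. \<exists>C. \<forall>a. 0 < a \<and> a \<le> 1 \<longrightarrow> norm (local_integral A p \<kappa> h \<delta> \<alpha> a) \<le> C * a ^ N"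
      using local_integral_off_curve[of \<alpha>] by metis
    \<comment> \<open>\<open>N\<close> corrected by the exponent of the prefactor of \<open>local_integral\<close>.\<close>
    define e where "e = N - (real j - (1 + \<alpha>) / 2)"
    obtain C where C: "\<And>a. 0 < a \<Longrightarrow> a \<le> 1 \<Longrightarrow> norm (local_integral A p \<kappa> h \<delta> \<alpha> a) \<le> C * a ^ nat \<lceil>e\<rceil>"
      using \<delta>(2) by blast
    show ?thesis
    proof (rule upper[OF \<alpha> \<delta>(1)])
      show "N = real j - (1 + \<alpha>) / 2 + e" by (simp add: e_def)
      fix a :: real assume a: "0 < a" "a \<le> 1"
      have "C * a ^ nat \<lceil>e\<rceil> \<le> \<bar>C\<bar> * a ^ nat \<lceil>e\<rceil>" using a by (intro mult_right_mono) auto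
      also have "\<dots> = \<bar>C\<bar> * a powr real (nat \<lceil>e\<rceil>)" using a by (simp add: powr_realpow)
      also have "\<dots> \<le> \<bar>C\<bar> * a powr e" by (intro mult_left_mono powr_mono' a(2) less_imp_le[OF a(1)] real_nat_ceiling_ge) auto
      finally show "norm (local_integral A p \<kappa> h \<delta> \<alpha> a) \<le> \<bar>C\<bar> * a powr e" using C[OF a] by linarith
    qed
  qed

  have part2: "(\<lambda>a. norm (taylorlet_transform n \<alpha> \<tau> f a s t)) \<in> O[at_right 0](\<lambda>a. a powr (real j + (\<alpha> - 1) / 2 +
                    (real r - real j) * (1 - (real k + 1) * \<alpha>)))"
    if \<alpha>: "0 < \<alpha>" "\<alpha> < 1 / real n" and k: "k < n" and ord: "highest_approx_order n q s t k" for \<alpha> k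
  proof -
    have K: "Suc k \<in> {1..n}" using k by simp
    have flat: "nderiv l p 0 = 0" if "l < Suc k" for l
      using ord that dp[of l] by (auto simp: highest_approx_order_def)
    have tangent: "nderiv (Suc k) p 0 \<noteq> 0"
      using ord k dp[of "Suc k"] by (auto simp: highest_approx_order_def)
    have "\<alpha> * real (Suc k) \<le> \<alpha> * real n" using \<alpha> k by (intro mult_left_mono) auto
    also have "\<dots> \<le> 1" using \<alpha> \<open>n \<ge> 1\<close> by (simp add: field_simps)
    finally have le1: "\<alpha> * real (Suc k) \<le> 1" .
    obtain \<delta> C where \<delta>: "\<delta> > 0" and C: "\<And>a. 0 < a \<Longrightarrow> a \<le> 1 \<Longrightarrow>
      norm (local_integral A p \<kappa> h \<delta> \<alpha> a) \<le> C * a powr (\<alpha> + real (r - j) * (1 - real (Suc k) * \<alpha>))"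
      using local_integral_partial_contact[OF vmA K flat tangent \<alpha>(1) le1] by blast
    show ?thesis
      by (rule upper[OF \<alpha>(1) \<delta> _ C]) (use \<open>j < r\<close> in \<open>simp_all add: of_nat_diff field_simps\<close>)
  qed

  have part3: "exact_order (\<lambda>a. taylorlet_transform n \<alpha> \<tau> f a s t) (real j + (\<alpha> - 1) / 2)"
    if \<alpha>: "\<alpha> > 1 / (real n + 1)" and restr: "restrictive_taylorlet n r \<tau>"
      and ord: "highest_approx_order n q s t n" for \<alpha>
  proof -
    \<comment> \<open>A tensor product does not determine its factors; the restrictive ones are used here.\<close>
    obtain g h where \<tau>: "\<tau> = tensor g h" and g: "schwartz g" and h: "schwartz h" and vm: "vanishing_moments n r g"
      and ne: "\<And>j. j \<le> r \<Longrightarrow> (int_plus ^^ j) g 0 \<noteq> 0" "(LINT t|lborel. h t) \<noteq> 0"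
      using restr unfolding restrictive_taylorlet_def by blast
    define A where "A = (int_plus ^^ j) g"
    have primitive: "schwartz A" "nderiv j A = g"
      using funpow_int_plus[OF g vm \<open>n \<ge> 1\<close>, of j] \<open>j < r\<close> by (auto simp: A_def)
    interpret R: windowed_curve A p \<kappa> h
      by unfold_locales (use primitive p h \<kappa> in auto)
    have "1 / (real n + 1) > 0" by simp
    then have \<alpha>0: "\<alpha> > 0" using \<alpha> by linarith
    define \<beta> where "\<beta> = \<alpha> * (real n + 1) - 1"
    have \<beta>: "\<beta> > 0" using \<alpha> by (simp add: \<beta>_def field_simps)
    have flat: "nderiv l p 0 = 0" if "l \<le> n" for l
      using ord that dp[of l] by (auto simp: highest_approx_order_def)
    let ?H = "LINT v|lborel. h v" and ?J = "local_integral A p \<kappa> h (1 / 2) \<alpha>"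
    let ?e0 = "real j - (1 + \<alpha>) / 2" and ?E = "real j + (\<alpha> - 1) / 2"
    obtain C1 where C1: "\<And>a. 0 < a \<Longrightarrow> a \<le> 1 \<Longrightarrow>
      norm (?J a - (a powr \<alpha> * A 0) *\<^sub>R ?H) \<le> C1 * a powr (\<alpha> + \<beta>)"
      using R.local_integral_osculating[where \<alpha> = \<alpha>, OF flat] unfolding \<beta>_def by blast
    obtain C where C: "\<And>a. 0 < a \<Longrightarrow> a \<le> 1 \<Longrightarrow>
      norm (taylorlet_transform n \<alpha> \<tau> f a s t - ((- \<sigma>) ^ j * a powr ?e0) *\<^sub>R ?J a) \<le> C * a powr (?E + \<beta>)"
      using represent[OF \<alpha>0 half_gt_zero[OF zero_less_one] primitive h] unfolding \<tau> by blast
    show ?thesis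
    proof (rule exact_orderI[OF _ \<beta>])
      show "((- \<sigma>) ^ j * A 0) *\<^sub>R ?H \<noteq> 0"
        using ne(1)[of j] ne(2) \<sigma> \<open>j < r\<close> by (auto simp: A_def)
      fix a :: real assume a: "0 < a" "a \<le> 1"
      let ?c = "(- \<sigma>) ^ j * a powr ?e0"
      have "norm (?c *\<^sub>R (?J a - (a powr \<alpha> * A 0) *\<^sub>R ?H)) = a powr ?e0 * norm (?J a - (a powr \<alpha> * A 0) *\<^sub>R ?H)"
        using \<sigma> by (auto simp: abs_mult power_abs)
      also have "\<dots> \<le> a powr ?e0 * (C1 * a powr (\<alpha> + \<beta>))" by (intro mult_left_mono C1 a) auto
      also have "\<dots> = C1 * a powr (?e0 + (\<alpha> + \<beta>))" by (simp add: powr_add mult_ac)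
      also have "?e0 + (\<alpha> + \<beta>) = ?E + \<beta>" by (simp add: field_simps)
      finally have 2: "norm (?c *\<^sub>R (?J a - (a powr \<alpha> * A 0) *\<^sub>R ?H)) \<le> C1 * a powr (?E + \<beta>)" .
      have "a powr ?e0 * a powr \<alpha> = a powr ?E"
        unfolding powr_add[symmetric] by (simp add: field_simps)
      then have "(a powr ?E) *\<^sub>R (((- \<sigma>) ^ j * A 0) *\<^sub>R ?H) = ?c *\<^sub>R ((a powr \<alpha> * A 0) *\<^sub>R ?H)"
        by (simp add: mult_ac flip: \<open>a powr ?e0 * a powr \<alpha> = a powr ?E\<close>)
      then have split: "taylorlet_transform n \<alpha> \<tau> f a s t - (a powr ?E) *\<^sub>R (((- \<sigma>) ^ j * A 0) *\<^sub>R ?H) =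
        (taylorlet_transform n \<alpha> \<tau> f a s t - ?c *\<^sub>R ?J a) + ?c *\<^sub>R (?J a - (a powr \<alpha> * A 0) *\<^sub>R ?H)"
        by (simp only: scaleR_diff_right) simp
      show "norm (taylorlet_transform n \<alpha> \<tau> f a s t - (a powr ?E) *\<^sub>R (((- \<sigma>) ^ j * A 0) *\<^sub>R ?H)) \<le>
          (C + C1) * a powr (?E + \<beta>)"
        unfolding split distrib_right by (rule norm_triangle_mono[OF C[OF a] 2])
    qed
  qed
  show ?thesis using part1 part2 part3 by blast
qed

end
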